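(* Let $H$ be a $d$-dimensional semisimple Hopf algebra over an algebraically closed field $k$ of characteristic $0$, with irreducible characters $\chi_i$ of degrees $d_i$, and let $n\ge2$. Let $z_n\in H$ be the element built from the idempotent integral of $H$ (defined in the context). Define the symmetric form $\beta^Z_n$ on the center $Z(H)$ by $\beta_n^Z(z,z')=\langle t_n,zz'\rangle$, where $$t_n=\sum_i d_i^{\,n-1-(n\bmod 2)}\chi_i .$$ Then the corresponding central Casimir element satisfies $$Cas^Z_{\beta_n}=z_n .$$ Moreover, $$d^{n-1}\Psi(Cas^Z_{\beta_n})=d^{\,n\bmod 2}\underbrace{f_{rob}\bullet\cdots\bullet f_{rob}}_{\frac{n-(n\bmod 2)}{2}}=\sum_i\frac{d^{n-1}}{d_i^{\,n-1-(n\bmod 2)}}\chi_i .$$ Here $f_{rob}=\sum_i\frac{d}{d_i}\chi_i$. In particular $t_2=\lambda$ and $Cas^Z_{\beta_2}=z_2$.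
   Context: $H$ has comultiplication $\Delta(h)=\sum h_1\otimes h_2$ (Sweedler notation), counit $\varepsilon$ and antipode $S$. $\Lambda$ is the idempotent integral: $h\Lambda=\varepsilon(h)\Lambda=\Lambda h$ for all $h\in H$, $\varepsilon(\Lambda)=1$. Let $\Lambda^1,\Lambda^2,\dots$ be copies of $\Lambda$ with $\Delta(\Lambda^i)=\sum\Lambda^i_1\otimes\Lambda^i_2$. For $n\ge1$, $z_n=\sum\Lambda^1_1\cdots\Lambda^n_1\,S(\Lambda^1_2)\cdots S(\Lambda^n_2)$. $\lambda=\chi_H=\sum_i d_i\chi_i$ is the character of the left regular representation (the integral of $H^*$ with $\langle\lambda,\Lambda\rangle=1$). For $p\in H^*$, $a\in H$, $\langle p\leftharpoonup a,a'\rangle=\langle p,aa'\rangle$. The Frobenius map is the bijection $\Psi:H\to H^*$, $\Psi(h)=\lambda\leftharpoonup S(h)$, with inverse $\Psi^{-1}(p)=\sum\langle p,\Lambda_1\rangle\Lambda_2$. The convolution product on $H^*$ is $p\bullet q=d\,\Psi(\Psi^{-1}(p)\Psi^{-1}(q))$. For a finite-dimensional algebra $A$ with a non-degenerate associative symmetric bilinear form $\beta$, let $\{r_i\},\{l_i\}$ be dual bases for $\beta$, i.e. $\beta(r_i,l_j)=\delta_{ij}$. The central Casimir element is $Cas_\beta=\sum_i r_il_i\in Z(A)$; it is independent of the choice of dual bases. $Cas^Z_{\beta_n}$ denotes the central Casimir element for $A=Z(H)$ and $\beta=\beta_n^Z$. Here $n\bmod 2\in\{0,1\}$. *)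

theory Defs
  imports
    "HOL-Library.Poly_Mapping"
    "HOL-Computational_Algebra.Polynomial"
    "Jordan_Normal_Form.Matrix"
begin

section \<open>Tensors\<close>

text \<open>
  An element of a tensor power of a vector space is given by a list of pure tensors, read as
  their sum, as in Sweedler notation. Two lists denote the same element iff they agree in the
  free vector space on the pure tensors modulo the span of the multilinearity relations. A set
  of slots (the maps that plug a vector into one position of a pure tensor) says in which
  positions a pure tensor is linear.
\<close>

definition tensor_rels ::
    "('k::field \<Rightarrow> 'v::ab_group_add \<Rightarrow> 'v) \<Rightarrow> ('v \<Rightarrow> 't) set \<Rightarrow> ('t \<Rightarrow>\<^sub>0 'k) set" where
  "tensor_rels scale slots =
     {Poly_Mapping.single (\<iota> (x + y)) 1 - Poly_Mapping.single (\<iota> x) 1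
        - Poly_Mapping.single (\<iota> y) 1 | \<iota> x y. \<iota> \<in> slots} \<union>
     {Poly_Mapping.single (\<iota> (scale c x)) 1 - Poly_Mapping.single (\<iota> x) c | \<iota> c x. \<iota> \<in> slots}"

definition tensor_eq ::
    "('k::field \<Rightarrow> 'v::ab_group_add \<Rightarrow> 'v) \<Rightarrow> ('v \<Rightarrow> 't) set \<Rightarrow> 't list \<Rightarrow> 't list \<Rightarrow> bool" where
  "tensor_eq scale slots xs ys \<longleftrightarrow>
     (\<Sum>x\<leftarrow>xs. Poly_Mapping.single x 1) - (\<Sum>y\<leftarrow>ys. Poly_Mapping.single y 1)
       \<in> Modules.module.span (\<lambda>c. Poly_Mapping.map ((*) c)) (tensor_rels scale slots)"

definition tensor2_eq ::
    "('k::field \<Rightarrow> 'v::ab_group_add \<Rightarrow> 'v) \<Rightarrow> ('v \<times> 'v) list \<Rightarrow> ('v \<times> 'v) list \<Rightarrow> bool" where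
  "tensor2_eq scale =
     tensor_eq scale (range (\<lambda>b x. (x, b)) \<union> range (\<lambda>a x. (a, x)))"

definition tensor3_eq ::
    "('k::field \<Rightarrow> 'v::ab_group_add \<Rightarrow> 'v) \<Rightarrow>
      ('v \<times> 'v \<times> 'v) list \<Rightarrow> ('v \<times> 'v \<times> 'v) list \<Rightarrow> bool" where
  "tensor3_eq scale =
     tensor_eq scale (range (\<lambda>(b, c) x. (x, b, c)) \<union> range (\<lambda>(a, c) x. (a, x, c))
       \<union> range (\<lambda>(a, b) x. (a, b, x)))"


section \<open>Hopf algebras\<close>

locale unital_algebra = Vector_Spaces.vector_space scale
  for scale :: "'k::field \<Rightarrow> 'h::ring_1 \<Rightarrow> 'h" +
  assumes scale_mult_left: "scale c x * y = scale c (x * y)"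
    and scale_mult_right: "x * scale c y = scale c (x * y)"

text \<open>
  The value of \<open>\<Delta>\<close> at \<open>h\<close> is some list of pure tensors representing the comultiplication
  of \<open>h\<close>. Which list is chosen is irrelevant: all axioms are equations between tensors, and
  below \<open>\<Delta>\<close> is used only inside expressions that are multilinear in the tensor factors.
\<close>

locale hopf_algebra = unital_algebra scale
  for scale :: "'k::field \<Rightarrow> 'h::ring_1 \<Rightarrow> 'h" +
  fixes \<Delta> :: "'h \<Rightarrow> ('h \<times> 'h) list"
    and \<epsilon> :: "'h \<Rightarrow> 'k"
    and S :: "'h \<Rightarrow> 'h"
  assumes comult_add: "tensor2_eq scale (\<Delta> (x + y)) (\<Delta> x @ \<Delta> y)"
    and comult_scale: "tensor2_eq scale (\<Delta> (scale c x)) [(scale c a, b). (a, b) \<leftarrow> \<Delta> x]"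
    and comult_one: "tensor2_eq scale (\<Delta> 1) [(1, 1)]"
    and comult_mult:
      "tensor2_eq scale (\<Delta> (x * y)) [(a * a', b * b'). (a, b) \<leftarrow> \<Delta> x, (a', b') \<leftarrow> \<Delta> y]"
    and coassoc:
      "tensor3_eq scale [(a', a'', b). (a, b) \<leftarrow> \<Delta> x, (a', a'') \<leftarrow> \<Delta> a]
                        [(a, b', b''). (a, b) \<leftarrow> \<Delta> x, (b', b'') \<leftarrow> \<Delta> b]"
    and counit_linear: "Vector_Spaces.linear scale (*) \<epsilon>"
    and counit_one: "\<epsilon> 1 = 1"
    and counit_mult: "\<epsilon> (x * y) = \<epsilon> x * \<epsilon> y"
    and counit_left: "(\<Sum>(a, b)\<leftarrow>\<Delta> x. scale (\<epsilon> a) b) = x"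
    and counit_right: "(\<Sum>(a, b)\<leftarrow>\<Delta> x. scale (\<epsilon> b) a) = x"
    and antipode_linear: "Vector_Spaces.linear scale scale S"
    and antipode_left: "(\<Sum>(a, b)\<leftarrow>\<Delta> x. S a * b) = scale (\<epsilon> x) 1"
    and antipode_right: "(\<Sum>(a, b)\<leftarrow>\<Delta> x. a * S b) = scale (\<epsilon> x) 1"

definition is_basis :: "('k::field \<Rightarrow> 'v::ab_group_add \<Rightarrow> 'v) \<Rightarrow> 'v set \<Rightarrow> 'v set \<Rightarrow> bool" where
  "is_basis scale A B \<longleftrightarrow>
     \<not> Modules.module.dependent scale B \<and> Modules.module.span scale B = A"

definition has_dimension :: "('k::field \<Rightarrow> 'v::ab_group_add \<Rightarrow> 'v) \<Rightarrow> nat \<Rightarrow> bool" where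
  "has_dimension scale d \<longleftrightarrow> (\<exists>B. finite B \<and> is_basis scale UNIV B \<and> card B = d)"

definition left_ideal :: "'h::ring_1 set \<Rightarrow> bool" where
  "left_ideal I \<longleftrightarrow> 0 \<in> I \<and> (\<forall>x\<in>I. \<forall>y\<in>I. x + y \<in> I) \<and> (\<forall>h. \<forall>x\<in>I. h * x \<in> I)"

text \<open>The left regular module is semisimple: each of its submodules is a direct summand.\<close>

definition semisimple_ring :: "'h::ring_1 itself \<Rightarrow> bool" where
  "semisimple_ring _ \<longleftrightarrow>
     (\<forall>I :: 'h set. left_ideal I \<longrightarrow>
        (\<exists>J. left_ideal J \<and> I \<inter> J = {0} \<and> (\<forall>h. \<exists>x\<in>I. \<exists>y\<in>J. h = x + y)))"

definition idempotent_integral ::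
    "('k::field \<Rightarrow> 'h::ring_1 \<Rightarrow> 'h) \<Rightarrow> ('h \<Rightarrow> 'k) \<Rightarrow> 'h \<Rightarrow> bool" where
  "idempotent_integral scale \<epsilon> \<Lambda> \<longleftrightarrow>
     (\<forall>h. h * \<Lambda> = scale (\<epsilon> h) \<Lambda> \<and> \<Lambda> * h = scale (\<epsilon> h) \<Lambda>) \<and> \<epsilon> \<Lambda> = 1"

text \<open>The list \<open>xs\<close> runs over all choices of one summand from each of the \<open>n\<close> copies of
  \<open>\<Delta> \<Lambda>\<close>.\<close>

definition z_elem ::
    "('h::ring_1 \<Rightarrow> ('h \<times> 'h) list) \<Rightarrow> ('h \<Rightarrow> 'h) \<Rightarrow> 'h \<Rightarrow> nat \<Rightarrow> 'h" where
  "z_elem \<Delta> S \<Lambda> n =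
     (\<Sum>xs\<leftarrow>List.n_lists n (\<Delta> \<Lambda>). prod_list (map fst xs) * prod_list (map (S \<circ> snd) xs))"


section \<open>Characters\<close>

definition is_rep ::
    "('k::field \<Rightarrow> 'h::ring_1 \<Rightarrow> 'h) \<Rightarrow> nat \<Rightarrow> ('h \<Rightarrow> 'k mat) \<Rightarrow> bool" where
  "is_rep scale m \<rho> \<longleftrightarrow>
     (\<forall>x. \<rho> x \<in> carrier_mat m m) \<and>
     (\<forall>x y. \<rho> (x + y) = \<rho> x + \<rho> y) \<and>
     (\<forall>c x. \<rho> (scale c x) = c \<cdot>\<^sub>m \<rho> x) \<and>
     \<rho> 1 = 1\<^sub>m m \<and>
     (\<forall>x y. \<rho> (x * y) = \<rho> x * \<rho> y)"

definition invariant_subspace ::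
    "nat \<Rightarrow> ('h \<Rightarrow> 'k::field mat) \<Rightarrow> 'k vec set \<Rightarrow> bool" where
  "invariant_subspace m \<rho> W \<longleftrightarrow>
     W \<subseteq> carrier_vec m \<and> 0\<^sub>v m \<in> W \<and>
     (\<forall>v\<in>W. \<forall>w\<in>W. v + w \<in> W) \<and> (\<forall>c. \<forall>w\<in>W. c \<cdot>\<^sub>v w \<in> W) \<and>
     (\<forall>x. \<forall>w\<in>W. \<rho> x *\<^sub>v w \<in> W)"

definition irreducible_rep ::
    "('k::field \<Rightarrow> 'h::ring_1 \<Rightarrow> 'h) \<Rightarrow> nat \<Rightarrow> ('h \<Rightarrow> 'k mat) \<Rightarrow> bool" where
  "irreducible_rep scale m \<rho> \<longleftrightarrow>
     is_rep scale m \<rho> \<and> m > 0 \<and>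
     (\<forall>W. invariant_subspace m \<rho> W \<longrightarrow> W = {0\<^sub>v m} \<or> W = carrier_vec m)"

definition character_of :: "('h \<Rightarrow> 'k::field mat) \<Rightarrow> 'h \<Rightarrow> 'k" where
  "character_of \<rho> = (\<lambda>h. \<Sum>i<dim_row (\<rho> h). \<rho> h $$ (i, i))"

text \<open>Irreducible characters index themselves: in characteristic 0, non-isomorphic irreducible
  representations have different characters.\<close>

definition irr_chars :: "('k::field \<Rightarrow> 'h::ring_1 \<Rightarrow> 'h) \<Rightarrow> ('h \<Rightarrow> 'k) set" where
  "irr_chars scale = {character_of \<rho> | m \<rho>. irreducible_rep scale m \<rho>}"

definition char_degree :: "('k::field \<Rightarrow> 'h::ring_1 \<Rightarrow> 'h) \<Rightarrow> ('h \<Rightarrow> 'k) \<Rightarrow> nat" where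
  "char_degree scale \<chi> = (THE m. \<exists>\<rho>. irreducible_rep scale m \<rho> \<and> \<chi> = character_of \<rho>)"

definition lin_trace :: "('k::field \<Rightarrow> 'v::ab_group_add \<Rightarrow> 'v) \<Rightarrow> ('v \<Rightarrow> 'v) \<Rightarrow> 'k" where
  "lin_trace scale f =
     (let B = (SOME B. is_basis scale UNIV B)
      in \<Sum>b\<in>B. Modules.module.representation scale B (f b) b)"

text \<open>The character \<open>\<lambda>\<close> of the left regular representation.\<close>

definition regular_char :: "('k::field \<Rightarrow> 'h::ring_1 \<Rightarrow> 'h) \<Rightarrow> 'h \<Rightarrow> 'k" where
  "regular_char scale = (\<lambda>h. lin_trace scale (\<lambda>x. h * x))"


section \<open>The Frobenius map and convolution\<close>

text \<open>The action \<open>p \<leftharpoonup> a\<close> of \<open>H\<close> on its dual.\<close>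

definition dual_act :: "('h::ring_1 \<Rightarrow> 'k) \<Rightarrow> 'h \<Rightarrow> 'h \<Rightarrow> 'k" where
  "dual_act p a = (\<lambda>a'. p (a * a'))"

definition frob_map ::
    "('k::field \<Rightarrow> 'h::ring_1 \<Rightarrow> 'h) \<Rightarrow> ('h \<Rightarrow> 'h) \<Rightarrow> 'h \<Rightarrow> 'h \<Rightarrow> 'k" where
  "frob_map scale S h = dual_act (regular_char scale) (S h)"

definition frob_map_inv ::
    "('k::field \<Rightarrow> 'h::ring_1 \<Rightarrow> 'h) \<Rightarrow> ('h \<Rightarrow> ('h \<times> 'h) list) \<Rightarrow> 'h \<Rightarrow> ('h \<Rightarrow> 'k) \<Rightarrow> 'h" where
  "frob_map_inv scale \<Delta> \<Lambda> p = (\<Sum>(a, b)\<leftarrow>\<Delta> \<Lambda>. scale (p a) b)"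

definition convolution ::
    "('k::field \<Rightarrow> 'h::ring_1 \<Rightarrow> 'h) \<Rightarrow> ('h \<Rightarrow> ('h \<times> 'h) list) \<Rightarrow> ('h \<Rightarrow> 'h) \<Rightarrow> 'h \<Rightarrow> nat \<Rightarrow>
      ('h \<Rightarrow> 'k) \<Rightarrow> ('h \<Rightarrow> 'k) \<Rightarrow> 'h \<Rightarrow> 'k" where
  "convolution scale \<Delta> S \<Lambda> d p q =
     (\<lambda>h. of_nat d *
        frob_map scale S (frob_map_inv scale \<Delta> \<Lambda> p * frob_map_inv scale \<Delta> \<Lambda> q) h)"

text \<open>The convolution product of \<open>m \<ge> 1\<close> factors equal to \<open>p\<close>; the value for \<open>m = 0\<close> is
  meaningless.\<close>

definition convolution_power ::
    "('k::field \<Rightarrow> 'h::ring_1 \<Rightarrow> 'h) \<Rightarrow> ('h \<Rightarrow> ('h \<times> 'h) list) \<Rightarrow> ('h \<Rightarrow> 'h) \<Rightarrow> 'h \<Rightarrow> nat \<Rightarrow>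
      ('h \<Rightarrow> 'k) \<Rightarrow> nat \<Rightarrow> 'h \<Rightarrow> 'k" where
  "convolution_power scale \<Delta> S \<Lambda> d p m = (convolution scale \<Delta> S \<Lambda> d p ^^ (m - 1)) p"

definition f_rob :: "('k::field \<Rightarrow> 'h::ring_1 \<Rightarrow> 'h) \<Rightarrow> nat \<Rightarrow> 'h \<Rightarrow> 'k" where
  "f_rob scale d = (\<lambda>h. \<Sum>\<chi>\<in>irr_chars scale. of_nat d / of_nat (char_degree scale \<chi>) * \<chi> h)"


section \<open>Casimir elements\<close>

text \<open>Here \<open>A\<close> is the underlying set of a subalgebra of \<open>'h\<close>. The Casimir element is the common
  value of the sum for all pairs of dual bases.\<close>

definition nondeg_assoc_sym_form ::
    "('k::field \<Rightarrow> 'h::ring_1 \<Rightarrow> 'h) \<Rightarrow> 'h set \<Rightarrow> ('h \<Rightarrow> 'h \<Rightarrow> 'k) \<Rightarrow> bool" where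
  "nondeg_assoc_sym_form scale A \<beta> \<longleftrightarrow>
     (\<forall>x\<in>A. \<forall>y\<in>A. \<forall>z\<in>A. \<beta> (x + y) z = \<beta> x z + \<beta> y z) \<and>
     (\<forall>c. \<forall>x\<in>A. \<forall>y\<in>A. \<beta> (scale c x) y = c * \<beta> x y) \<and>
     (\<forall>x\<in>A. \<forall>y\<in>A. \<beta> x y = \<beta> y x) \<and>
     (\<forall>x\<in>A. \<forall>y\<in>A. \<forall>z\<in>A. \<beta> (x * y) z = \<beta> x (y * z)) \<and>
     (\<forall>x\<in>A. (\<forall>y\<in>A. \<beta> x y = 0) \<longrightarrow> x = 0)"

definition dual_bases ::
    "('k::field \<Rightarrow> 'h::ring_1 \<Rightarrow> 'h) \<Rightarrow> 'h set \<Rightarrow> ('h \<Rightarrow> 'h \<Rightarrow> 'k) \<Rightarrow>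
      nat \<Rightarrow> (nat \<Rightarrow> 'h) \<Rightarrow> (nat \<Rightarrow> 'h) \<Rightarrow> bool" where
  "dual_bases scale A \<beta> m r l \<longleftrightarrow>
     inj_on r {..<m} \<and> is_basis scale A (r ` {..<m}) \<and>
     inj_on l {..<m} \<and> is_basis scale A (l ` {..<m}) \<and>
     (\<forall>i<m. \<forall>j<m. \<beta> (r i) (l j) = (if i = j then 1 else 0))"

definition casimir ::
    "('k::field \<Rightarrow> 'h::ring_1 \<Rightarrow> 'h) \<Rightarrow> 'h set \<Rightarrow> ('h \<Rightarrow> 'h \<Rightarrow> 'k) \<Rightarrow> 'h" where
  "casimir scale A \<beta> = (THE c. \<exists>m r l. dual_bases scale A \<beta> m r l \<and> c = (\<Sum>i<m. r i * l i))"

definition center :: "'h::ring_1 set" where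
  "center = {z. \<forall>h. z * h = h * z}"

definition t_char :: "('k::field \<Rightarrow> 'h::ring_1 \<Rightarrow> 'h) \<Rightarrow> nat \<Rightarrow> 'h \<Rightarrow> 'k" where
  "t_char scale n =
     (\<lambda>h. \<Sum>\<chi>\<in>irr_chars scale. of_nat (char_degree scale \<chi>) ^ (n - 1 - n mod 2) * \<chi> h)"

definition beta_Z :: "('k::field \<Rightarrow> 'h::ring_1 \<Rightarrow> 'h) \<Rightarrow> nat \<Rightarrow> 'h \<Rightarrow> 'h \<Rightarrow> 'k" where
  "beta_Z scale n = (\<lambda>z z'. t_char scale n (z * z'))"

definition casimir_Z :: "('k::field \<Rightarrow> 'h::ring_1 \<Rightarrow> 'h) \<Rightarrow> nat \<Rightarrow> 'h" where
  "casimir_Z scale n = casimir scale center (beta_Z scale n)"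

end

theory Submission
  imports Defs Complex_Main
begin

text \<open>
  Over an algebraically closed field, \<open>H\<close> is a product of matrix algebras. With matrix units
  \<open>E a b\<close>, the sum \<open>T\<close> of the irreducible characters is the matrix trace, a central element is
  given by one scalar for each block, and the Casimir element of the form \<open>T (q x y)\<close> on the
  center, where \<open>q\<close> is central and invertible, has the scalar \<open>1 / (q\<^sub>i d\<^sub>i)\<close> in the block \<open>i\<close> of
  degree \<open>d\<^sub>i\<close>. All other objects of the theorem are governed by the tensor \<open>\<Lambda>\<^sub>1 \<otimes> S \<Lambda>\<^sub>2\<close>. Since
  \<open>h \<Lambda>\<^sub>1 \<otimes> S \<Lambda>\<^sub>2 = \<Lambda>\<^sub>1 \<otimes> S \<Lambda>\<^sub>2 h\<close>, it has the form \<open>\<Sum> E a b w \<otimes> E b a\<close> with a single element \<open>w\<close>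
  (\<open>integral_tensor\<close>). From \<open>\<Lambda>\<^sub>1 S \<Lambda>\<^sub>2 = 1\<close> it follows that \<open>w\<close> has trace 1 in every block, and
  moving elements through the tensor on the right shows that the square of the antipode is
  conjugation by \<open>w\<close>.

  If the square of the antipode is the identity, \<open>w\<close> is central, hence equal to \<open>1 / d\<^sub>i\<close> in the
  block \<open>i\<close>. The integral \<open>\<lambda>\<close> of the dual algebra, which is \<open>T\<close> weighted by the inverse of \<open>w\<close>, is
  then the regular character. Two nested copies of \<open>\<Lambda>\<close> act as multiplication by \<open>w\<^sup>2\<close>
  (\<open>double_averaging\<close>), so \<open>z\<^sub>n\<close> is the power of \<open>w\<close> with exponent \<open>n - n mod 2\<close>, and this is the
  Casimir element above for the weights \<open>q\<close> of \<open>t\<^sub>n\<close>. Finally \<open>f\<^sub>r\<^sub>o\<^sub>b\<close> is \<open>d \<lambda>\<close> translated by \<open>w\<^sup>2\<close>,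
  and the convolution product of two translates of \<open>\<lambda>\<close> is \<open>d\<close> times the translate by the product.

  So everything rests on the theorem of Larson and Radford that the antipode is an involution
  (\<open>antipode_involutive\<close>). It cannot be avoided: the formula for \<open>z\<^sub>2\<close> says that \<open>w\<close> has in each
  block the square \<open>1 / d\<^sub>i\<^sup>2\<close>, which together with trace 1 makes \<open>w\<close> scalar. The proof has three
  steps.

  \<^item> The failure of \<open>\<lambda>\<close> to be a two-sided integral is measured by a group-like element \<open>g\<close>, and
    Radford's formula says that the fourth power of the antipode is conjugation by \<open>g\<close>
    (\<open>antipode_fourth_power\<close>). Here \<open>g\<close> has finite order.

  \<^item> Hence a power of \<open>w\<close> is central, and up to a scalar the eigenvalues of \<open>w\<close> in a block are
    roots of unity. So \<open>\<lambda> 1\<close>, the sum of the block traces of the inverse of \<open>w\<close>, is a sum of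
    numbers that behave like squared absolute values of sums of roots of unity, and it does not
    vanish (\<open>cointegral_one_nonzero\<close>). This uses characteristic 0. It follows that \<open>g = 1\<close>, and the
    square of the antipode is an involution of \<open>H\<close> with trace \<open>\<lambda> 1\<close>.

  \<^item> The idempotent \<open>\<chi>\<^sub>H / d\<close> of the dual algebra, \<open>\<chi>\<^sub>H\<close> being the regular character, projects \<open>H\<close> onto
    a subspace on which the involution has trace \<open>\<lambda> 1 / d\<close>. Traces of involutions are integers, so
    the integer \<open>\<lambda> 1\<close> is a nonzero multiple of \<open>d\<close>, and the involution is plus or minus the identity.
    As it fixes 1, it is the identity.
\<close>

section \<open>Sweedler notation and the antipode\<close>

text \<open>A slotwise linear map extends to the free vector space on the pure tensors, kills the
  multilinearity relations there, and hence their span. Every equation between tensors enters the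
  proof through such maps: two tensors are compared by all multilinear maps at once.\<close>

lemma tensor_eq_imp_sum_eq:
  fixes scale :: "'k::field \<Rightarrow> 'v::ab_group_add \<Rightarrow> 'v" and B :: "'t \<Rightarrow> 'w::ab_group_add"
  assumes W: "Vector_Spaces.vector_space sW"
    and lin: "\<And>\<iota>. \<iota> \<in> slots \<Longrightarrow> Vector_Spaces.linear scale sW (\<lambda>x. B (\<iota> x))"
    and eq: "tensor_eq scale slots xs ys"
  shows "(\<Sum>x\<leftarrow>xs. B x) = (\<Sum>y\<leftarrow>ys. B y)"
proof -
  interpret W: Vector_Spaces.vector_space sW by (fact W)
  let ?pm = "\<lambda>c::'k. Poly_Mapping.map ((*) c) :: ('t \<Rightarrow>\<^sub>0 'k) \<Rightarrow> _"
  have lk: "Poly_Mapping.lookup (?pm c m) t = c * Poly_Mapping.lookup m t" for c m t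
    by (simp add: Poly_Mapping.map.rep_eq when_def)
  interpret P: Modules.module ?pm
    by standard (auto intro!: poly_mapping_eqI simp: lk lookup_add algebra_simps)
  define F where "F = (\<lambda>m::'t \<Rightarrow>\<^sub>0 'k. \<Sum>t\<in>Poly_Mapping.keys m. sW (Poly_Mapping.lookup m t) (B t))"
  have F_alt: "F m = (\<Sum>t\<in>K. sW (Poly_Mapping.lookup m t) (B t))"
    if "finite K" "Poly_Mapping.keys m \<subseteq> K" for m K
    unfolding F_def using that
    by (intro sum.mono_neutral_left) (auto simp: in_keys_iff W.scale_zero_left)
  have F_add: "F (m + m') = F m + F m'" for m m'
  proof -
    let ?K = "Poly_Mapping.keys m \<union> Poly_Mapping.keys m'"
    show ?thesis
      using Poly_Mapping.keys_add[of m m']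
      by (simp add: F_alt[of ?K] lookup_add W.scale_left_distrib sum.distrib)
  qed
  have F_pm: "F (?pm c m) = sW c (F m)" for c m
  proof -
    have "Poly_Mapping.keys (?pm c m) \<subseteq> Poly_Mapping.keys m"
      by (auto simp: in_keys_iff lk)
    then show ?thesis
      by (simp add: F_alt[of "Poly_Mapping.keys m"] lk W.scale_sum_right)
  qed
  have F_zero: "F 0 = 0" by (simp add: F_def)
  have F_diff: "F (m - m') = F m - F m'" for m m'
    using F_add[of "m - m'" m'] by simp
  have F_single: "F (Poly_Mapping.single t c) = sW c (B t)" for t c
    by (simp add: F_alt[of "{t}"])
  have F_list: "F (\<Sum>x\<leftarrow>zs. Poly_Mapping.single x 1) = (\<Sum>x\<leftarrow>zs. B x)" for zs
    by (induction zs) (simp_all add: F_zero F_add F_single)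
  have "F r = 0" if "r \<in> tensor_rels scale slots" for r
    using that unfolding tensor_rels_def
  proof (elim UnE CollectE exE conjE)
    fix \<iota> x y assume r: "r = Poly_Mapping.single (\<iota> (x + y)) 1 - Poly_Mapping.single (\<iota> x) 1
        - Poly_Mapping.single (\<iota> y) 1" and "\<iota> \<in> slots"
    interpret L: Vector_Spaces.linear scale sW "\<lambda>x. B (\<iota> x)" by (rule lin) fact
    show "F r = 0" by (simp add: r F_diff F_single L.add)
  next
    fix \<iota> x c assume r: "r = Poly_Mapping.single (\<iota> (scale c x)) 1 - Poly_Mapping.single (\<iota> x) c"
      and "\<iota> \<in> slots"
    interpret L: Vector_Spaces.linear scale sW "\<lambda>x. B (\<iota> x)" by (rule lin) fact
    show "F r = 0" by (simp add: r F_diff F_single L.scale)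
  qed
  then have step: "F (?pm c x + y) = 0" if "x \<in> tensor_rels scale slots" "F y = 0" for c x y
    using that by (simp add: F_add F_pm)
  have "F r = 0" if "r \<in> P.span (tensor_rels scale slots)" for r
    using that F_zero step by (rule P.span_induct_alt)
  with eq have "F ((\<Sum>x\<leftarrow>xs. Poly_Mapping.single x 1) - (\<Sum>y\<leftarrow>ys. Poly_Mapping.single y 1)) = 0"
    unfolding tensor_eq_def by blast
  then show ?thesis by (simp add: F_diff F_list)
qed

context unital_algebra
begin

abbreviation lin :: "('k \<Rightarrow> 'w::ab_group_add \<Rightarrow> 'w) \<Rightarrow> ('h \<Rightarrow> 'w) \<Rightarrow> bool" where
  "lin sW f \<equiv> Vector_Spaces.linear scale sW f"

lemma vector_space_self: "Vector_Spaces.vector_space scale"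
  by (fact vector_space_axioms)

lemma vector_space_field: "Vector_Spaces.vector_space ((*) :: 'k \<Rightarrow> 'k \<Rightarrow> 'k)"
  by unfold_locales (simp_all add: algebra_simps)

lemma linI:
  assumes "Vector_Spaces.vector_space sW" "\<And>x y. f (x + y) = f x + f y"
    "\<And>c x. f (scale c x) = sW c (f x)"
  shows "lin sW f"
proof -
  interpret W: Vector_Spaces.vector_space sW by fact
  show ?thesis by unfold_locales (simp_all add: assms)
qed

lemma lin_vector_space: "lin sW f \<Longrightarrow> Vector_Spaces.vector_space sW"
  by (simp add: Vector_Spaces.linear_def)

lemma lin_add: "lin sW f \<Longrightarrow> f (x + y) = f x + f y"
  by (simp add: Vector_Spaces.linear_iff)

lemma lin_scale: "lin sW f \<Longrightarrow> f (scale c x) = sW c (f x)"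
  by (simp add: Vector_Spaces.linear_iff)

lemma lin_zero: "lin sW f \<Longrightarrow> f 0 = 0"
  using lin_add[of sW f 0 0] by simp

lemma lin_minus: "lin sW f \<Longrightarrow> f (- x) = - f x"
  using lin_add[of sW f x "- x"] by (simp add: lin_zero eq_neg_iff_add_eq_0 add.commute)

lemma lin_diff: "lin sW f \<Longrightarrow> f (x - y) = f x - f y"
  using lin_add[of sW f x "- y"] by (simp add: lin_minus)

lemma lin_sum: "lin sW f \<Longrightarrow> f (sum g I) = (\<Sum>i\<in>I. f (g i))"
  by (induction I rule: infinite_finite_induct) (simp_all add: lin_zero lin_add)

lemma lin_self: "lin scale (\<lambda>x. x)"
  by (intro linI vector_space_self) auto

lemma lin_compose: "lin sW f \<Longrightarrow> lin scale g \<Longrightarrow> lin sW (\<lambda>x. f (g x))"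
  by (intro linI) (auto simp: lin_vector_space lin_add lin_scale)

lemma lin_mult_left: "lin scale g \<Longrightarrow> lin scale (\<lambda>x. c * g x)"
  by (intro linI vector_space_self) (auto simp: lin_add lin_scale scale_mult_right distrib_left)

lemma lin_mult_right: "lin scale g \<Longrightarrow> lin scale (\<lambda>x. g x * c)"
  by (intro linI vector_space_self) (auto simp: lin_add lin_scale scale_mult_left distrib_right)

lemma lin_scale_vec: "lin scale g \<Longrightarrow> lin scale (\<lambda>x. scale c (g x))"
  by (intro linI vector_space_self)
    (auto simp: lin_add lin_scale scale_right_distrib mult.commute)

lemma lin_scale_coeff: "lin (*) p \<Longrightarrow> lin scale (\<lambda>x. scale (p x) y)"
  by (intro linI vector_space_self) (auto simp: lin_add lin_scale scale_left_distrib)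

lemma lin_add_fun: "lin sW f \<Longrightarrow> lin sW g \<Longrightarrow> lin sW (\<lambda>x. f x + g x)"
proof (intro linI)
  assume fg: "lin sW f" "lin sW g"
  then interpret W: Vector_Spaces.vector_space sW by (auto intro: lin_vector_space)
  show "f (scale c x) + g (scale c x) = sW c (f x + g x)" for c x
    using fg by (simp add: lin_scale W.scale_right_distrib)
qed (auto simp: lin_vector_space lin_add)

lemma lin_zero_fun: "Vector_Spaces.vector_space sW \<Longrightarrow> lin sW (\<lambda>x. 0)"
proof (intro linI)
  assume "Vector_Spaces.vector_space sW"
  then interpret W: Vector_Spaces.vector_space sW .
  show "0 = sW c 0" for c by simp
qed auto

lemma lin_sum_fun:
  "Vector_Spaces.vector_space sW \<Longrightarrow> (\<And>i. i \<in> I \<Longrightarrow> lin sW (\<lambda>x. f x i)) \<Longrightarrow>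
    lin sW (\<lambda>x. \<Sum>i\<in>I. f x i)"
  by (induction I rule: infinite_finite_induct) (auto intro: lin_zero_fun lin_add_fun)

lemma lin_sum_list_fun:
  "Vector_Spaces.vector_space sW \<Longrightarrow> (\<And>t. lin sW (\<lambda>x. f x t)) \<Longrightarrow>
    lin sW (\<lambda>x. \<Sum>t\<leftarrow>ts. f x t)"
  by (induction ts) (auto intro: lin_zero_fun lin_add_fun)

lemma lin_field_mult_left: "lin (*) p \<Longrightarrow> lin (*) (\<lambda>x. c * p x)"
  by (intro linI vector_space_field) (auto simp: lin_add lin_scale algebra_simps)

lemma lin_field_mult_right: "lin (*) p \<Longrightarrow> lin (*) (\<lambda>x. p x * c)"
  by (intro linI vector_space_field) (auto simp: lin_add lin_scale algebra_simps)

lemmas lin_intros = lin_self lin_mult_left lin_mult_right lin_scale_vec lin_scale_coeff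
  lin_field_mult_left lin_field_mult_right

definition bilin :: "('k \<Rightarrow> 'w::ab_group_add \<Rightarrow> 'w) \<Rightarrow> ('h \<Rightarrow> 'h \<Rightarrow> 'w) \<Rightarrow> bool" where
  "bilin sW B \<longleftrightarrow> (\<forall>b. lin sW (\<lambda>a. B a b)) \<and> (\<forall>a. lin sW (\<lambda>b. B a b))"

lemma bilinI:
  "(\<And>b. lin sW (\<lambda>a. B a b)) \<Longrightarrow> (\<And>a. lin sW (\<lambda>b. B a b)) \<Longrightarrow> bilin sW B"
  by (simp add: bilin_def)

lemma bilin1: "bilin sW B \<Longrightarrow> lin scale g \<Longrightarrow> lin sW (\<lambda>x. B (g x) b)"
  using lin_compose[of sW "\<lambda>a. B a b" g] by (simp add: bilin_def)

lemma bilin2: "bilin sW B \<Longrightarrow> lin scale g \<Longrightarrow> lin sW (\<lambda>x. B a (g x))"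
  using lin_compose[of sW "\<lambda>b. B a b" g] by (simp add: bilin_def)

lemma bilin_vector_space: "bilin sW B \<Longrightarrow> Vector_Spaces.vector_space sW"
  unfolding bilin_def using lin_vector_space by blast

lemma bilin_scale1: "bilin sW B \<Longrightarrow> B (scale c a) b = sW c (B a b)"
  using lin_scale[OF bilin1[OF _ lin_self]] .

lemma bilin_scale2: "bilin sW B \<Longrightarrow> B a (scale c b) = sW c (B a b)"
  using lin_scale[OF bilin2[OF _ lin_self]] .

end

context hopf_algebra
begin

text \<open>The Sweedler sum \<open>\<Sum> B x\<^sub>1 x\<^sub>2\<close>. Further legs are obtained by nesting. The values of \<open>B\<close> lie in
  an arbitrary vector space, since both \<open>H\<close>-valued and scalar sums are needed.\<close>

definition sw :: "'h \<Rightarrow> ('h \<Rightarrow> 'h \<Rightarrow> 'w::ab_group_add) \<Rightarrow> 'w" where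
  "sw x B = (\<Sum>(a, b)\<leftarrow>\<Delta> x. B a b)"

lemma lin_eps: "lin scale g \<Longrightarrow> lin (*) (\<lambda>x. \<epsilon> (g x))"
  by (rule lin_compose[OF counit_linear])

lemma lin_S: "lin scale g \<Longrightarrow> lin scale (\<lambda>x. S (g x))"
  by (rule lin_compose[OF antipode_linear])

lemma sw_tensor2:
  assumes "bilin sW B" "tensor2_eq scale xs ys"
  shows "(\<Sum>(a, b)\<leftarrow>xs. B a b) = (\<Sum>(a, b)\<leftarrow>ys. B a b)"
  using assms unfolding tensor2_eq_def
  by (intro tensor_eq_imp_sum_eq[where sW = sW and B = "\<lambda>(a, b). B a b"])
    (auto simp: bilin_vector_space intro: bilin1 bilin2 lin_self)

lemma sw_add: "bilin sW B \<Longrightarrow> sw (x + y) B = sw x B + sw y B"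
  using sw_tensor2[OF _ comult_add] by (simp add: sw_def)

lemma sw_scale: assumes B: "bilin sW B" shows "sw (scale c x) B = sW c (sw x B)"
proof -
  interpret W: Vector_Spaces.vector_space sW by (rule bilin_vector_space[OF B])
  have eq: "(\<Sum>(a, b)\<leftarrow>[(scale c a, b). (a, b) \<leftarrow> xs]. B a b) = sW c (\<Sum>(a, b)\<leftarrow>xs. B a b)" for xs
    by (induction xs) (auto simp: bilin_scale1[OF B] W.scale_right_distrib)
  show ?thesis unfolding sw_def using sw_tensor2[OF B comult_scale] eq by simp
qed

lemma sw_one: "bilin sW B \<Longrightarrow> sw 1 B = B 1 1"
  using sw_tensor2[OF _ comult_one] by (simp add: sw_def)

lemma sw_mult:
  assumes B: "bilin sW B"
  shows "sw (x * y) B = sw x (\<lambda>a b. sw y (\<lambda>c d. B (a * c) (b * d)))"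
proof -
  have eq: "(\<Sum>(a, b)\<leftarrow>[(a * c, b * d). (a, b) \<leftarrow> xs, (c, d) \<leftarrow> ys]. B a b)
      = (\<Sum>(a, b)\<leftarrow>xs. \<Sum>(c, d)\<leftarrow>ys. B (a * c) (b * d))" for xs ys
    by (induction xs) (auto simp: o_def case_prod_unfold)
  show ?thesis unfolding sw_def using sw_tensor2[OF B comult_mult] eq by simp
qed

lemma sw_coassoc:
  assumes "\<And>b c. lin sW (\<lambda>a. B a b c)" "\<And>a c. lin sW (\<lambda>b. B a b c)" "\<And>a b. lin sW (\<lambda>c. B a b c)"
  shows "sw x (\<lambda>a b. sw b (\<lambda>c d. B a c d)) = sw x (\<lambda>a b. sw a (\<lambda>c d. B c d b))"
proof -
  have eq1: "(\<Sum>(a, b, c)\<leftarrow>[(a', a'', b). (a, b) \<leftarrow> xs, (a', a'') \<leftarrow> \<Delta> a]. B a b c)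
      = (\<Sum>(a, b)\<leftarrow>xs. \<Sum>(a', a'')\<leftarrow>\<Delta> a. B a' a'' b)"
    and eq2: "(\<Sum>(a, b, c)\<leftarrow>[(a, b', b''). (a, b) \<leftarrow> xs, (b', b'') \<leftarrow> \<Delta> b]. B a b c)
      = (\<Sum>(a, b)\<leftarrow>xs. \<Sum>(b', b'')\<leftarrow>\<Delta> b. B a b' b'')" for xs
    by (induction xs; auto simp: o_def case_prod_unfold)+
  have "(\<Sum>(a, b, c)\<leftarrow>[(a', a'', b). (a, b) \<leftarrow> \<Delta> x, (a', a'') \<leftarrow> \<Delta> a]. B a b c) =
      (\<Sum>(a, b, c)\<leftarrow>[(a, b', b''). (a, b) \<leftarrow> \<Delta> x, (b', b'') \<leftarrow> \<Delta> b]. B a b c)"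
    using coassoc[of x] unfolding tensor3_eq_def
    by (intro tensor_eq_imp_sum_eq[where sW = sW and B = "\<lambda>(a, b, c). B a b c"])
      (auto simp: assms intro: lin_vector_space[OF assms(1)])
  then show ?thesis unfolding sw_def eq1 eq2 by simp
qed

lemma sw_cong: "(\<And>a b. B a b = C a b) \<Longrightarrow> sw x B = sw x C"
  by (simp add: sw_def)

lemma lin_sw: "bilin sW B \<Longrightarrow> lin scale g \<Longrightarrow> lin sW (\<lambda>x. sw (g x) B)"
  by (intro linI) (auto simp: bilin_vector_space lin_add lin_scale sw_add sw_scale)

lemma lin_sw_fun:
  assumes "\<And>a b. lin sW (\<lambda>x. B x a b)" shows "lin sW (\<lambda>x. sw y (\<lambda>a b. B x a b))"
  unfolding sw_def using assms
  by (auto intro!: lin_sum_list_fun lin_vector_space[OF assms] simp: case_prod_unfold)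

lemma sw_apply: assumes "Vector_Spaces.linear sV sW f" shows "f (sw x B) = sw x (\<lambda>a b. f (B a b))"
proof -
  interpret L: Vector_Spaces.linear sV sW f by fact
  have "f (\<Sum>(a, b)\<leftarrow>xs. B a b) = (\<Sum>(a, b)\<leftarrow>xs. f (B a b))" for xs
    by (induction xs) (auto simp: L.add)
  then show ?thesis by (simp add: sw_def)
qed

lemma sw_swap:
  "sw x (\<lambda>a b. sw y (\<lambda>c d. B a b c d)) = sw y (\<lambda>c d. sw x (\<lambda>a b. B a b c d))"
proof -
  have "(\<Sum>(a, b)\<leftarrow>xs. \<Sum>(c, d)\<leftarrow>ys. B a b c d) = (\<Sum>(c, d)\<leftarrow>ys. \<Sum>(a, b)\<leftarrow>xs. B a b c d)" for xs ys
    by (induction xs) (auto simp: case_prod_unfold sum_list_addf)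
  then show ?thesis by (simp add: sw_def)
qed

lemma sw_counit_left: assumes "lin sW f" shows "sw x (\<lambda>a b. sW (\<epsilon> a) (f b)) = f x"
  using sw_apply[OF assms, of x "\<lambda>a b. scale (\<epsilon> a) b"] counit_left[of x]
  by (simp add: sw_def lin_scale[OF assms])

lemma sw_counit_right: assumes "lin sW f" shows "sw x (\<lambda>a b. sW (\<epsilon> b) (f a)) = f x"
  using sw_apply[OF assms, of x "\<lambda>a b. scale (\<epsilon> b) a"] counit_right[of x]
  by (simp add: sw_def lin_scale[OF assms])

lemma sw_antipode_left: assumes "lin sW f" shows "sw x (\<lambda>a b. f (S a * b)) = sW (\<epsilon> x) (f 1)"
  using sw_apply[OF assms, of x "\<lambda>a b. S a * b"] antipode_left[of x]
  by (simp add: sw_def lin_scale[OF assms])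

lemma sw_antipode_right: assumes "lin sW f" shows "sw x (\<lambda>a b. f (a * S b)) = sW (\<epsilon> x) (f 1)"
  using sw_apply[OF assms, of x "\<lambda>a b. a * S b"] antipode_right[of x]
  by (simp add: sw_def lin_scale[OF assms])

lemma antipode_one: "S 1 = 1"
proof -
  have "bilin scale (\<lambda>a b. S a * b)" by (intro bilinI lin_intros lin_S)
  from sw_one[OF this] have "S 1 = sw 1 (\<lambda>a b. S a * b)" by simp
  also have "\<dots> = 1" using sw_antipode_left[OF lin_self, of 1] by (simp add: counit_one)
  finally show ?thesis .
qed

lemma counit_antipode: "\<epsilon> (S x) = \<epsilon> x"
proof -
  have "\<epsilon> (S x) = sw x (\<lambda>a b. \<epsilon> b * \<epsilon> (S a))"
    by (rule sw_counit_right[symmetric]) (intro lin_eps lin_S lin_self)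
  also have "\<dots> = sw x (\<lambda>a b. \<epsilon> (S a * b))" by (simp add: counit_mult mult.commute)
  also have "\<dots> = \<epsilon> x * \<epsilon> 1"
    by (rule sw_antipode_left) (intro lin_eps lin_self)
  finally show ?thesis by (simp add: counit_one)
qed

text \<open>Both sides are values of
  \<open>\<Sum> S (x\<^sub>1 y\<^sub>1) x\<^sub>2 y\<^sub>2 S y\<^sub>3 S x\<^sub>3\<close>: contracting the legs 2 and 3 leaves \<open>S (x y)\<close>,
  contracting the legs 1 and 2 leaves \<open>S y S x\<close>.\<close>

lemma antipode_mult: "S (x * y) = S y * S x"
proof -
  let ?G = "\<lambda>a c d p r s. S (a * p) * (c * (r * S s)) * S d"
  note L = lin_intros lin_S lin_sw lin_sw_fun bilinI lin_eps
  have "sw x (\<lambda>a b. sw b (\<lambda>c d. sw y (\<lambda>p q. sw q (\<lambda>r s. ?G a c d p r s))))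
      = sw x (\<lambda>a b. sw b (\<lambda>c d. sw y (\<lambda>p q. scale (\<epsilon> q) (S (a * p) * c * S d))))"
    by (intro sw_cong) (subst sw_antipode_right, auto intro!: L simp: mult.assoc)
  also have "\<dots> = sw x (\<lambda>a b. sw b (\<lambda>c d. S (a * y) * (c * S d)))"
    by (intro sw_cong) (subst sw_counit_right, auto intro!: L simp: mult.assoc)
  also have "\<dots> = sw x (\<lambda>a b. scale (\<epsilon> b) (S (a * y)))"
    by (intro sw_cong) (subst sw_antipode_right, auto intro!: L simp: mult.assoc)
  also have "\<dots> = S (x * y)"
    by (intro sw_counit_right L)
  finally have 1: "sw x (\<lambda>a b. sw b (\<lambda>c d. sw y (\<lambda>p q. sw q (\<lambda>r s. ?G a c d p r s)))) = S (x * y)" .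
  have "sw x (\<lambda>a b. sw b (\<lambda>c d. sw y (\<lambda>p q. sw q (\<lambda>r s. ?G a c d p r s))))
      = sw x (\<lambda>a b. sw a (\<lambda>c d. sw y (\<lambda>p q. sw q (\<lambda>r s. ?G c d b p r s))))"
    by (intro sw_coassoc[where sW = scale] L)
  also have "\<dots> = sw x (\<lambda>a b. sw a (\<lambda>c d. sw y (\<lambda>p q. sw p (\<lambda>r s. ?G c d b r s q))))"
    by (intro sw_cong sw_coassoc[where sW = scale] L)
  also have "\<dots> = sw x (\<lambda>a b. sw y (\<lambda>p q. sw a (\<lambda>c d. sw p (\<lambda>r s. ?G c d b r s q))))"
    by (subst (2) sw_swap) (rule refl)
  also have "\<dots> = sw x (\<lambda>a b. sw y (\<lambda>p q. sw (a * p) (\<lambda>u v. (S u * v) * S q * S b)))"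
    by (intro sw_cong, subst sw_mult) (auto intro!: L simp: mult.assoc)
  also have "\<dots> = sw x (\<lambda>a b. sw y (\<lambda>p q. scale (\<epsilon> (a * p)) (S q * S b)))"
    by (intro sw_cong, subst sw_antipode_left[where f = "\<lambda>t. t * S q * S b" for q b])
      (auto intro!: L)
  also have "\<dots> = sw x (\<lambda>a b. sw y (\<lambda>p q. scale (\<epsilon> p) (scale (\<epsilon> a) (S q * S b))))"
    by (simp add: counit_mult mult.commute)
  also have "\<dots> = sw x (\<lambda>a b. scale (\<epsilon> a) (S y * S b))"
    by (intro sw_cong sw_counit_left L)
  also have "\<dots> = S y * S x" by (intro sw_counit_left L)
  finally show ?thesis using 1 by simp
qed

text \<open>This is \<open>\<Delta> (S x) = S x\<^sub>2 \<otimes> S x\<^sub>1\<close>. Both sides invert \<open>\<Delta>\<close> under convolution, the left one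
  from the left and the right one from the right; the common value is
  \<open>\<Sum> \<Delta> (S x\<^sub>1) \<Delta> x\<^sub>2 (S x\<^sub>4 \<otimes> S x\<^sub>3)\<close>.\<close>

lemma sw_antipode:
  assumes B: "bilin sW B"
  shows "sw (S x) B = sw x (\<lambda>a b. B (S b) (S a))"
proof -
  note L = lin_intros lin_S lin_sw lin_sw_fun bilinI lin_eps bilin1[OF B] bilin2[OF B]
  let ?X = "\<lambda>p q r s t u. B (p * (r * S u)) (q * (s * S t))"
  define M where "M = (\<lambda>a c d. sw (S a) (\<lambda>p q. sw c (\<lambda>r s. sw d (\<lambda>t u. ?X p q r s t u))))"
  have M: "M a c d = sw d (\<lambda>t u. sw (S a * c) (\<lambda>v w. B (v * S u) (w * S t)))" for a c d
  proof -
    have "M a c d = sw (S a) (\<lambda>p q. sw d (\<lambda>t u. sw c (\<lambda>r s. ?X p q r s t u)))"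
      unfolding M_def by (intro sw_cong sw_swap)
    also have "\<dots> = sw d (\<lambda>t u. sw (S a) (\<lambda>p q. sw c (\<lambda>r s. ?X p q r s t u)))"
      by (rule sw_swap)
    also have "\<dots> = sw d (\<lambda>t u. sw (S a * c) (\<lambda>v w. B (v * S u) (w * S t)))"
      by (intro sw_cong, subst sw_mult[where sW = sW]) (auto intro!: L simp: mult.assoc)
    finally show ?thesis .
  qed
  have inner: "sw b (\<lambda>c d. sw c (\<lambda>r s. sw d (\<lambda>t u. ?X p q r s t u))) = sW (\<epsilon> b) (B p q)" for b p q
  proof -
    have "sw b (\<lambda>c d. sw c (\<lambda>r s. sw d (\<lambda>t u. ?X p q r s t u)))
        = sw b (\<lambda>r d. sw d (\<lambda>s e. sw e (\<lambda>t u. ?X p q r s t u)))"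
      by (intro sw_coassoc[where sW = sW, symmetric] L)
    also have "\<dots> = sw b (\<lambda>r d. sw d (\<lambda>e u. sw e (\<lambda>s t. ?X p q r s t u)))"
      by (intro sw_cong sw_coassoc[where sW = sW] L)
    also have "\<dots> = sw b (\<lambda>r d. sw d (\<lambda>e u. sW (\<epsilon> e) (B (p * (r * S u)) (q * 1))))"
      by (intro sw_cong sw_antipode_right[where f = "\<lambda>z. B (p * (r * S u)) (q * z)" for r u] L)
    also have "\<dots> = sw b (\<lambda>r d. B (p * (r * S d)) (q * 1))"
      by (intro sw_cong sw_counit_left[where f = "\<lambda>u. B (p * (r * S u)) (q * 1)" for r] L)
    also have "\<dots> = sW (\<epsilon> b) (B (p * 1) (q * 1))"
      by (intro sw_antipode_right[where f = "\<lambda>z. B (p * z) (q * 1)"] L)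
    finally show ?thesis by simp
  qed
  have "sw x (\<lambda>a b. sw b (\<lambda>c d. M a c d)) = sw x (\<lambda>a b. sw (S a) (\<lambda>p q. sW (\<epsilon> b) (B p q)))"
  proof (intro sw_cong)
    show "sw b (\<lambda>c d. M a c d) = sw (S a) (\<lambda>p q. sW (\<epsilon> b) (B p q))" for a b
      unfolding M_def by (subst sw_swap) (simp only: inner)
  qed
  also have "\<dots> = sw x (\<lambda>a b. sW (\<epsilon> b) (sw (S a) B))"
  proof (intro sw_cong)
    fix a b
    interpret W: Vector_Spaces.vector_space sW by (rule bilin_vector_space[OF B])
    have "Vector_Spaces.linear sW sW (sW (\<epsilon> b))"
      by unfold_locales (auto simp: W.scale_right_distrib mult.commute)
    then show "sw (S a) (\<lambda>p q. sW (\<epsilon> b) (B p q)) = sW (\<epsilon> b) (sw (S a) B)"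
      by (rule sw_apply[symmetric])
  qed
  also have "\<dots> = sw (S x) B"
    by (intro sw_counit_right[where f = "\<lambda>a. sw (S a) B"] L B)
  finally have 1: "sw x (\<lambda>a b. sw b (\<lambda>c d. M a c d)) = sw (S x) B" .
  have "sw x (\<lambda>a b. sw b (\<lambda>c d. M a c d)) = sw x (\<lambda>a b. sw a (\<lambda>c d. M c d b))"
    unfolding M_def by (intro sw_coassoc[where sW = sW] L)
  also have "\<dots> = sw x (\<lambda>a b. sW (\<epsilon> a) (sw b (\<lambda>t u. sw 1 (\<lambda>v w. B (v * S u) (w * S t)))))"
    unfolding M
    by (intro sw_cong sw_antipode_left[where f = "\<lambda>z. sw b (\<lambda>t u. sw z (\<lambda>v w. B (v * S u) (w * S t)))" for b] L)
  also have "\<dots> = sw x (\<lambda>a b. sW (\<epsilon> a) (sw b (\<lambda>t u. B (S u) (S t))))"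
    by (intro sw_cong, subst sw_one[where sW = sW]) (auto intro!: L)
  also have "\<dots> = sw x (\<lambda>t u. B (S u) (S t))"
    by (intro sw_counit_left[where f = "\<lambda>b. sw b (\<lambda>t u. B (S u) (S t))"] L)
  finally show ?thesis using 1 by simp
qed

end

section \<open>Traces on finite-dimensional algebras\<close>

locale findim_algebra = unital_algebra scale
  for scale :: "'k::field \<Rightarrow> 'h::ring_1 \<Rightarrow> 'h" +
  fixes d :: nat
  assumes dim: "has_dimension scale d"
begin

lemma independent_bound:
  assumes "independent B" shows "finite B" "card B \<le> d"
proof -
  obtain C where C: "finite C" "span C = UNIV" "card C = d"
    using dim by (auto simp: has_dimension_def is_basis_def)
  show "finite B" "card B \<le> d"
    using independent_span_bound[of C B] assms C by auto
qed

lemma family_dependent: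
  fixes v :: "nat \<Rightarrow> 'h"
  obtains c where "\<exists>i\<le>d. c i \<noteq> 0" "(\<Sum>i\<le>d. scale (c i) (v i)) = 0"
proof (cases "inj_on v {..d}")
  case True
  then have "card (v ` {..d}) = Suc d" by (simp add: card_image)
  then have "dependent (v ` {..d})"
    using independent_bound(2)[of "v ` {..d}"] by auto
  then obtain u where u: "\<exists>x\<in>v ` {..d}. u x \<noteq> 0" "(\<Sum>x\<in>v ` {..d}. scale (u x) x) = 0"
    by (auto simp: dependent_finite)
  show ?thesis
  proof (rule that[of "\<lambda>i. u (v i)"])
    show "\<exists>i\<le>d. u (v i) \<noteq> 0" using u(1) by blast
    show "(\<Sum>i\<le>d. scale (u (v i)) (v i)) = 0" using u(2) True by (simp add: sum.reindex)
  qed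
next
  case False
  then obtain i j where ij: "i \<le> d" "j \<le> d" "i \<noteq> j" "v i = v j" by (auto simp: inj_on_def)
  let ?c = "\<lambda>l. if l = i then 1 else if l = j then -1 else (0 :: 'k)"
  have "(\<Sum>l\<le>d. scale (?c l) (v l)) = (\<Sum>l\<in>{i, j}. scale (?c l) (v l))"
    by (intro sum.mono_neutral_right) (use ij in auto)
  also have "\<dots> = 0" using ij by simp
  finally have "(\<Sum>l\<le>d. scale (?c l) (v l)) = 0" .
  moreover have "\<exists>l\<le>d. ?c l \<noteq> 0" using ij(1) by (intro exI[of _ i]) simp
  ultimately show ?thesis by (rule that[rotated])
qed

text \<open>A finite generating family with linear coordinate functions. The family may be linearly
  dependent, as the one read off from \<open>\<Delta> \<Lambda>\<close> can be.\<close>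

definition coordinates :: "'j set \<Rightarrow> ('j \<Rightarrow> 'h) \<Rightarrow> ('j \<Rightarrow> 'h \<Rightarrow> 'k) \<Rightarrow> bool" where
  "coordinates J v \<phi> \<longleftrightarrow> finite J \<and> (\<forall>j\<in>J. lin (*) (\<phi> j)) \<and> (\<forall>x. x = (\<Sum>j\<in>J. scale (\<phi> j x) (v j)))"

text \<open>Expanding each family in the other one turns both sums into the same double sum.\<close>

lemma trace_coordinates_unique:
  assumes f: "lin scale f" and J: "coordinates J v \<phi>" and K: "coordinates K u \<psi>"
  shows "(\<Sum>j\<in>J. \<phi> j (f (v j))) = (\<Sum>k\<in>K. \<psi> k (f (u k)))"
proof -
  have \<phi>: "lin (*) (\<phi> j)" if "j \<in> J" for j using J that by (simp add: coordinates_def)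
  have \<psi>: "lin (*) (\<psi> k)" if "k \<in> K" for k using K that by (simp add: coordinates_def)
  have v: "x = (\<Sum>j\<in>J. scale (\<phi> j x) (v j))" and u: "x = (\<Sum>k\<in>K. scale (\<psi> k x) (u k))" for x
    using J K by (auto simp: coordinates_def)
  have "(\<Sum>j\<in>J. \<phi> j (f (v j))) = (\<Sum>j\<in>J. \<phi> j (\<Sum>k\<in>K. scale (\<psi> k (f (v j))) (u k)))"
    using u by simp
  also have "\<dots> = (\<Sum>j\<in>J. \<Sum>k\<in>K. \<psi> k (f (v j)) * \<phi> j (u k))"
    by (intro sum.cong refl) (simp add: lin_sum[OF \<phi>] lin_scale[OF \<phi>])
  also have "\<dots> = (\<Sum>k\<in>K. \<Sum>j\<in>J. \<phi> j (u k) * \<psi> k (f (v j)))"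
    by (subst sum.swap) (simp add: mult.commute)
  also have "\<dots> = (\<Sum>k\<in>K. \<psi> k (f (\<Sum>j\<in>J. scale (\<phi> j (u k)) (v j))))"
    by (intro sum.cong refl) (simp add: lin_sum[OF f] lin_scale[OF f] lin_sum[OF \<psi>] lin_scale[OF \<psi>])
  also have "\<dots> = (\<Sum>k\<in>K. \<psi> k (f (u k)))"
    using v by simp
  finally show ?thesis .
qed

lemma basis_coordinates:
  assumes "is_basis scale UNIV B"
  shows "coordinates B (\<lambda>b. b) (\<lambda>b x. representation B x b)"
proof -
  have B: "independent B" "span B = UNIV" using assms by (auto simp: is_basis_def)
  show ?thesis unfolding coordinates_def
  proof (intro conjI ballI allI)
    show "finite B" using independent_bound B by blast
    show "lin (*) (\<lambda>x. representation B x b)" if "b \<in> B" for b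
      using B by (intro linI vector_space_field) (auto simp: representation_add representation_scale)
    show "x = (\<Sum>b\<in>B. scale (representation B x b) b)" for x
      using B \<open>finite B\<close> by (subst sum_representation_eq) auto
  qed
qed

lemma basis_exists: "\<exists>B. is_basis scale UNIV B"
  using dim by (auto simp: has_dimension_def)

lemma lin_trace_coordinates:
  assumes "lin scale f" "coordinates J v \<phi>"
  shows "lin_trace scale f = (\<Sum>j\<in>J. \<phi> j (f (v j)))"
  using trace_coordinates_unique[OF assms(1) basis_coordinates[OF someI_ex[OF basis_exists]] assms(2)]
  by (simp add: lin_trace_def)

lemma lin_trace_add:
  assumes f: "lin scale f" and g: "lin scale g"
  shows "lin_trace scale (\<lambda>x. f x + g x) = lin_trace scale f + lin_trace scale g"
proof -
  from basis_exists obtain B where "is_basis scale UNIV B" by blast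
  note C = basis_coordinates[OF this]
  note \<phi> = C[unfolded coordinates_def, THEN conjunct2, THEN conjunct1, rule_format]
  show ?thesis
    by (simp add: lin_trace_coordinates[OF _ C] lin_add_fun f g lin_add[OF \<phi>] sum.distrib)
qed

lemma lin_trace_scale:
  assumes f: "lin scale f"
  shows "lin_trace scale (\<lambda>x. scale c (f x)) = c * lin_trace scale f"
proof -
  from basis_exists obtain B where "is_basis scale UNIV B" by blast
  note C = basis_coordinates[OF this]
  note \<phi> = C[unfolded coordinates_def, THEN conjunct2, THEN conjunct1, rule_format]
  show ?thesis
    by (simp add: lin_trace_coordinates[OF _ C] lin_scale_vec f lin_scale[OF \<phi>] sum_distrib_left)
qed

lemma lin_trace_id: "lin_trace scale (\<lambda>x. x) = of_nat d"
proof -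
  obtain B where B: "finite B" "is_basis scale UNIV B" "card B = d"
    using dim by (auto simp: has_dimension_def)
  have "lin_trace scale (\<lambda>x. x) = (\<Sum>b\<in>B. representation B b b)"
    by (rule lin_trace_coordinates[OF lin_self basis_coordinates[OF B(2)]])
  also have "\<dots> = (\<Sum>b\<in>B. 1)"
    using B by (intro sum.cong) (auto simp: representation_basis is_basis_def)
  finally show ?thesis using B by simp
qed

text \<open>The trace of an idempotent is its rank: in a basis that extends a basis of the range, the
  vectors of the range are fixed, and the images of the others have no diagonal coefficient.\<close>

lemma lin_trace_idempotent:
  assumes P: "lin scale P" and idem: "\<And>x. P (P x) = P x"
  obtains r where "lin_trace scale P = of_nat r" "r \<le> d" "r = 0 \<Longrightarrow> \<forall>x. P x = 0"
proof -
  obtain U where U: "U \<subseteq> range P" "independent U" "range P \<subseteq> span U"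
    by (rule maximal_independent_subset)
  let ?C = "extend_basis U"
  have C: "independent ?C" "span ?C = UNIV" "U \<subseteq> ?C"
    using U(2) by (simp_all add: extend_basis_superset independent_extend_basis)
  then have fin: "finite ?C" using independent_bound by blast
  have "lin_trace scale P = (\<Sum>b\<in>?C. representation ?C (P b) b)"
    using C by (intro lin_trace_coordinates[OF P basis_coordinates]) (simp add: is_basis_def)
  also have "\<dots> = (\<Sum>b\<in>?C. if b \<in> U then 1 else 0)"
  proof (intro sum.cong refl)
    fix b assume b: "b \<in> ?C"
    show "representation ?C (P b) b = (if b \<in> U then 1 else 0)"
    proof (cases "b \<in> U")
      case True
      then have "P b = b" using U(1) idem by auto
      then show ?thesis using True b C by (simp add: representation_basis)
    next
      case False
      have "P b \<in> span U" using U(3) by auto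
      then have "representation ?C (P b) = representation U (P b)"
        using representation_extend[OF C(1) _ C(3)] by blast
      then show ?thesis using False representation_ne_zero[of U "P b" b] by auto
    qed
  qed
  also have "\<dots> = of_nat (card U)"
    using C(3) fin by (simp add: sum.If_cases Int_absorb1)
  finally have tr: "lin_trace scale P = of_nat (card U)" .
  show ?thesis
  proof (rule that[OF tr])
    show "card U \<le> d" using independent_bound[OF U(2)] by simp
    assume "card U = 0"
    then have "U = {}" using independent_bound[OF U(2)] by simp
    then have "range P \<subseteq> {0}" using U(3) by simp
    then show "\<forall>x. P x = 0" by blast
  qed
qed

end

section \<open>Matrix units\<close>

text \<open>The rows and columns are indexed by a complete set \<open>A\<close> of primitive orthogonal idempotents,
  all blocks together: \<open>rep a\<close> is a label for the block of \<open>a\<close>, and \<open>E a b\<close> is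
  zero if \<open>a\<close> and \<open>b\<close> belong to different blocks. Sums over \<open>A\<close> then replace iterated sums over
  blocks and over the rows of a block.\<close>

locale matrix_units = findim_algebra scale d
  for scale :: "'k::field \<Rightarrow> 'h::ring_1 \<Rightarrow> 'h" and d :: nat +
  fixes A :: "'h set" and rep :: "'h \<Rightarrow> 'h" and E :: "'h \<Rightarrow> 'h \<Rightarrow> 'h"
  assumes finite_A: "finite A"
    and A_nonzero: "a \<in> A \<Longrightarrow> a \<noteq> 0"
    and E_diag: "a \<in> A \<Longrightarrow> E a a = a"
    and E_mult: "a \<in> A \<Longrightarrow> b \<in> A \<Longrightarrow> b' \<in> A \<Longrightarrow> c \<in> A \<Longrightarrow> rep a = rep b \<Longrightarrow> rep b' = rep c \<Longrightarrow>
      E a b * E b' c = (if b = b' then E a c else 0)"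
    and E_off: "a \<in> A \<Longrightarrow> b \<in> A \<Longrightarrow> rep a \<noteq> rep b \<Longrightarrow> E a b = 0"
    and sum_A: "\<Sum>A = 1"
    and corner: "a \<in> A \<Longrightarrow> b \<in> A \<Longrightarrow> \<exists>c. a * h * b = scale c (E a b)"

locale semisimple_algebra = findim_algebra scale d
  for scale :: "'k::alg_closed_field \<Rightarrow> 'h::ring_1 \<Rightarrow> 'h" and d :: nat +
  assumes semisimple: "semisimple_ring TYPE('h)"
begin

definition orthogonal_idempotents :: "'h set \<Rightarrow> bool" where
  "orthogonal_idempotents A \<longleftrightarrow> finite A \<and> (\<forall>a\<in>A. a \<noteq> 0) \<and>
     (\<forall>a\<in>A. \<forall>b\<in>A. a * b = (if a = b then a else 0)) \<and> \<Sum>A = 1"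

text \<open>Orthogonal idempotents are linearly independent, so there is a largest system of them.\<close>

lemma orthogonal_idempotents_card:
  assumes "orthogonal_idempotents A" shows "card A \<le> d"
proof -
  from assms have A: "finite A" "\<And>a. a \<in> A \<Longrightarrow> a \<noteq> 0"
    "\<And>a b. a \<in> A \<Longrightarrow> b \<in> A \<Longrightarrow> a * b = (if a = b then a else 0)"
    by (auto simp: orthogonal_idempotents_def)
  have "independent A"
  proof
    assume "dependent A"
    then obtain u a where u: "a \<in> A" "u a \<noteq> 0" "(\<Sum>b\<in>A. scale (u b) b) = 0"
      using A(1) by (auto simp: dependent_finite)
    have "0 = a * (\<Sum>b\<in>A. scale (u b) b)" by (simp add: u)
    also have "\<dots> = (\<Sum>b\<in>A. scale (u b) (a * b))"
      by (simp add: sum_distrib_left scale_mult_right)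
    also have "\<dots> = (\<Sum>b\<in>A. if a = b then scale (u a) a else 0)"
      using u(1) A(3) by (intro sum.cong) auto
    also have "\<dots> = scale (u a) a" using A(1) u(1) by simp
    finally show False using u A(2) by simp
  qed
  then show ?thesis by (rule independent_bound)
qed

text \<open>Primitivity is stated as minimality of the left ideals: every nonzero element of
  \<open>H a\<close> generates it.\<close>

definition primitive_system :: "'h set \<Rightarrow> bool" where
  "primitive_system A \<longleftrightarrow> orthogonal_idempotents A \<and>
     (\<forall>a\<in>A. \<forall>x. x \<noteq> 0 \<longrightarrow> x * a = x \<longrightarrow> (\<exists>y. y * x = a))"

text \<open>The idempotent is the component of 1 in \<open>H x\<close> along a complementary left ideal.\<close>

lemma left_ideal_idempotent:
  fixes x :: 'h
  obtains p y where "p = y * x" "p * p = p" "x * p = x"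
proof -
  let ?L = "{y * x | y. True}"
  have L: "left_ideal ?L" unfolding left_ideal_def
  proof (intro conjI ballI allI)
    have "0 = 0 * x" by simp
    then show "0 \<in> ?L" by blast
    fix r s assume "r \<in> ?L" "s \<in> ?L"
    then obtain y y' where "r = y * x" "s = y' * x" by blast
    then have "r + s = (y + y') * x" by (simp only: distrib_right)
    then show "r + s \<in> ?L" by blast
  next
    fix h r assume "r \<in> ?L"
    then obtain y where "r = y * x" by blast
    then have "h * r = (h * y) * x" by (simp only: mult.assoc)
    then show "h * r \<in> ?L" by blast
  qed
  obtain J where J: "left_ideal J" "?L \<inter> J = {0}" and ex: "\<forall>h. \<exists>r\<in>?L. \<exists>s\<in>J. h = r + s"
    using semisimple[unfolded semisimple_ring_def, THEN spec, THEN mp, OF L] by (elim exE conjE)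
  obtain p q where pq: "p \<in> ?L" "q \<in> J" "1 = p + q"
    using ex[THEN spec[of _ 1]] by (elim bexE)
  have "z * p = z" if "z \<in> ?L" for z
  proof -
    have "z * (p + q) = z" by (simp add: pq(3)[symmetric])
    then have eq: "z * q = z - z * p" by (simp add: distrib_left eq_diff_eq add.commute)
    have "z * q \<in> J" using J(1) pq(2) by (simp add: left_ideal_def)
    moreover from that pq(1) obtain y y' where "z = y * x" "p = y' * x" by blast
    then have "z * q = (y - z * y') * x"
      unfolding eq by (simp only: left_diff_distrib mult.assoc)
    then have "z * q \<in> ?L" by blast
    ultimately have "z * q = 0" using J(2) by blast
    then show ?thesis by (simp add: eq)
  qed
  moreover have "x = 1 * x" by simp
  then have "x \<in> ?L" by blast
  ultimately show ?thesis using pq(1) that by blast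
qed

text \<open>A largest system is primitive. Otherwise some \<open>H a\<close> contains a nonzero left ideal \<open>H p\<close> that
  misses \<open>a\<close>, with \<open>p\<close> idempotent, and \<open>a\<close> could be split into \<open>a p\<close> and \<open>a - a p\<close>.\<close>

lemma primitive_system_exists: "\<exists>A. primitive_system A"
proof -
  have "orthogonal_idempotents {1}" by (simp add: orthogonal_idempotents_def)
  moreover have "\<forall>A. orthogonal_idempotents A \<longrightarrow> card A < Suc d"
    using orthogonal_idempotents_card by (simp add: less_Suc_eq_le)
  ultimately obtain A where A: "orthogonal_idempotents A"
      and max: "\<And>B. orthogonal_idempotents B \<Longrightarrow> card B \<le> card A"
    using ex_has_greatest_nat[of orthogonal_idempotents "{1}" card "Suc d"] by (metis less_imp_le)
  have Ad: "finite A" "\<Sum>A = 1" and nz: "\<And>a. a \<in> A \<Longrightarrow> a \<noteq> 0"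
    and orth: "\<And>a b. a \<in> A \<Longrightarrow> b \<in> A \<Longrightarrow> a * b = (if a = b then a else 0)"
    using A by (auto simp: orthogonal_idempotents_def)
  have "\<exists>y. y * x = a" if a: "a \<in> A" and x: "x \<noteq> 0" "x * a = x" for a x
  proof (rule ccontr)
    assume no: "\<nexists>y. y * x = a"
    obtain p y where p: "p = y * x" "p * p = p" "x * p = x" by (rule left_ideal_idempotent)
    have aa: "a * a = a" using orth a by simp
    have pa: "p * a = p" using p(1) x(2) by (simp add: mult.assoc)
    \<comment> \<open>The element \<open>p\<close> itself need not be orthogonal to the rest of \<open>A\<close>, but \<open>a p\<close> is.\<close>
    define f where "f = a * p"
    define f' where "f' = a - f"
    have ff: "f * f = f" by (metis f_def mult.assoc p(2) pa)
    have af: "a * f = f" "f * a = f" by (simp_all add: f_def aa pa mult.assoc[symmetric]) (simp add: mult.assoc pa)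
    have "x * f = x" using x p by (simp add: f_def mult.assoc[symmetric])
    then have f0: "f \<noteq> 0" using x by auto
    have "a * y * x \<noteq> a" using no by blast
    then have f'0: "f' \<noteq> 0" by (auto simp: f'_def f_def p(1) mult.assoc)
    have f': "f' * f' = f'" "f * f' = 0" "f' * f = 0" "a * f' = f'" "f' * a = f'"
      by (simp_all add: f'_def algebra_simps ff af aa)
    have zero: "b * f = 0" "f * b = 0" "b * f' = 0" "f' * b = 0" if "b \<in> A - {a}" for b
    proof -
      have ba: "b * a = 0" "a * b = 0" using orth a that by auto
      have "b * f = b * a * f" "b * f' = b * a * f'" "f * b = f * (a * b)" "f' * b = f' * (a * b)"
        by (simp_all add: mult.assoc af f') (simp_all add: mult.assoc[symmetric] af f')
      then show "b * f = 0" "f * b = 0" "b * f' = 0" "f' * b = 0" using ba by simp_all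
    qed
    have nin: "f \<notin> A - {a}" "f' \<notin> A - {a}" "f \<noteq> f'"
      using zero(1)[of f] zero(3)[of f'] f0 f'0 ff f' by auto
    let ?B = "insert f (insert f' (A - {a}))"
    have "orthogonal_idempotents ?B" unfolding orthogonal_idempotents_def
    proof (intro conjI ballI)
      show "finite ?B" using Ad by simp
      show "b \<noteq> 0" if "b \<in> ?B" for b using that nz f0 f'0 by auto
      have neq: "b \<noteq> f" "b \<noteq> f'" if "b \<in> A - {a}" for b using nin that by auto
      show "b * c = (if b = c then b else 0)" if "b \<in> ?B" "c \<in> ?B" for b c
      proof -
        from that have "b = f \<or> b = f' \<or> b \<in> A - {a}" "c = f \<or> c = f' \<or> c \<in> A - {a}" by blast+
        then show ?thesis
          by (elim disjE) (use ff f' nin(3) neq[of b] neq[of c] zero[of b] zero[of c] orth[of b c] in simp_all)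
      qed
      have "\<Sum>?B = f + (f' + \<Sum>(A - {a}))" using nin Ad by simp
      also have "\<dots> = a + \<Sum>(A - {a})" by (simp add: f'_def)
      also have "\<dots> = 1" using sum.remove[OF Ad(1) a, of "\<lambda>x. x"] Ad(2) by simp
      finally show "\<Sum>?B = 1" .
    qed
    moreover have "card ?B = Suc (card A)"
      using nin Ad a card_Suc_Diff1[OF Ad(1) a] by simp
    ultimately show False using max by fastforce
  qed
  with A show ?thesis by (auto simp: primitive_system_def)
qed

text \<open>Schur's lemma. Take a polynomial of least degree that kills \<open>z\<close> in the corner and split off
  a linear factor: the element \<open>z - c a\<close> then kills a nonzero element of the corner. Since nonzero
  elements have left inverses there, \<open>z = c a\<close>.\<close>

lemma corner_scalar:
  assumes aa: "a * a = a" "a \<noteq> 0" and prim: "\<And>x. x \<noteq> 0 \<Longrightarrow> x * a = x \<Longrightarrow> \<exists>y. y * x = a"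
    and z: "a * z = z" "z * a = z"
  shows "\<exists>c. z = scale c a"
proof -
  define ev where "ev = (\<lambda>p. fold_coeffs (\<lambda>c r. scale c a + z * r) p 0)"
  have ev_0: "ev 0 = 0" by (simp add: ev_def)
  have ev_pCons: "ev (pCons c p) = scale c a + z * ev p" for c p
    by (cases "c = 0 \<and> p = 0") (auto simp: ev_def)
  have ev_add: "ev (p + q) = ev p + ev q" for p q
    by (induction p q rule: poly_induct2)
      (auto simp: ev_0 ev_pCons scale_left_distrib distrib_left)
  have ev_smult: "ev (Polynomial.smult c p) = scale c (ev p)" for c p
    by (induction p) (auto simp: ev_0 ev_pCons scale_right_distrib scale_mult_right)
  have a_ev: "a * ev p = ev p" for p
    by (cases p) (auto simp: ev_pCons distrib_left scale_mult_right aa mult.assoc[symmetric] z)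
  have ev_linear: "ev ([:- c, 1:] * q) = (z - scale c a) * ev q" for c q
  proof -
    have "ev ([:- c, 1:] * q) = ev (Polynomial.smult (- c) q + pCons 0 q)" by simp
    also have "\<dots> = z * ev q - scale c (ev q)"
      by (simp only: ev_add ev_smult ev_pCons) simp
    finally show ?thesis by (simp add: left_diff_distrib scale_mult_left a_ev)
  qed
  have ev_monom: "ev (Polynomial.monom c i) = scale c (z ^ i * a)" for c i
    by (induction i) (auto simp: monom_0 monom_Suc ev_pCons ev_0 scale_mult_right mult.assoc)
  have ev_sum: "ev (sum f I) = (\<Sum>i\<in>I. ev (f i))" for f and I :: "nat set"
    by (induction I rule: infinite_finite_induct) (auto simp: ev_0 ev_add)
  obtain c where c: "\<exists>i\<le>d. c i \<noteq> 0" "(\<Sum>i\<le>d. scale (c i) (z ^ i * a)) = 0"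
    by (rule family_dependent)
  let ?p0 = "\<Sum>i\<le>d. Polynomial.monom (c i) i"
  have "coeff ?p0 i = c i" if "i \<le> d" for i
    using that by (simp add: coeff_sum)
  with c(1) have "?p0 \<noteq> 0" by (metis coeff_0)
  moreover have "ev ?p0 = 0" using c(2) by (simp add: ev_sum ev_monom)
  ultimately obtain p where p: "p \<noteq> 0" "ev p = 0"
      and min: "\<And>q. q \<noteq> 0 \<Longrightarrow> ev q = 0 \<Longrightarrow> degree p \<le> degree q"
    using ex_has_least_nat[of "\<lambda>p. p \<noteq> 0 \<and> ev p = 0" ?p0 degree] by blast
  have "degree p > 0"
  proof (rule ccontr)
    assume "\<not> degree p > 0"
    then obtain c where "p = [:c:]" by (auto elim: degree_eq_zeroE)
    then show False using p aa by (auto simp: ev_pCons ev_0)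
  qed
  then obtain c where "poly p c = 0" using alg_closed_imp_poly_has_root by blast
  then obtain q where q: "p = [:- c, 1:] * q" by (auto simp: poly_eq_0_iff_dvd)
  with p have "q \<noteq> 0" by auto
  then have "degree q < degree p" unfolding q by (subst degree_mult_eq) auto
  then have ev_q: "ev q \<noteq> 0" using min \<open>q \<noteq> 0\<close> by fastforce
  have "z - scale c a = 0"
  proof (rule ccontr)
    assume nz: "z - scale c a \<noteq> 0"
    have "(z - scale c a) * a = z - scale c a" by (simp add: algebra_simps z scale_mult_left aa)
    then obtain y where y: "y * (z - scale c a) = a" using prim[OF nz] by blast
    have "a * ev q = y * ((z - scale c a) * ev q)" by (simp add: y mult.assoc[symmetric])
    also have "\<dots> = 0" using p(2) q ev_linear by simp
    finally show False using ev_q a_ev by simp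
  qed
  then show ?thesis by auto
qed

text \<open>If \<open>a H b\<close> contains some \<open>t \<noteq> 0\<close>, then \<open>t\<close> has an inverse in \<open>b H a\<close>. Such a pair
  \<open>u a\<close>, \<open>u' a\<close> for \<open>a\<close> and the representative of its block yields \<open>E a b = u a u' b\<close>.\<close>

theorem matrix_units_exist: "\<exists>A rep E. matrix_units scale d A rep E"
proof -
  obtain A where A: "primitive_system A" using primitive_system_exists by blast
  then have fin: "finite A" and sumA: "\<Sum>A = 1" and nz: "\<And>a. a \<in> A \<Longrightarrow> a \<noteq> 0"
    and orth: "\<And>a b. a \<in> A \<Longrightarrow> b \<in> A \<Longrightarrow> a * b = (if a = b then a else 0)"
    and prim: "\<And>a x. a \<in> A \<Longrightarrow> x \<noteq> 0 \<Longrightarrow> x * a = x \<Longrightarrow> \<exists>y. y * x = a"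
    by (auto simp: primitive_system_def orthogonal_idempotents_def)
  have aa: "a * a = a" if "a \<in> A" for a using orth that by simp
  have scalar: "\<exists>c. z = scale c a" if "a \<in> A" "a * z = z" "z * a = z" for a z
    by (rule corner_scalar[OF aa nz prim]) (use that in auto)
  have inverse: "\<exists>s. s = b * s * a \<and> s * t = b \<and> t * s = a"
    if ab: "a \<in> A" "b \<in> A" and t: "a * t = t" "t * b = t" "t \<noteq> 0" for a b t
  proof -
    obtain y where y: "y * t = b" using prim[OF ab(2) t(3,2)] by blast
    define s where "s = b * y * a"
    have bs: "b * s = s" "s * a = s" using aa ab by (simp_all add: s_def mult.assoc) (simp add: mult.assoc[symmetric])
    have st: "s * t = b" using y t aa[OF ab(2)] by (simp add: s_def mult.assoc)
    have "a * (t * s) = t * s" "t * s * a = t * s" using t bs by (simp_all add: mult.assoc[symmetric]) (simp add: mult.assoc bs)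
    then obtain c where c: "t * s = scale c a" using scalar[OF ab(1)] by blast
    have "t = t * s * t" using st t by (simp add: mult.assoc)
    also have "\<dots> = scale c t" using c t by (simp add: scale_mult_left)
    finally have "scale (1 - c) t = 0" by (simp add: scale_left_diff_distrib)
    then have "c = 1" using t(3) by simp
    then show ?thesis using bs st c by (intro exI[of _ s]) (simp add: mult.assoc)
  qed
  define R where "R = (\<lambda>a b :: 'h. \<exists>t. a * t = t \<and> t * b = t \<and> t \<noteq> 0)"
  have R_refl: "R a a" if "a \<in> A" for a
    unfolding R_def using aa[OF that] nz[OF that] by blast
  have R_sym: "R b a" if ab: "a \<in> A" "b \<in> A" "R a b" for a b
  proof -
    obtain t where t: "a * t = t" "t * b = t" "t \<noteq> 0" using ab by (auto simp: R_def)
    obtain s where s: "s = b * s * a" "s * t = b" using inverse[OF ab(1,2) t] by blast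
    have "s \<noteq> 0" using s(2) nz[OF ab(2)] by auto
    moreover have "b * s = s" "s * a = s" using aa ab(1,2) s(1) by (metis mult.assoc)+
    ultimately show ?thesis unfolding R_def by blast
  qed
  have R_trans: "R a c" if ab: "a \<in> A" "b \<in> A" "c \<in> A" "R a b" "R b c" for a b c
  proof -
    obtain t where t: "a * t = t" "t * b = t" "t \<noteq> 0" using ab by (auto simp: R_def)
    obtain r where r: "b * r = r" "r * c = r" "r \<noteq> 0" using ab by (auto simp: R_def)
    obtain s where s: "s * t = b" using inverse[OF ab(1,2) t] by blast
    have "s * (t * r) = r" using s r by (simp add: mult.assoc[symmetric])
    then have "t * r \<noteq> 0" using r by auto
    then show ?thesis unfolding R_def using t r by (metis mult.assoc)
  qed
  define rep where "rep = (\<lambda>a. SOME b. b \<in> A \<and> R a b)"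
  have rep: "rep a \<in> A" "R a (rep a)" if "a \<in> A" for a
    using someI[of "\<lambda>b. b \<in> A \<and> R a b" a] R_refl that by (auto simp: rep_def)
  have rep_eq: "rep a = rep b \<longleftrightarrow> R a b" if "a \<in> A" "b \<in> A" for a b
  proof
    assume "rep a = rep b"
    then show "R a b" using rep R_sym R_trans that by metis
  next
    assume "R a b"
    then have "(\<lambda>c. c \<in> A \<and> R a c) = (\<lambda>c. c \<in> A \<and> R b c)"
      using R_sym R_trans that by blast
    then show "rep a = rep b" by (simp add: rep_def)
  qed
  have "\<exists>u. \<exists>u'. a * u = u \<and> u * rep a = u \<and> rep a * u' = u' \<and> u' * a = u' \<and> u' * u = rep a \<and> u * u' = a"
    if a: "a \<in> A" for a
  proof -
    obtain t where t: "a * t = t" "t * rep a = t" "t \<noteq> 0" using rep[OF a] by (auto simp: R_def)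
    obtain s where s: "s = rep a * s * a" "s * t = rep a" "t * s = a"
      using inverse[OF a rep(1)[OF a] t] by blast
    have "rep a * s = s" "s * a = s" using aa rep a s(1) by (metis mult.assoc)+
    then show ?thesis using t s by blast
  qed
  then have "\<forall>a\<in>A. \<exists>u. \<exists>u'. a * u = u \<and> u * rep a = u \<and> rep a * u' = u' \<and> u' * a = u' \<and>
      u' * u = rep a \<and> u * u' = a" by blast
  from bchoice[OF this] obtain u where "\<forall>a\<in>A. \<exists>u'. a * u a = u a \<and> u a * rep a = u a \<and>
      rep a * u' = u' \<and> u' * a = u' \<and> u' * u a = rep a \<and> u a * u' = a" by (elim exE)
  from bchoice[OF this] obtain u' where U: "\<forall>a\<in>A. a * u a = u a \<and> u a * rep a = u a \<and>
      rep a * u' a = u' a \<and> u' a * a = u' a \<and> u' a * u a = rep a \<and> u a * u' a = a" by (elim exE)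
  from U have u: "\<And>a. a \<in> A \<Longrightarrow> a * u a = u a" "\<And>a. a \<in> A \<Longrightarrow> u a * rep a = u a"
    and u': "\<And>a. a \<in> A \<Longrightarrow> rep a * u' a = u' a" "\<And>a. a \<in> A \<Longrightarrow> u' a * a = u' a"
    and uu: "\<And>a. a \<in> A \<Longrightarrow> u' a * u a = rep a" "\<And>a. a \<in> A \<Longrightarrow> u a * u' a = a"
    by simp_all
  define E where "E = (\<lambda>a b. u a * u' b)"
  have "matrix_units scale d A rep E"
  proof
    fix a assume a: "a \<in> A"
    show "a \<noteq> 0" using nz a .
    show "E a a = a" using uu a by (simp add: E_def)
  next
    fix a b assume ab: "a \<in> A" "b \<in> A" "rep a \<noteq> rep b"
    have "E a b = u a * (rep a * rep b) * u' b"
      using u(2)[OF ab(1)] u'(1)[OF ab(2)] by (metis E_def mult.assoc)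
    then show "E a b = 0" using orth[of "rep a" "rep b"] rep ab by simp
  next
    fix a b b' c assume abc: "a \<in> A" "b \<in> A" "b' \<in> A" "c \<in> A" "rep a = rep b" "rep b' = rep c"
    have "E a b * E b' c = u a * (u' b * u b') * u' c" by (simp add: E_def mult.assoc)
    moreover have "u' b * u b' = (if b = b' then rep b else 0)"
    proof (cases "b = b'")
      case False
      have "u' b * u b' = u' b * (b * b') * u b'"
        using u(1) u'(2) abc by (metis mult.assoc)
      then show ?thesis using orth abc False by simp
    qed (use uu abc in simp)
    ultimately show "E a b * E b' c = (if b = b' then E a c else 0)"
      using u(2)[OF abc(1)] abc(5) by (cases "b = b'") (simp_all add: E_def)
  next
    fix a b h assume ab: "a \<in> A" "b \<in> A"
    show "\<exists>c. a * h * b = scale c (E a b)"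
    proof (cases "rep a = rep b")
      case True
      let ?r = "rep a"
      have "?r * (u' a * (a * h * b) * u b) = u' a * (a * h * b) * u b"
        using u'(1)[OF ab(1)] by (simp add: mult.assoc[symmetric])
      moreover have "u' a * (a * h * b) * u b * ?r = u' a * (a * h * b) * u b"
        using u(2)[OF ab(2)] True by (simp add: mult.assoc)
      ultimately obtain c where c: "u' a * (a * h * b) * u b = scale c ?r"
        using scalar[OF rep(1)[OF ab(1)]] by blast
      have "a * h * b = (u a * u' a) * (a * h * b) * (u b * u' b)"
        using uu ab aa by (simp add: mult.assoc) (simp add: mult.assoc[symmetric] aa)
      also have "\<dots> = u a * (u' a * (a * h * b) * u b) * u' b" by (simp add: mult.assoc)
      also have "\<dots> = scale c (E a b)"
        using u(2)[OF ab(1)] by (simp add: c scale_mult_left scale_mult_right E_def)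
      finally show ?thesis by blast
    next
      case False
      then have "\<not> R a b" using rep_eq ab by blast
      moreover have "a * (a * h * b) = a * h * b" "a * h * b * b = a * h * b"
        using aa ab by (simp_all add: mult.assoc[symmetric]) (simp add: mult.assoc)
      ultimately have "a * h * b = 0" unfolding R_def by blast
      then show ?thesis by (intro exI[of _ 0]) simp
    qed
  qed (fact fin sumA)+
  then show ?thesis by blast
qed

end

section \<open>Matrix coefficients and irreducible characters\<close>

context matrix_units
begin

lemma E_nonzero:
  assumes "a \<in> A" "b \<in> A" "rep a = rep b" shows "E a b \<noteq> 0"
proof
  assume "E a b = 0"
  then have "E a a = 0" using E_mult[OF assms(1,2,2,1,3) assms(3)[symmetric]] by simp
  then show False using assms by (simp add: E_diag A_nonzero)
qed

definition coef :: "'h \<Rightarrow> 'h \<Rightarrow> 'h \<Rightarrow> 'k" where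
  "coef a b h = (if rep a = rep b then THE c. a * h * b = scale c (E a b) else 0)"

lemma coef_off: "rep a \<noteq> rep b \<Longrightarrow> coef a b h = 0"
  by (simp add: coef_def)

lemma coef_eqI:
  assumes "a \<in> A" "b \<in> A" "rep a = rep b" "a * h * b = scale c (E a b)"
  shows "coef a b h = c"
proof -
  have "(THE c. a * h * b = scale c (E a b)) = c"
  proof (rule the_equality)
    fix c' assume "a * h * b = scale c' (E a b)"
    from trans[OF this[symmetric] assms(4)] have "scale c' (E a b) = scale c (E a b)" .
    then show "c' = c" using E_nonzero[OF assms(1-3)] by (simp add: scale_cancel_right)
  qed fact
  then show ?thesis using assms(3) by (simp add: coef_def)
qed

lemma corner_coef:
  assumes "a \<in> A" "b \<in> A" shows "a * h * b = scale (coef a b h) (E a b)"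
proof -
  obtain c where c: "a * h * b = scale c (E a b)" using corner[OF assms] by blast
  show ?thesis
  proof (cases "rep a = rep b")
    case True
    then show ?thesis using coef_eqI[OF assms True c] c by simp
  next
    case False
    then show ?thesis using c E_off[OF assms] by simp
  qed
qed

lemma lin_coef_self: assumes "a \<in> A" "b \<in> A" shows "lin (*) (coef a b)"
proof (cases "rep a = rep b")
  case True
  show ?thesis
  proof (rule linI[OF vector_space_field])
    show "coef a b (x + y) = coef a b x + coef a b y" for x y
      using assms True
      by (intro coef_eqI) (auto simp: distrib_left distrib_right corner_coef scale_left_distrib)
    show "coef a b (scale c x) = c * coef a b x" for c x
      using assms True
      by (intro coef_eqI) (auto simp: scale_mult_left scale_mult_right corner_coef)
  qed
next
  case False
  then have "coef a b = (\<lambda>x. 0)" by (auto simp: coef_off)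
  then show ?thesis by (simp add: lin_zero_fun vector_space_field)
qed

lemma expansion: "h = (\<Sum>a\<in>A. \<Sum>b\<in>A. scale (coef a b h) (E a b))"
proof -
  have "h = \<Sum>A * h * \<Sum>A" by (simp add: sum_A)
  also have "\<dots> = (\<Sum>a\<in>A. \<Sum>b\<in>A. a * h * b)"
    by (simp add: sum_distrib_left sum_distrib_right) (rule sum.swap)
  also have "\<dots> = (\<Sum>a\<in>A. \<Sum>b\<in>A. scale (coef a b h) (E a b))"
    by (intro sum.cong refl corner_coef)
  finally show ?thesis .
qed

lemma A_mult_E:
  assumes "a \<in> A" "b \<in> A" "c \<in> A"
  shows "a * E b c = (if a = b then E b c else 0)" "E b c * a = (if c = a then E b c else 0)"
proof -
  show "a * E b c = (if a = b then E b c else 0)"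
  proof (cases "rep b = rep c")
    case True
    then show ?thesis using E_mult[of a a b c] assms by (simp add: E_diag)
  qed (use assms in \<open>auto simp: E_off\<close>)
  show "E b c * a = (if c = a then E b c else 0)"
  proof (cases "rep b = rep c")
    case True
    then show ?thesis using E_mult[of b c a a] assms by (simp add: E_diag)
  qed (use assms in \<open>auto simp: E_off\<close>)
qed

lemma A_orthogonal: "a \<in> A \<Longrightarrow> b \<in> A \<Longrightarrow> a * b = (if a = b then a else 0)"
  using A_mult_E(1)[of a b b] by (simp add: E_diag)

lemma coef_E:
  assumes "a \<in> A" "b \<in> A" "c \<in> A" "e \<in> A" "rep c = rep e"
  shows "coef a b (E c e) = (if a = c \<and> b = e then 1 else 0)"
proof (cases "rep a = rep b")
  case True
  then show ?thesis using assms by (intro coef_eqI) (auto simp: A_mult_E)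
qed (use assms in \<open>auto simp: coef_off\<close>)

lemma coef_mult:
  assumes "a \<in> A" "b \<in> A"
  shows "coef a b (x * y) = (\<Sum>c\<in>A. coef a c x * coef c b y)"
proof (cases "rep a = rep b")
  case True
  have "a * (x * y) * b = (a * x) * \<Sum>A * (y * b)" by (simp add: sum_A mult.assoc)
  also have "\<dots> = (\<Sum>c\<in>A. a * x * c * (y * b))"
    by (simp add: sum_distrib_left sum_distrib_right)
  also have "\<dots> = (\<Sum>c\<in>A. (a * x * c) * (c * y * b))"
  proof (intro sum.cong refl)
    fix c assume "c \<in> A"
    then have "c * c = c" by (simp add: A_orthogonal)
    then show "a * x * c * (y * b) = (a * x * c) * (c * y * b)"
      by (metis mult.assoc)
  qed
  also have "\<dots> = (\<Sum>c\<in>A. scale (coef a c x * coef c b y) (E a b))"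
  proof (intro sum.cong refl)
    fix c assume c: "c \<in> A"
    have "(a * x * c) * (c * y * b) = scale (coef a c x * coef c b y) (E a c * E c b)"
      unfolding corner_coef[OF assms(1) c] corner_coef[OF c assms(2)]
      by (simp only: scale_mult_left scale_mult_right scale_scale mult.commute[of "coef c b y"])
    also have "\<dots> = scale (coef a c x * coef c b y) (E a b)"
    proof (cases "rep a = rep c")
      case True
      then have "rep c = rep b" using \<open>rep a = rep b\<close> by (rule trans[OF sym])
      from E_mult[OF assms(1) c c assms(2) True this] show ?thesis by simp
    qed (simp add: coef_off)
    finally show "(a * x * c) * (c * y * b) = scale (coef a c x * coef c b y) (E a b)" .
  qed
  finally show ?thesis using assms True by (intro coef_eqI) (simp_all add: scale_sum_left)
next
  case False
  have "(\<Sum>c\<in>A. coef a c x * coef c b y) = 0"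
    by (intro sum.neutral ballI) (use False in \<open>auto simp: coef_def\<close>)
  then show ?thesis using False by (simp add: coef_off)
qed

definition block :: "'h \<Rightarrow> 'h set" where "block i = {a \<in> A. rep a = i}"

definition block_trace :: "'h \<Rightarrow> 'h \<Rightarrow> 'k" where
  "block_trace i h = (\<Sum>a\<in>block i. coef a a h)"

definition deg :: "'h \<Rightarrow> nat" where "deg i = card (block i)"

definition full_trace :: "'h \<Rightarrow> 'k" where
  "full_trace h = (\<Sum>a\<in>A. coef a a h)"

text \<open>The element \<open>\<Sum>\<^sub>i f(i) e\<^sub>i\<close>, where \<open>e\<^sub>i\<close> is the unit element of the block \<open>i\<close>. The lemma
  \<open>center_eq\<close> says that these are all central elements.\<close>

definition central :: "('h \<Rightarrow> 'k) \<Rightarrow> 'h" where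
  "central f = (\<Sum>a\<in>A. scale (f (rep a)) a)"

lemma finite_block: "finite (block i)" using finite_A by (simp add: block_def)

lemma block_in: "a \<in> block i \<Longrightarrow> a \<in> A" "a \<in> block i \<Longrightarrow> rep a = i" by (auto simp: block_def)

lemma deg_pos: "i \<in> rep ` A \<Longrightarrow> deg i > 0"
  using finite_block by (auto simp: deg_def card_gt_0_iff block_def)

lemma sum_blocks: "(\<Sum>a\<in>A. f a) = (\<Sum>i\<in>rep ` A. \<Sum>a\<in>block i. f a)"
  unfolding block_def using finite_A by (rule sum.image_gen)

lemma lin_block_trace_self: "lin (*) (block_trace i)"
  unfolding block_trace_def[abs_def]
  by (intro lin_sum_fun vector_space_field lin_coef_self) (auto simp: block_in)

lemma lin_full_trace_self: "lin (*) full_trace"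
  unfolding full_trace_def[abs_def]
  by (intro lin_sum_fun vector_space_field lin_coef_self)

lemma lin_full_trace: "lin scale g \<Longrightarrow> lin (*) (\<lambda>x. full_trace (g x))"
  by (rule lin_compose[OF lin_full_trace_self])

lemma block_trace_mult:
  "block_trace i (x * y) = (\<Sum>a\<in>block i. \<Sum>b\<in>block i. coef a b x * coef b a y)"
  unfolding block_trace_def
proof (intro sum.cong refl)
  fix a assume a: "a \<in> block i"
  have "coef a a (x * y) = (\<Sum>b\<in>A. coef a b x * coef b a y)"
    using a by (simp add: coef_mult block_in)
  also have "\<dots> = (\<Sum>b\<in>block i. coef a b x * coef b a y)"
    using a by (intro sum.mono_neutral_right finite_A) (auto simp: block_def coef_off)
  finally show "coef a a (x * y) = (\<Sum>b\<in>block i. coef a b x * coef b a y)" .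
qed

lemma block_trace_comm: "block_trace i (x * y) = block_trace i (y * x)"
  unfolding block_trace_mult by (subst sum.swap) (simp add: mult.commute)

lemma full_trace_blocks: "full_trace h = (\<Sum>i\<in>rep ` A. block_trace i h)"
  unfolding full_trace_def block_trace_def by (rule sum_blocks)

lemma full_trace_comm: "full_trace (x * y) = full_trace (y * x)"
  unfolding full_trace_blocks by (intro sum.cong refl block_trace_comm)

lemma full_trace_E:
  assumes "a \<in> A" "b \<in> A" shows "full_trace (x * E a b) = coef b a x"
proof (cases "rep a = rep b")
  case True
  have "full_trace (x * E a b) = (\<Sum>c\<in>A. \<Sum>e\<in>A. coef c e x * coef e c (E a b))"
    by (simp add: full_trace_def coef_mult)
  also have "\<dots> = (\<Sum>c\<in>A. \<Sum>e\<in>A. if c = b then if e = a then coef c e x else 0 else 0)"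
    using assms True by (intro sum.cong refl) (auto simp: coef_E)
  also have "\<dots> = (\<Sum>c\<in>A. if c = b then coef c a x else 0)"
    by (intro sum.cong refl) (use finite_A assms in simp)
  also have "\<dots> = coef b a x" using finite_A assms by simp
  finally show ?thesis .
next
  case False
  then show ?thesis using assms by (simp add: E_off coef_off lin_zero[OF lin_full_trace_self])
qed

text \<open>The matrix units \<open>E a b\<close> and \<open>E b a\<close> are dual bases for the trace form.\<close>

lemma trace_expansion: "h = (\<Sum>a\<in>A. \<Sum>b\<in>A. scale (full_trace (h * E b a)) (E a b))"
proof -
  have "h = (\<Sum>a\<in>A. \<Sum>b\<in>A. scale (coef a b h) (E a b))" by (rule expansion)
  also have "\<dots> = (\<Sum>a\<in>A. \<Sum>b\<in>A. scale (full_trace (h * E b a)) (E a b))"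
    by (intro sum.cong refl) (simp add: full_trace_E)
  finally show ?thesis .
qed

lemma trace_nondegenerate:
  assumes "\<And>y. full_trace (x * y) = full_trace (x' * y)" shows "x = x'"
proof -
  have "x = (\<Sum>a\<in>A. \<Sum>b\<in>A. scale (full_trace (x * E b a)) (E a b))" by (rule trace_expansion)
  also have "\<dots> = x'" unfolding assms by (rule trace_expansion[symmetric])
  finally show ?thesis .
qed

lemma coef_central_mult:
  assumes "a \<in> A" "b \<in> A"
  shows "coef a b (central f * x) = f (rep a) * coef a b x"
    "coef a b (x * central f) = f (rep a) * coef a b x"
proof -
  have l: "a * central f = scale (f (rep a)) a" if "a \<in> A" for a
  proof -
    have "a * central f = (\<Sum>c\<in>A. scale (f (rep c)) (a * c))"
      by (simp add: central_def sum_distrib_left scale_mult_right)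
    also have "\<dots> = (\<Sum>c\<in>A. if a = c then scale (f (rep a)) a else 0)"
      using that by (intro sum.cong refl) (auto simp: A_orthogonal)
    finally show ?thesis using that finite_A by simp
  qed
  have r: "central f * a = scale (f (rep a)) a" if "a \<in> A" for a
  proof -
    have "central f * a = (\<Sum>c\<in>A. scale (f (rep c)) (c * a))"
      by (simp add: central_def sum_distrib_right scale_mult_left)
    also have "\<dots> = (\<Sum>c\<in>A. if a = c then scale (f (rep a)) a else 0)"
      using that by (intro sum.cong refl) (auto simp: A_orthogonal)
    finally show ?thesis using that finite_A by simp
  qed
  show "coef a b (central f * x) = f (rep a) * coef a b x"
  proof (cases "rep a = rep b")
    case True
    have "a * (central f * x) * b = (a * central f) * x * b" by (simp add: mult.assoc)
    also have "\<dots> = scale (f (rep a) * coef a b x) (E a b)"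
      by (simp only: l[OF assms(1)] scale_mult_left corner_coef[OF assms] scale_scale)
    finally show ?thesis using assms True by (intro coef_eqI)
  qed (simp add: coef_off)
  show "coef a b (x * central f) = f (rep a) * coef a b x"
  proof (cases "rep a = rep b")
    case True
    have "a * (x * central f) * b = a * x * (central f * b)" by (simp add: mult.assoc)
    also have "\<dots> = scale (f (rep a) * coef a b x) (E a b)"
      by (simp only: r[OF assms(2)] True scale_mult_right corner_coef[OF assms] scale_scale)
    finally show ?thesis using assms True by (intro coef_eqI)
  qed (simp add: coef_off)
qed

lemma coef_eq_imp_eq:
  assumes "\<And>a b. a \<in> A \<Longrightarrow> b \<in> A \<Longrightarrow> coef a b x = coef a b y" shows "x = y"
proof -
  have "x = (\<Sum>a\<in>A. \<Sum>b\<in>A. scale (coef a b x) (E a b))" by (rule expansion)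
  also have "\<dots> = (\<Sum>a\<in>A. \<Sum>b\<in>A. scale (coef a b y) (E a b))" by (simp add: assms)
  also have "\<dots> = y" by (rule expansion[symmetric])
  finally show ?thesis .
qed

lemma central_commute: "central f * x = x * central f"
  by (rule coef_eq_imp_eq) (simp add: coef_central_mult)

lemma central_in_center: "central f \<in> center"
  by (simp add: center_def central_commute)

lemma central_one: "central (\<lambda>i. 1) = 1"
  by (simp add: central_def sum_A)

lemma central_scale: "scale c (central f) = central (\<lambda>i. c * f i)"
  by (simp add: central_def scale_sum_right)

lemma central_sum: "(\<Sum>t\<in>X. central (f t)) = central (\<lambda>i. \<Sum>t\<in>X. f t i)"
  unfolding central_def scale_sum_left by (rule sum.swap)

lemma central_mult: "central f * central g = central (\<lambda>i. f i * g i)"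
proof (rule coef_eq_imp_eq)
  fix a b assume ab: "a \<in> A" "b \<in> A"
  have "coef a b (central f * central g) = f (rep a) * (g (rep a) * coef a b 1)"
    using coef_central_mult(1)[OF ab, of f "central g"] coef_central_mult(1)[OF ab, of g 1] by simp
  also have "\<dots> = coef a b (central (\<lambda>i. f i * g i))"
    using coef_central_mult(1)[OF ab, of "\<lambda>i. f i * g i" 1] by simp
  finally show "coef a b (central f * central g) = coef a b (central (\<lambda>i. f i * g i))" .
qed

lemma central_power: "central f ^ n = central (\<lambda>i. f i ^ n)"
  by (induction n) (simp_all add: central_one central_mult)

lemma central_cong: "(\<And>i. i \<in> rep ` A \<Longrightarrow> f i = g i) \<Longrightarrow> central f = central g"
  by (simp add: central_def)

lemma coef_one: "a \<in> A \<Longrightarrow> b \<in> A \<Longrightarrow> coef a b 1 = (if a = b then 1 else 0)"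
proof -
  assume ab: "a \<in> A" "b \<in> A"
  show ?thesis
  proof (cases "rep a = rep b")
    case True
    then show ?thesis using ab by (intro coef_eqI) (auto simp: A_orthogonal E_diag)
  qed (auto simp: coef_off)
qed

lemma coef_central: "a \<in> A \<Longrightarrow> b \<in> A \<Longrightarrow> coef a b (central f) = (if a = b then f (rep a) else 0)"
  using coef_central_mult(1)[of a b f 1] by (simp add: coef_one)

lemma block_trace_central_mult: "block_trace i (central f * x) = f i * block_trace i x"
  unfolding block_trace_def sum_distrib_left
  by (intro sum.cong refl) (auto simp: coef_central_mult block_in)

lemma block_trace_one: "block_trace i 1 = of_nat (deg i)"
  by (simp add: block_trace_def deg_def coef_one block_in)

lemma block_trace_central: "block_trace i (central f) = f i * of_nat (deg i)"
  using block_trace_central_mult[of i f 1] by (simp add: block_trace_one)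

text \<open>An element that commutes with the matrix units has no coefficients off the diagonal, and its
  diagonal coefficients are constant on every block.\<close>

lemma center_eq: "center = range central"
proof
  show "range central \<subseteq> center" using central_in_center by auto
  show "center \<subseteq> range central"
  proof
    fix z :: 'h assume "z \<in> center"
    then have z: "z * h = h * z" for h by (simp add: center_def)
    have "coef b b z = coef a a z" if ab: "a \<in> A" "b \<in> A" "rep a = rep b" for a b
    proof -
      have "coef b b z = full_trace (z * E b b)" using ab by (simp add: full_trace_E)
      also have "\<dots> = full_trace (z * (E b a * E a b))" 
        by (simp only: E_mult[OF ab(2,1,1,2) ab(3)[symmetric] ab(3)] if_True simp_thms)
      also have "\<dots> = full_trace (E b a * (z * E a b))" by (metis z mult.assoc)
      also have "\<dots> = full_trace (z * E a b * E b a)" by (rule full_trace_comm)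
      also have "\<dots> = full_trace (z * E a a)"
        by (simp only: mult.assoc E_mult[OF ab(1,2,2,1,3) ab(3)[symmetric]] if_True simp_thms)
      also have "\<dots> = coef a a z" by (rule full_trace_E[OF ab(1,1)])
      finally show ?thesis .
    qed
    note diag = this
    define f where "f = (\<lambda>i. coef (SOME a. a \<in> block i) (SOME a. a \<in> block i) z)"
    have f: "f (rep a) = coef a a z" if "a \<in> A" for a
    proof -
      have "(SOME b. b \<in> block (rep a)) \<in> block (rep a)"
        by (rule someI[of _ a]) (use that in \<open>simp add: block_def\<close>)
      then show ?thesis unfolding f_def using that by (intro diag) (auto simp: block_def)
    qed
    have "z = central f"
    proof (rule coef_eq_imp_eq)
      fix a b assume ab: "a \<in> A" "b \<in> A"
      show "coef a b z = coef a b (central f)"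
      proof (cases "a = b")
        case True
        then show ?thesis using ab f by (simp add: coef_central)
      next
        case False
        have "coef a b z = full_trace (z * E b a)" using ab by (simp add: full_trace_E)
        also have "\<dots> = full_trace (z * (b * E b a))" using ab by (simp add: A_mult_E)
        also have "\<dots> = full_trace (b * (z * E b a))" by (metis z mult.assoc)
        also have "\<dots> = full_trace (z * E b a * b)" by (rule full_trace_comm)
        also have "\<dots> = 0"
          using ab False by (simp add: A_mult_E mult.assoc lin_zero[OF lin_full_trace_self])
        finally show ?thesis using ab False by (simp add: coef_central)
      qed
    qed
    then show "z \<in> range central" by simp
  qed
qed

text \<open>Left multiplication by \<open>h\<close> acts on each column of a block as the matrix of \<open>h\<close> in that
  block, and block \<open>i\<close> has \<open>deg i\<close> columns.\<close>

lemma regular_char_eq: "regular_char scale h = (\<Sum>i\<in>rep ` A. of_nat (deg i) * block_trace i h)"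
proof -
  let ?J = "{(a, b). a \<in> A \<and> b \<in> A \<and> rep a = rep b}"
  have fin: "finite ?J" by (rule finite_subset[of _ "A \<times> A"]) (use finite_A in auto)
  have J: "(\<Sum>a\<in>A. \<Sum>b\<in>A. g a b) = (\<Sum>(a, b)\<in>?J. g a b)"
    if "\<And>a b. a \<in> A \<Longrightarrow> b \<in> A \<Longrightarrow> rep a \<noteq> rep b \<Longrightarrow> g a b = 0"
    for g :: "'h \<Rightarrow> 'h \<Rightarrow> 'w::comm_monoid_add"
    unfolding sum.cartesian_product by (intro sum.mono_neutral_right) (use finite_A that in auto)
  have "coordinates ?J (\<lambda>(a, b). E a b) (\<lambda>(a, b). coef a b)"
    unfolding coordinates_def
  proof (intro conjI ballI allI fin)
    show "lin (*) (case j of (a, b) \<Rightarrow> coef a b)" if "j \<in> ?J" for j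
      using that by (auto intro: lin_coef_self)
    show "x = (\<Sum>j\<in>?J. scale ((case j of (a, b) \<Rightarrow> coef a b) x) (case j of (a, b) \<Rightarrow> E a b))" for x
    proof -
      have "x = (\<Sum>a\<in>A. \<Sum>b\<in>A. scale (coef a b x) (E a b))" by (rule expansion)
      also have "\<dots> = (\<Sum>(a, b)\<in>?J. scale (coef a b x) (E a b))" by (rule J) (simp add: coef_off)
      finally show ?thesis by (simp add: case_prod_unfold)
    qed
  qed
  then have "regular_char scale h = (\<Sum>j\<in>?J. (case j of (a, b) \<Rightarrow> coef a b) (h * (case j of (a, b) \<Rightarrow> E a b)))"
    unfolding regular_char_def by (intro lin_trace_coordinates lin_mult_left lin_self)
  also have "\<dots> = (\<Sum>(a, b)\<in>?J. coef a a h)"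
  proof (intro sum.cong refl, clarify)
    fix a b assume ab: "a \<in> A" "b \<in> A" "rep a = rep b"
    have "coef a b (h * E a b) = (\<Sum>c\<in>A. if c = a then coef a a h else 0)"
      unfolding coef_mult[OF ab(1,2)] by (intro sum.cong refl) (use ab in \<open>auto simp: coef_E\<close>)
    then show "coef a b (h * E a b) = coef a a h" using ab finite_A by simp
  qed
  also have "\<dots> = (\<Sum>(a, b)\<in>?J. if rep a = rep b then coef a a h else 0)"
    by (intro sum.cong) auto
  also have "\<dots> = (\<Sum>a\<in>A. \<Sum>b\<in>A. if rep a = rep b then coef a a h else 0)"
    by (rule J[symmetric]) auto
  also have "\<dots> = (\<Sum>a\<in>A. of_nat (deg (rep a)) * coef a a h)"
  proof (intro sum.cong refl)
    fix a
    have "{b \<in> A. rep a = rep b} = block (rep a)" by (auto simp: block_def)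
    then show "(\<Sum>b\<in>A. if rep a = rep b then coef a a h else 0) = of_nat (deg (rep a)) * coef a a h"
      using finite_A by (simp add: sum.If_cases Int_def deg_def)
  qed
  also have "\<dots> = (\<Sum>i\<in>rep ` A. of_nat (deg i) * block_trace i h)"
    unfolding sum_blocks block_trace_def sum_distrib_left
    by (intro sum.cong refl) (auto simp: block_in)
  finally show ?thesis .
qed

lemma regular_char_trace:
  "regular_char scale h = full_trace (central (\<lambda>i. of_nat (deg i)) * h)"
  by (simp add: regular_char_eq full_trace_blocks block_trace_central_mult)

end

locale matrix_units_char0 = matrix_units scale d A rep E
  for scale :: "'k::field_char_0 \<Rightarrow> 'h::ring_1 \<Rightarrow> 'h" and d A rep E
begin

text \<open>The coefficients in one block form a representation. It is irreducible because the matrix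
  units move any nonzero coordinate of a vector to any other place.\<close>

lemma block_rep:
  assumes i: "i \<in> rep ` A"
  shows "\<exists>\<rho>. irreducible_rep scale (deg i) \<rho> \<and> character_of \<rho> = block_trace i"
proof -
  let ?n = "deg i"
  obtain en where en: "bij_betw en {..<?n} (block i)"
    using ex_bij_betw_nat_finite[OF finite_block] by (auto simp: deg_def atLeast0LessThan)
  have enB: "en j \<in> block i" if "j < ?n" for j
    using en that by (auto simp: bij_betw_def)
  then have enA: "en j \<in> A" "rep (en j) = i" if "j < ?n" for j
    using that by (auto simp: block_def)
  have en_eq: "en j = en l \<longleftrightarrow> j = l" if "j < ?n" "l < ?n" for j l
    using en that by (auto simp: bij_betw_def inj_on_def)
  define \<rho> where "\<rho> = (\<lambda>h. mat ?n ?n (\<lambda>(j, l). coef (en j) (en l) h))"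
  have dim: "\<rho> h \<in> carrier_mat ?n ?n" for h by (simp add: \<rho>_def)
  have \<rho>_index: "\<rho> h $$ (j, l) = coef (en j) (en l) h" if "j < ?n" "l < ?n" for h j l
    using that by (simp add: \<rho>_def)
  have rep: "is_rep scale ?n \<rho>" unfolding is_rep_def
  proof (intro conjI allI dim)
    show "\<rho> (x + y) = \<rho> x + \<rho> y" for x y
      by (rule eq_matI) (auto simp: \<rho>_def lin_add[OF lin_coef_self] enA)
    show "\<rho> (scale c x) = c \<cdot>\<^sub>m \<rho> x" for c x
      by (rule eq_matI) (auto simp: \<rho>_def lin_scale[OF lin_coef_self] enA)
    show "\<rho> 1 = 1\<^sub>m ?n"
      by (rule eq_matI) (auto simp: \<rho>_def coef_one enA en_eq)
    show "\<rho> (x * y) = \<rho> x * \<rho> y" for x y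
    proof (rule eq_matI)
      fix j l assume "j < dim_row (\<rho> x * \<rho> y)" "l < dim_col (\<rho> x * \<rho> y)"
      then have jl: "j < ?n" "l < ?n" by (simp_all add: \<rho>_def)
      have "\<rho> (x * y) $$ (j, l) = (\<Sum>c\<in>A. coef (en j) c x * coef c (en l) y)"
        using jl by (simp add: \<rho>_index coef_mult enA)
      also have "\<dots> = (\<Sum>c\<in>block i. coef (en j) c x * coef c (en l) y)"
      proof (intro sum.mono_neutral_right finite_A ballI)
        show "coef (en j) c x * coef c (en l) y = 0" if "c \<in> A - block i" for c
          using that enA(2)[OF jl(1)] coef_off[of "en j" c x] by (auto simp: block_def)
      qed (auto simp: block_in)
      also have "\<dots> = (\<Sum>m<?n. coef (en j) (en m) x * coef (en m) (en l) y)"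
        by (rule sum.reindex_bij_betw[OF en, symmetric])
      also have "\<dots> = (\<rho> x * \<rho> y) $$ (j, l)"
        using jl by (simp add: \<rho>_def scalar_prod_def atLeast0LessThan)
      finally show "\<rho> (x * y) $$ (j, l) = (\<rho> x * \<rho> y) $$ (j, l)" .
    qed (simp_all add: \<rho>_def)
  qed
  have "irreducible_rep scale ?n \<rho>" unfolding irreducible_rep_def
  proof (intro conjI allI impI rep deg_pos i)
    fix W assume W: "invariant_subspace ?n \<rho> W"
    have Wc: "W \<subseteq> carrier_vec ?n" and W0: "0\<^sub>v ?n \<in> W"
      and Wadd: "\<And>v w. v \<in> W \<Longrightarrow> w \<in> W \<Longrightarrow> v + w \<in> W"
      and Wsc: "\<And>c w. w \<in> W \<Longrightarrow> c \<cdot>\<^sub>v w \<in> W"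
      and Wr: "\<And>x w. w \<in> W \<Longrightarrow> \<rho> x *\<^sub>v w \<in> W"
      using W by (auto simp: invariant_subspace_def)
    show "W = {0\<^sub>v ?n} \<or> W = carrier_vec ?n"
    proof (rule disjCI)
      assume "W \<noteq> carrier_vec ?n"
      show "W = {0\<^sub>v ?n}"
      proof (rule ccontr)
        assume "W \<noteq> {0\<^sub>v ?n}"
        then obtain v where v: "v \<in> W" "v \<noteq> 0\<^sub>v ?n" using W0 by blast
        have vdim: "dim_vec v = ?n" using v(1) Wc by auto
        obtain j0 where j0: "j0 < ?n" "v $ j0 \<noteq> 0"
        proof (rule ccontr)
          assume "\<not> thesis"
          then have "v = 0\<^sub>v ?n" using vdim that by (intro eq_vecI) auto
          then show False using v by simp
        qed
        have unit: "unit_vec ?n j \<in> W" if j: "j < ?n" for j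
        proof -
          have "\<rho> (E (en j) (en j0)) *\<^sub>v v = v $ j0 \<cdot>\<^sub>v unit_vec ?n j"
          proof (rule eq_vecI)
            fix l assume "l < dim_vec (v $ j0 \<cdot>\<^sub>v unit_vec ?n j)"
            then have l: "l < ?n" by simp
            have "(\<rho> (E (en j) (en j0)) *\<^sub>v v) $ l
                = (\<Sum>m<?n. coef (en l) (en m) (E (en j) (en j0)) * v $ m)"
              using l vdim by (simp add: \<rho>_def scalar_prod_def atLeast0LessThan)
            also have "\<dots> = (\<Sum>m<?n. if m = j0 then (if l = j then v $ j0 else 0) else 0)"
              using l j j0 by (intro sum.cong refl) (auto simp: coef_E enA en_eq)
            also have "\<dots> = (v $ j0 \<cdot>\<^sub>v unit_vec ?n j) $ l"
              using j0 l j by simp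
            finally show "(\<rho> (E (en j) (en j0)) *\<^sub>v v) $ l = (v $ j0 \<cdot>\<^sub>v unit_vec ?n j) $ l" .
          qed (simp add: \<rho>_def)
          with Wr[OF v(1), of "E (en j) (en j0)"] have "v $ j0 \<cdot>\<^sub>v unit_vec ?n j \<in> W" by simp
          then have "inverse (v $ j0) \<cdot>\<^sub>v (v $ j0 \<cdot>\<^sub>v unit_vec ?n j) \<in> W" by (rule Wsc)
          then show ?thesis using j0(2) by (simp add: smult_smult_assoc)
        qed
        have "carrier_vec ?n \<subseteq> W"
        proof
          fix w :: "'k vec" assume w: "w \<in> carrier_vec ?n"
          have "vec ?n (\<lambda>j. if j < k then w $ j else 0) \<in> W" if "k \<le> ?n" for k
            using that
          proof (induction k)
            case 0
            have "vec ?n (\<lambda>j. if j < 0 then w $ j else 0) = 0\<^sub>v ?n" by (rule eq_vecI) auto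
            then show ?case using W0 by simp
          next
            case (Suc k)
            have "vec ?n (\<lambda>j. if j < Suc k then w $ j else 0)
                = vec ?n (\<lambda>j. if j < k then w $ j else 0) + w $ k \<cdot>\<^sub>v unit_vec ?n k"
              using Suc.prems by (intro eq_vecI) (auto simp: less_Suc_eq)
            then show ?case using Suc by (simp add: Wadd Wsc unit)
          qed
          moreover have "vec ?n (\<lambda>j. if j < ?n then w $ j else 0) = w"
            using w by (intro eq_vecI) auto
          ultimately show "w \<in> W" by (metis order_refl)
        qed
        then show False using \<open>W \<noteq> carrier_vec ?n\<close> Wc by blast
      qed
    qed
  qed
  moreover have "character_of \<rho> h = block_trace i h" for h
  proof -
    have "character_of \<rho> h = (\<Sum>j<?n. coef (en j) (en j) h)"
      by (simp add: character_of_def \<rho>_def)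
    also have "\<dots> = block_trace i h"
      unfolding block_trace_def by (rule sum.reindex_bij_betw[OF en])
    finally show ?thesis .
  qed
  ultimately show ?thesis by blast
qed

text \<open>Some \<open>a\<close> in \<open>A\<close> acts as a nonzero operator, and a vector \<open>u\<close> fixed by it generates the
  representation. As \<open>a x a\<close> is always a multiple of \<open>a\<close>, the operator of \<open>a\<close> maps everything into
  the line of \<open>u\<close>, so it has trace 1. Moving it around with matrix units gives trace 1 to every
  diagonal unit of the block of \<open>a\<close>; the remaining units have trace 0.\<close>

lemma irreducible_rep_character:
  assumes irr: "irreducible_rep scale m \<rho>"
  shows "\<exists>i\<in>rep ` A. character_of \<rho> = block_trace i \<and> m = deg i"
proof -
  have R: "\<rho> x \<in> carrier_mat m m" "\<rho> (x + y) = \<rho> x + \<rho> y" "\<rho> (scale c x) = c \<cdot>\<^sub>m \<rho> x"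
    "\<rho> 1 = 1\<^sub>m m" "\<rho> (x * y) = \<rho> x * \<rho> y" for x y c
    using irr by (auto simp: irreducible_rep_def is_rep_def)
  have dims: "dim_row (\<rho> x) = m" "dim_col (\<rho> x) = m" for x using R(1)[of x] by auto
  have m: "m > 0" using irr by (simp add: irreducible_rep_def)
  let ?\<chi> = "character_of \<rho>"
  have \<chi>_alt: "?\<chi> h = (\<Sum>j<m. \<rho> h $$ (j, j))" for h by (simp add: character_of_def dims)
  have \<chi>_lin: "lin (*) ?\<chi>"
    by (intro linI vector_space_field)
      (auto simp: \<chi>_alt R(2,3) dims sum.distrib sum_distrib_left)
  have \<chi>_comm: "?\<chi> (x * y) = ?\<chi> (y * x)" for x y
  proof -
    have "?\<chi> (x * y) = (\<Sum>j<m. \<Sum>l<m. \<rho> x $$ (j, l) * \<rho> y $$ (l, j))" for x y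
      by (simp add: \<chi>_alt R(5) dims scalar_prod_def atLeast0LessThan)
    then show ?thesis by simp (subst sum.swap, simp add: mult.commute)
  qed
  have R0: "\<rho> 0 = 0\<^sub>m m m"
  proof -
    have "\<rho> 0 = 0 \<cdot>\<^sub>m \<rho> 0" using R(3)[of 0 0] by simp
    also have "\<dots> = 0\<^sub>m m m" using R(1)[of 0] by (intro eq_matI) auto
    finally show ?thesis .
  qed
  have act: "\<rho> (x * y) *\<^sub>v v = \<rho> x *\<^sub>v (\<rho> y *\<^sub>v v)" if "v \<in> carrier_vec m" for x y v
    using assoc_mult_mat_vec[OF R(1) R(1) that] by (simp add: R(5))
  have smult_vec: "(c \<cdot>\<^sub>m \<rho> x) *\<^sub>v v = c \<cdot>\<^sub>v (\<rho> x *\<^sub>v v)" if "v \<in> carrier_vec m" for c x v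
    using that by (intro eq_vecI) (auto simp: dims scalar_prod_def sum_distrib_left mult.assoc)
  have "\<exists>a\<in>A. \<rho> a \<noteq> 0\<^sub>m m m"
  proof (rule ccontr)
    assume no: "\<not> (\<exists>a\<in>A. \<rho> a \<noteq> 0\<^sub>m m m)"
    have "\<rho> (\<Sum>B) = 0\<^sub>m m m" if "B \<subseteq> A" for B
      using finite_subset[OF that finite_A] that
      by (induction B rule: finite_induct) (use no in \<open>auto simp: R0 R(2)\<close>)
    from this[of A] have "(0\<^sub>m m m :: 'k mat) = 1\<^sub>m m" by (simp add: sum_A R(4))
    then have "(0\<^sub>m m m :: 'k mat) $$ (0, 0) = 1\<^sub>m m $$ (0, 0)" by simp
    then show False using m by simp
  qed
  then obtain a where a: "a \<in> A" "\<rho> a \<noteq> 0\<^sub>m m m" by blast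
  obtain j0 l0 where jl: "j0 < m" "l0 < m" "\<rho> a $$ (j0, l0) \<noteq> 0"
  proof (rule ccontr)
    assume "\<not> thesis"
    then have "\<rho> a = 0\<^sub>m m m" using that by (intro eq_matI) (auto simp: dims)
    then show False using a by simp
  qed
  have col_a: "\<rho> x *\<^sub>v unit_vec m l = col (\<rho> x) l" if "l < m" for x l
    using that by (intro eq_vecI) (simp_all add: dims)
  define u where "u = \<rho> a *\<^sub>v unit_vec m l0"
  have u_car: "u \<in> carrier_vec m" by (simp add: u_def carrier_vecI dims)
  have au: "\<rho> a *\<^sub>v u = u"
  proof -
    have "\<rho> a *\<^sub>v u = \<rho> (a * a) *\<^sub>v unit_vec m l0" unfolding u_def by (simp add: act)
    then show ?thesis using a(1) by (simp add: A_orthogonal u_def)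
  qed
  have "u $ j0 \<noteq> 0" using jl by (simp add: u_def col_a dims)
  then have u0: "u \<noteq> 0\<^sub>v m" using jl by auto
  \<comment> \<open>This subspace is invariant and contains \<open>u\<close>, so it is everything.\<close>
  define W where "W = {\<rho> x *\<^sub>v u | x. True}"
  have "invariant_subspace m \<rho> W" unfolding invariant_subspace_def
  proof (intro conjI ballI allI)
    show "W \<subseteq> carrier_vec m" using u_car by (auto simp: W_def intro!: carrier_vecI simp: dims)
    have "\<rho> 0 *\<^sub>v u = 0\<^sub>v m" using u_car by (intro eq_vecI) (auto simp: R0)
    then show "0\<^sub>v m \<in> W" unfolding W_def by (intro CollectI exI[of _ 0]) simp
    show "v + w \<in> W" if vw: "v \<in> W" "w \<in> W" for v w
    proof -
      from vw obtain x y where "v = \<rho> x *\<^sub>v u" "w = \<rho> y *\<^sub>v u" by (auto simp: W_def)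
      then have "v + w = \<rho> (x + y) *\<^sub>v u"
        using add_mult_distrib_mat_vec[OF R(1)[of x] R(1)[of y] u_car] by (simp add: R(2))
      then show ?thesis unfolding W_def by blast
    qed
    show "c \<cdot>\<^sub>v w \<in> W" if w: "w \<in> W" for c w
    proof -
      from w obtain x where "w = \<rho> x *\<^sub>v u" by (auto simp: W_def)
      then have "c \<cdot>\<^sub>v w = \<rho> (scale c x) *\<^sub>v u"
        by (simp add: R(3) smult_vec u_car)
      then show ?thesis unfolding W_def by blast
    qed
    show "\<rho> x *\<^sub>v w \<in> W" if w: "w \<in> W" for x w
    proof -
      from w obtain y where "w = \<rho> y *\<^sub>v u" by (auto simp: W_def)
      then have "\<rho> x *\<^sub>v w = \<rho> (x * y) *\<^sub>v u" by (simp add: act u_car)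
      then show ?thesis unfolding W_def by blast
    qed
  qed
  then have "W = {0\<^sub>v m} \<or> W = carrier_vec m" using irr by (auto simp: irreducible_rep_def)
  moreover have "u \<in> W" unfolding W_def using u_car R(4) by (intro CollectI exI[of _ 1]) simp
  ultimately have W: "W = carrier_vec m" using u0 by auto
  have cyclic: "\<exists>x. v = \<rho> x *\<^sub>v u" if "v \<in> carrier_vec m" for v
    using that W unfolding W_def by blast
  have "\<exists>c. \<rho> a *\<^sub>v unit_vec m l = c \<cdot>\<^sub>v u" for l
  proof -
    obtain x where x: "unit_vec m l = \<rho> x *\<^sub>v u" using cyclic[of "unit_vec m l"] by auto
    have "\<rho> a *\<^sub>v unit_vec m l = \<rho> (a * x * a) *\<^sub>v u"
      using u_car by (simp add: x act au mult.assoc)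
    also have "\<dots> = coef a a x \<cdot>\<^sub>v u"
      using a(1) by (simp only: corner_coef[OF a(1) a(1), of x] E_diag R(3) smult_vec u_car au)
    finally show ?thesis by blast
  qed
  then have "\<forall>l. \<exists>c. \<rho> a *\<^sub>v unit_vec m l = c \<cdot>\<^sub>v u" by blast
  from choice[OF this] obtain c where c: "\<And>l. \<rho> a *\<^sub>v unit_vec m l = c l \<cdot>\<^sub>v u" by blast
  have entry: "\<rho> a $$ (j, l) = c l * u $ j" if "j < m" "l < m" for j l
  proof -
    have "\<rho> a $$ (j, l) = (\<rho> a *\<^sub>v unit_vec m l) $ j" using that by (simp add: col_a dims)
    then show ?thesis using that u_car by (simp add: c)
  qed
  have "u $ j0 = (\<rho> a *\<^sub>v u) $ j0" by (simp add: au)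
  also have "\<dots> = (\<Sum>l<m. c l * u $ j0 * u $ l)"
    using jl u_car by (simp add: dims scalar_prod_def entry atLeast0LessThan)
  also have "\<dots> = (\<Sum>l<m. c l * u $ l) * u $ j0"
    unfolding sum_distrib_right by (intro sum.cong refl) (simp add: mult_ac)
  finally have "(\<Sum>l<m. c l * u $ l) = 1" using \<open>u $ j0 \<noteq> 0\<close> by simp
  then have \<chi>a: "?\<chi> a = 1" by (simp add: \<chi>_alt entry)
  let ?i = "rep a"
  have kill: "?\<chi> (E b c) = 0" if bc: "b \<in> A" "c \<in> A" "b \<noteq> c \<or> rep b \<noteq> ?i" for b c
  proof (cases "b = c")
    case False
    have "?\<chi> (E b c) = ?\<chi> (b * E b c)" using bc by (simp add: A_mult_E)
    also have "\<dots> = ?\<chi> (E b c * b)" by (rule \<chi>_comm)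
    also have "\<dots> = 0" using bc False by (simp add: A_mult_E lin_zero[OF \<chi>_lin])
    finally show ?thesis .
  next
    case True
    then have nb: "rep b \<noteq> ?i" using bc by simp
    have "\<rho> b = 0\<^sub>m m m"
    proof (rule eq_matI)
      fix j l assume "j < dim_row (0\<^sub>m m m :: 'k mat)" "l < dim_col (0\<^sub>m m m :: 'k mat)"
      then have jl: "j < m" "l < m" by simp_all
      obtain x where x: "unit_vec m l = \<rho> x *\<^sub>v u" using cyclic[of "unit_vec m l"] by auto
      have "\<rho> b *\<^sub>v unit_vec m l = \<rho> (b * x * a) *\<^sub>v u"
        using u_car by (simp add: x act au mult.assoc)
      also have "b * x * a = 0"
        using corner_coef[OF bc(1) a(1), of x] nb by (simp add: coef_off)
      finally have "(\<rho> b *\<^sub>v unit_vec m l) $ j = (0\<^sub>m m m *\<^sub>v u) $ j" by (simp add: R0)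
      then show "\<rho> b $$ (j, l) = 0\<^sub>m m m $$ (j, l)"
        using jl u_car by (simp add: col_a dims)
    qed (simp_all add: dims)
    then have "?\<chi> b = 0" by (simp add: \<chi>_alt)
    then show ?thesis using True bc by (simp add: E_diag)
  qed
  have diag: "?\<chi> (E b b) = 1" if b: "b \<in> A" "rep b = ?i" for b
  proof -
    have "?\<chi> (E b b) = ?\<chi> (E b a * E a b)"
      using E_mult[OF b(1) a(1) a(1) b(1) b(2) b(2)[symmetric]] by simp
    also have "\<dots> = ?\<chi> (E a b * E b a)" by (rule \<chi>_comm)
    also have "\<dots> = ?\<chi> (E a a)"
      using E_mult[OF a(1) b(1) b(1) a(1) b(2)[symmetric] b(2)] by simp
    finally show ?thesis using \<chi>a a by (simp add: E_diag)
  qed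
  have "?\<chi> h = block_trace ?i h" for h
  proof -
    have "?\<chi> h = ?\<chi> (\<Sum>b\<in>A. \<Sum>c\<in>A. scale (coef b c h) (E b c))" using expansion[of h] by (rule arg_cong)
    also have "\<dots> = (\<Sum>b\<in>A. \<Sum>c\<in>A. coef b c h * ?\<chi> (E b c))"
      by (simp add: lin_sum[OF \<chi>_lin] lin_scale[OF \<chi>_lin])
    also have "\<dots> = (\<Sum>b\<in>A. \<Sum>c\<in>A. if c = b then if rep b = ?i then coef b b h else 0 else 0)"
    proof (intro sum.cong refl)
      fix b c assume bc: "b \<in> A" "c \<in> A"
      show "coef b c h * ?\<chi> (E b c) = (if c = b then if rep b = ?i then coef b b h else 0 else 0)"
        using kill[OF bc] diag[OF bc(1)] by (cases "c = b"; cases "rep b = ?i") simp_all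
    qed
    also have "\<dots> = (\<Sum>b\<in>A. if rep b = ?i then coef b b h else 0)"
      using finite_A by (intro sum.cong refl) simp
    also have "\<dots> = block_trace ?i h"
      unfolding block_trace_def block_def using finite_A by (rule sum.inter_filter[symmetric])
    finally show ?thesis .
  qed
  then have eq: "?\<chi> = block_trace ?i" by blast
  have "of_nat m = ?\<chi> 1" by (simp add: \<chi>_alt R(4))
  also have "\<dots> = of_nat (deg ?i)" by (simp add: eq block_trace_one)
  finally have "m = deg ?i" by simp
  with eq a(1) show ?thesis by blast
qed

lemma irr_chars_eq: "irr_chars scale = block_trace ` rep ` A"
proof
  show "irr_chars scale \<subseteq> block_trace ` rep ` A"
    using irreducible_rep_character unfolding irr_chars_def by blast
  show "block_trace ` rep ` A \<subseteq> irr_chars scale"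
  proof
    fix \<chi> assume "\<chi> \<in> block_trace ` rep ` A"
    then obtain i where i: "i \<in> rep ` A" "\<chi> = block_trace i" by blast
    obtain \<rho> where "irreducible_rep scale (deg i) \<rho>" "character_of \<rho> = block_trace i"
      using block_rep[OF i(1)] by blast
    then show "\<chi> \<in> irr_chars scale" unfolding irr_chars_def i(2)
      by (intro CollectI exI[of _ "deg i"] exI[of _ \<rho>]) simp
  qed
qed

lemma inj_block_trace: "inj_on block_trace (rep ` A)"
proof
  fix i j assume ij: "i \<in> rep ` A" "j \<in> rep ` A" "block_trace i = block_trace j"
  show "i = j"
  proof (rule ccontr)
    assume "i \<noteq> j"
    let ?e = "central (\<lambda>l. if l = i then 1 else 0)"
    have "of_nat (deg i) = block_trace i ?e" by (simp add: block_trace_central)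
    also have "\<dots> = block_trace j ?e" using ij(3) by simp
    also have "\<dots> = 0" using \<open>i \<noteq> j\<close> by (simp add: block_trace_central)
    finally show False using deg_pos[OF ij(1)] by simp
  qed
qed

lemma char_degree_eq:
  assumes i: "i \<in> rep ` A" shows "char_degree scale (block_trace i) = deg i"
  unfolding char_degree_def
proof (rule the_equality)
  show "\<exists>\<rho>. irreducible_rep scale (deg i) \<rho> \<and> block_trace i = character_of \<rho>"
    using block_rep[OF i] by metis
next
  fix m assume "\<exists>\<rho>. irreducible_rep scale m \<rho> \<and> block_trace i = character_of \<rho>"
  then obtain \<rho> where "irreducible_rep scale m \<rho>" and eq: "block_trace i = character_of \<rho>" by blast
  from irreducible_rep_character[OF this(1)]
  obtain j where j: "j \<in> rep ` A" "character_of \<rho> = block_trace j" "m = deg j" by blast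
  then have "i = j" using inj_onD[OF inj_block_trace _ i j(1)] eq by simp
  then show "m = deg i" using j by simp
qed

lemma sum_irr_chars:
  "(\<Sum>\<chi>\<in>irr_chars scale. F (char_degree scale \<chi>) * \<chi> h) = (\<Sum>i\<in>rep ` A. F (deg i) * block_trace i h)"
  unfolding irr_chars_eq
  by (subst sum.reindex[OF inj_block_trace]) (simp add: char_degree_eq o_def)

lemma sum_irr_chars_trace:
  "(\<Sum>\<chi>\<in>irr_chars scale. F (char_degree scale \<chi>) * \<chi> h)
    = full_trace (central (\<lambda>i. F (deg i)) * h)"
  unfolding sum_irr_chars full_trace_blocks by (simp add: block_trace_central_mult)

end

section \<open>The integral and the fourth power of the antipode\<close>

locale semisimple_hopf = hopf_algebra scale \<Delta> \<epsilon> S + matrix_units_char0 scale d A rep E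
  for scale :: "'k::{alg_closed_field, field_char_0} \<Rightarrow> 'h::ring_1 \<Rightarrow> 'h"
    and \<Delta> \<epsilon> S d A rep E +
  fixes \<Lambda> :: 'h
  assumes integral: "idempotent_integral scale \<epsilon> \<Lambda>"
begin

lemma integral_left: "h * \<Lambda> = scale (\<epsilon> h) \<Lambda>"
  and integral_right: "\<Lambda> * h = scale (\<epsilon> h) \<Lambda>"
  and counit_integral: "\<epsilon> \<Lambda> = 1"
  using integral by (simp_all add: idempotent_integral_def)

lemmas sw_intros = lin_intros lin_S lin_eps lin_sw lin_sw_fun bilinI lin_full_trace lin_scale_coeff

text \<open>\<open>\<Lambda>\<^sub>1 h \<otimes> \<Lambda>\<^sub>2 = \<Lambda>\<^sub>1 h\<^sub>1 \<otimes> \<Lambda>\<^sub>2 h\<^sub>2 S h\<^sub>3 = \<Lambda>\<^sub>1 \<otimes> \<Lambda>\<^sub>2 S h\<close>.\<close>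

lemma integral_move_right:
  assumes B: "bilin sW B"
  shows "sw \<Lambda> (\<lambda>a b. B (a * h) b) = sw \<Lambda> (\<lambda>a b. B a (b * S h))"
proof -
  interpret W: Vector_Spaces.vector_space sW by (rule bilin_vector_space[OF B])
  note L = sw_intros bilin1[OF B] bilin2[OF B]
  have "sw \<Lambda> (\<lambda>a b. B (a * h) b) = sw h (\<lambda>p q. sW (\<epsilon> q) (sw \<Lambda> (\<lambda>a b. B (a * p) b)))"
    by (intro sw_counit_right[where f = "\<lambda>p. sw \<Lambda> (\<lambda>a b. B (a * p) b)", symmetric] L)
  also have "\<dots> = sw h (\<lambda>p q. sw q (\<lambda>r s. sw \<Lambda> (\<lambda>a b. B (a * p) (b * (r * S s)))))"
    by (intro sw_cong, subst sw_antipode_right[where f = "\<lambda>z. sw \<Lambda> (\<lambda>a b. B (a * p) (b * z))" for p])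
      (auto intro!: L)
  also have "\<dots> = sw h (\<lambda>p q. sw p (\<lambda>r s. sw \<Lambda> (\<lambda>a b. B (a * r) (b * (s * S q)))))"
    by (intro sw_coassoc[where sW = sW] L)
  also have "\<dots> = sw h (\<lambda>p q. sw (\<Lambda> * p) (\<lambda>a b. B a (b * S q)))"
    by (intro sw_cong, subst sw_mult[where sW = sW])
      (auto intro!: L sw_cong simp: mult.assoc sw_swap[of _ \<Lambda>])
  also have "\<dots> = sw h (\<lambda>p q. sW (\<epsilon> p) (sw \<Lambda> (\<lambda>a b. B a (b * S q))))"
    unfolding integral_right by (intro sw_cong sw_scale[where sW = sW] L)
  also have "\<dots> = sw \<Lambda> (\<lambda>a b. B a (b * S h))"
    by (intro sw_counit_left[where f = "\<lambda>q. sw \<Lambda> (\<lambda>a b. B a (b * S q))"] L)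
  finally show ?thesis .
qed

text \<open>\<open>\<Lambda>\<^sub>1 \<otimes> h \<Lambda>\<^sub>2 = S h\<^sub>1 h\<^sub>2 \<Lambda>\<^sub>1 \<otimes> h\<^sub>3 \<Lambda>\<^sub>2 = S h \<Lambda>\<^sub>1 \<otimes> \<Lambda>\<^sub>2\<close>.\<close>

lemma integral_move_left:
  assumes B: "bilin sW B"
  shows "sw \<Lambda> (\<lambda>a b. B a (h * b)) = sw \<Lambda> (\<lambda>a b. B (S h * a) b)"
proof -
  interpret W: Vector_Spaces.vector_space sW by (rule bilin_vector_space[OF B])
  note L = sw_intros bilin1[OF B] bilin2[OF B]
  have "sw \<Lambda> (\<lambda>a b. B a (h * b)) = sw h (\<lambda>p q. sW (\<epsilon> p) (sw \<Lambda> (\<lambda>a b. B a (q * b))))"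
    by (intro sw_counit_left[where f = "\<lambda>p. sw \<Lambda> (\<lambda>a b. B a (p * b))", symmetric] L)
  also have "\<dots> = sw h (\<lambda>p q. sw p (\<lambda>r s. sw \<Lambda> (\<lambda>a b. B (S r * s * a) (q * b))))"
    by (intro sw_cong, subst sw_antipode_left[where f = "\<lambda>z. sw \<Lambda> (\<lambda>a b. B (z * a) (q * b))" for q])
      (auto intro!: L)
  also have "\<dots> = sw h (\<lambda>r p. sw p (\<lambda>s q. sw \<Lambda> (\<lambda>a b. B (S r * s * a) (q * b))))"
    by (intro sw_coassoc[where sW = sW, symmetric] L)
  also have "\<dots> = sw h (\<lambda>r p. sw (p * \<Lambda>) (\<lambda>a b. B (S r * a) b))"
    by (intro sw_cong, subst sw_mult[where sW = sW])
      (auto intro!: L sw_cong simp: mult.assoc)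
  also have "\<dots> = sw h (\<lambda>r p. sW (\<epsilon> p) (sw \<Lambda> (\<lambda>a b. B (S r * a) b)))"
    unfolding integral_left by (intro sw_cong sw_scale[where sW = sW] L)
  also have "\<dots> = sw \<Lambda> (\<lambda>a b. B (S h * a) b)"
    by (intro sw_counit_right[where f = "\<lambda>r. sw \<Lambda> (\<lambda>a b. B (S r * a) b)"] L)
  finally show ?thesis .
qed

lemma averaging_one: "sw \<Lambda> (\<lambda>a b. a * S b) = 1"
  using sw_antipode_right[OF lin_self, of \<Lambda>] by (simp add: counit_integral)

lemma antipode_zero: "S 0 = 0" using lin_zero[OF antipode_linear] .

lemma averaging_kernel: assumes "S h = 0" shows "sw \<Lambda> (\<lambda>a b. a * h * S b) = 0"
proof -
  have "sw \<Lambda> (\<lambda>a b. a * h * S b) = sw \<Lambda> (\<lambda>a b. a * S (b * S h))"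
    by (intro integral_move_right[where sW = scale and B = "\<lambda>a b. a * S b"] sw_intros)
  also have "\<dots> = sw \<Lambda> (\<lambda>a b. 0)" by (simp add: assms antipode_mult antipode_zero)
  also have "\<dots> = 0" by (simp add: sw_def case_prod_unfold)
  finally show ?thesis .
qed

text \<open>The kernel of \<open>S\<close> is a two-sided ideal, so if it is not zero it contains the unit element
  \<open>e\<close> of a block. The map \<open>x \<mapsto> \<Sum> \<Lambda>\<^sub>1 x S \<Lambda>\<^sub>2\<close> kills the kernel of \<open>S\<close> and fixes central elements,
  which forces \<open>e = 0\<close>.\<close>

lemma antipode_eq_0: assumes "S h = 0" shows "h = 0"
proof (rule ccontr)
  assume "h \<noteq> 0"
  have ideal: "S (x * y * z) = 0" if "S y = 0" for x y z using that by (simp add: antipode_mult)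
  obtain a b where ab: "a \<in> A" "b \<in> A" "coef a b h \<noteq> 0"
  proof (rule ccontr)
    assume "\<not> thesis"
    then have "coef a b h = coef a b 0" if "a \<in> A" "b \<in> A" for a b
      using that \<open>\<And>a b. a \<in> A \<Longrightarrow> b \<in> A \<Longrightarrow> coef a b h \<noteq> 0 \<Longrightarrow> thesis\<close>
      by (auto simp: lin_zero[OF lin_coef_self])
    then show False using \<open>h \<noteq> 0\<close> coef_eq_imp_eq by blast
  qed
  have rep: "rep a = rep b" using ab(3) coef_off by blast
  have "scale (coef a b h) (S (E a b)) = 0"
    using ideal[OF assms, of a b] corner_coef[OF ab(1,2), of h] lin_scale[OF antipode_linear] by metis
  then have SE: "S (E a b) = 0" using ab(3) by simp
  have block: "S c = 0" if c: "c \<in> block (rep a)" for c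
  proof -
    have cA: "c \<in> A" "rep c = rep a" using c by (auto simp: block_def)
    have "E c a * E a b * E b c = c"
      by (simp only: E_mult[OF cA(1) ab(1,1,2) cA(2) rep] E_mult[OF cA(1) ab(2,2) cA(1) trans[OF cA(2) rep] trans[OF rep[symmetric] cA(2)[symmetric]]] E_diag[OF cA(1)] if_True simp_thms)
    then show ?thesis using ideal[OF SE, of "E c a" "E b c"] by simp
  qed
  let ?e = "\<Sum>(block (rep a))"
  have "S ?e = 0" using block by (simp add: lin_sum[OF antipode_linear])
  have e: "?e = central (\<lambda>i. if i = rep a then 1 else 0)"
  proof -
    have "central (\<lambda>i. if i = rep a then 1 else 0) = (\<Sum>c\<in>A. if rep c = rep a then c else 0)"
      unfolding central_def by (intro sum.cong refl) simp
    also have "\<dots> = ?e" unfolding block_def using finite_A by (rule sum.inter_filter[symmetric])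
    finally show ?thesis by simp
  qed
  have "?e = ?e * sw \<Lambda> (\<lambda>a b. a * S b)" by (simp add: averaging_one)
  also have "\<dots> = sw \<Lambda> (\<lambda>a b. ?e * (a * S b))" by (intro sw_apply[where sV = scale and sW = scale] sw_intros)
  also have "\<dots> = sw \<Lambda> (\<lambda>a b. a * ?e * S b)"
  proof (intro sw_cong)
    fix c b :: 'h
    have "?e * c = c * ?e" unfolding e by (rule central_commute)
    then show "?e * (c * S b) = c * ?e * S b" by (simp only: mult.assoc[symmetric])
  qed
  also have "\<dots> = 0" by (rule averaging_kernel) fact
  finally have "coef a a ?e = 0" by (simp add: lin_zero[OF lin_coef_self] ab)
  then show False by (simp add: e coef_central ab)
qed

lemma inj_antipode: "inj S"
proof
  fix x y assume "S x = S y"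
  then have "S (x - y) = 0" by (simp add: lin_diff[OF antipode_linear])
  then show "x = y" using antipode_eq_0 by fastforce
qed

lemma surj_antipode: "surj S"
proof -
  obtain B where B: "finite B" "independent B" "span B = UNIV"
    using dim by (auto simp: has_dimension_def is_basis_def)
  interpret F: finite_dimensional_vector_space scale B
    by unfold_locales (use B in auto)
  show ?thesis using F.linear_inj_imp_surj[OF antipode_linear inj_antipode] .
qed

lemma integral_balanced:
  assumes B: "bilin sW B"
  shows "sw \<Lambda> (\<lambda>a b. B (h * a) (S b)) = sw \<Lambda> (\<lambda>a b. B a (S b * h))"
proof -
  obtain h' where h: "h = S h'" using surj_antipode by blast
  have "bilin sW (\<lambda>a b. B a (S b))" by (intro bilinI bilin1[OF B] bilin2[OF B] sw_intros)
  from integral_move_left[OF this, of h'] show ?thesis by (simp add: h antipode_mult)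
qed

lemma sw_sum: "sw x (\<lambda>p q. \<Sum>a\<in>I. F a p q) = (\<Sum>a\<in>I. sw x (F a))"
proof -
  have "(\<Sum>(p, q)\<leftarrow>xs. \<Sum>a\<in>I. F a p q) = (\<Sum>a\<in>I. \<Sum>(p, q)\<leftarrow>xs. F a p q)" for xs
    by (induction xs) (auto simp: sum.distrib)
  then show ?thesis by (simp add: sw_def)
qed

text \<open>The element \<open>w\<close> with \<open>\<Lambda>\<^sub>1 \<otimes> S \<Lambda>\<^sub>2 = \<Sum> E a b w \<otimes> E b a\<close>. Conjugation by \<open>w\<close> is the square of
  the antipode, so this square is the identity iff \<open>w\<close> is central.\<close>

definition twist :: 'h where "twist = sw \<Lambda> (\<lambda>a b. scale (full_trace (S b)) a)"

text \<open>A tensor with \<open>h u \<otimes> v = u \<otimes> v h\<close> for all \<open>h\<close> is determined by the value of the matrix trace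
  on its second leg: expand that leg in matrix units and move them to the first leg.\<close>

lemma integral_tensor:
  assumes B: "bilin sW B"
  shows "sw \<Lambda> (\<lambda>a b. B a (S b)) = (\<Sum>a\<in>A. \<Sum>b\<in>A. B (E a b * twist) (E b a))"
proof -
  interpret W: Vector_Spaces.vector_space sW by (rule bilin_vector_space[OF B])
  note L = sw_intros bilin1[OF B] bilin2[OF B]
  have B_expand: "B p q = (\<Sum>a\<in>A. \<Sum>b\<in>A. sW (full_trace (q * E a b)) (B p (E b a)))" for p q
  proof -
    have l: "lin sW (\<lambda>x. B p x)" by (intro bilin2[OF B] lin_self)
    have "B p q = B p (\<Sum>b\<in>A. \<Sum>a\<in>A. scale (full_trace (q * E a b)) (E b a))"
      using trace_expansion[of q] by (rule arg_cong)
    also have "\<dots> = (\<Sum>b\<in>A. \<Sum>a\<in>A. sW (full_trace (q * E a b)) (B p (E b a)))"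
      by (simp only: lin_sum[OF l] lin_scale[OF l])
    finally show ?thesis by (subst sum.swap)
  qed
  have "sw \<Lambda> (\<lambda>p q. B p (S q)) = (\<Sum>a\<in>A. \<Sum>b\<in>A. sw \<Lambda> (\<lambda>p q. sW (full_trace (S q * E a b)) (B p (E b a))))"
    by (subst B_expand) (simp add: sw_sum)
  also have "\<dots> = (\<Sum>a\<in>A. \<Sum>b\<in>A. B (E a b * twist) (E b a))"
  proof (intro sum.cong refl)
    fix a b
    have bl: "bilin sW (\<lambda>p q. sW (full_trace q) (B p (E b a)))"
    proof (intro bilinI linI W.vector_space_axioms)
      fix q c x y
      have l: "lin sW (\<lambda>p. B p (E b a))" by (intro bilin1[OF B] lin_self)
      show "sW (full_trace q) (B (x + y) (E b a)) = sW (full_trace q) (B x (E b a)) + sW (full_trace q) (B y (E b a))"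
        using lin_add[OF l] by (simp add: W.scale_right_distrib)
      show "sW (full_trace q) (B (scale c x) (E b a)) = sW c (sW (full_trace q) (B x (E b a)))"
        using lin_scale[OF l] by (simp add: mult.commute)
      show "sW (full_trace (x + y)) (B q (E b a)) = sW (full_trace x) (B q (E b a)) + sW (full_trace y) (B q (E b a))"
        by (simp add: lin_add[OF lin_full_trace_self] W.scale_left_distrib)
      show "sW (full_trace (scale c x)) (B q (E b a)) = sW c (sW (full_trace x) (B q (E b a)))"
        by (simp add: lin_scale[OF lin_full_trace_self])
    qed
    have "sw \<Lambda> (\<lambda>p q. sW (full_trace (S q * E a b)) (B p (E b a)))
        = sw \<Lambda> (\<lambda>p q. sW (full_trace (S q)) (B (E a b * p) (E b a)))"
      by (rule integral_balanced[OF bl, symmetric])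
    also have "\<dots> = sw \<Lambda> (\<lambda>p q. B (E a b * scale (full_trace (S q)) p) (E b a))"
      by (simp add: scale_mult_right bilin_scale1[OF B])
    also have "\<dots> = B (E a b * twist) (E b a)"
      unfolding twist_def
      by (intro sw_apply[where sV = scale and sW = sW and f = "\<lambda>z. B (E a b * z) (E b a)", symmetric] L)
    finally show "sw \<Lambda> (\<lambda>p q. sW (full_trace (S q * E a b)) (B p (E b a))) = B (E a b * twist) (E b a)" .
  qed
  finally show ?thesis .
qed

lemma E_sandwich:
  assumes "a \<in> A" "b \<in> A"
  shows "E a b * x * E b a = scale (if rep a = rep b then coef b b x else 0) a"
proof (cases "rep a = rep b")
  case True
  have "E a b * x * E b a = E a b * (b * x * b) * E b a"
    using A_mult_E(1)[OF assms(2,2,1)] A_mult_E(2)[OF assms(2,1,2)] by (metis mult.assoc)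
  also have "\<dots> = scale (coef b b x) (E a b * E b b * E b a)"
    unfolding corner_coef[OF assms(2,2)] by (simp add: scale_mult_left scale_mult_right)
  also have "E a b * E b b * E b a = a"
    by (simp only: E_mult[OF assms(1,2,2,2) True refl] E_mult[OF assms(1,2,2,1) True True[symmetric]] if_True simp_thms)
      (rule E_diag[OF assms(1)])
  finally show ?thesis using True by simp
next
  case False
  then show ?thesis by (simp add: E_off[OF assms False])
qed

text \<open>The identity \<open>\<Lambda>\<^sub>1 S \<Lambda>\<^sub>2 = 1\<close> read off in one block.\<close>

lemma block_trace_twist: assumes "i \<in> rep ` A" shows "block_trace i twist = 1"
proof -
  obtain a where a: "a \<in> A" "rep a = i" using assms by blast
  have "1 = sw \<Lambda> (\<lambda>a b. a * S b)" by (simp add: averaging_one)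
  also have "\<dots> = (\<Sum>c\<in>A. \<Sum>b\<in>A. E c b * twist * E b c)"
    by (intro integral_tensor[where sW = scale] sw_intros)
  also have "\<dots> = (\<Sum>c\<in>A. \<Sum>b\<in>A. scale (if rep c = rep b then coef b b twist else 0) c)"
    by (intro sum.cong refl E_sandwich)
  also have "\<dots> = (\<Sum>c\<in>A. scale (block_trace (rep c) twist) c)"
  proof (intro sum.cong refl)
    fix c
    have "(\<Sum>b\<in>A. scale (if rep c = rep b then coef b b twist else 0) c)
        = scale (\<Sum>b\<in>A. if rep b = rep c then coef b b twist else 0) c"
      unfolding scale_sum_left by (intro sum.cong refl) (simp add: eq_commute)
    also have "(\<Sum>b\<in>A. if rep b = rep c then coef b b twist else 0) = block_trace (rep c) twist"
      unfolding block_trace_def block_def using finite_A by (rule sum.inter_filter[symmetric])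
    finally show "(\<Sum>b\<in>A. scale (if rep c = rep b then coef b b twist else 0) c) = scale (block_trace (rep c) twist) c" .
  qed
  also have "\<dots> = central (\<lambda>i. block_trace i twist)" by (simp add: central_def)
  finally have "coef a a 1 = coef a a (central (\<lambda>i. block_trace i twist))" by simp
  then show ?thesis using a by (simp add: coef_one coef_central)
qed

text \<open>The two ways of moving \<open>h\<close> through \<open>\<Lambda>\<^sub>1 \<otimes> S \<Lambda>\<^sub>2\<close> differ by the square of the antipode.\<close>

lemma antipode_square_twist: "S (S h) * twist = twist * h"
proof -
  have b: "bilin scale (\<lambda>p q. scale (full_trace (S q)) p)" by (intro sw_intros)
  have b': "bilin scale (\<lambda>p q. scale (full_trace q) p)" by (intro sw_intros)
  have "twist * h = sw \<Lambda> (\<lambda>a b. scale (full_trace (S b)) a * h)"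
    unfolding twist_def by (intro sw_apply[where sV = scale and sW = scale] sw_intros)
  also have "\<dots> = sw \<Lambda> (\<lambda>a b. scale (full_trace (S b)) (a * h))" by (simp add: scale_mult_left)
  also have "\<dots> = sw \<Lambda> (\<lambda>a b. scale (full_trace (S (b * S h))) a)"
    by (rule integral_move_right[OF b])
  also have "\<dots> = sw \<Lambda> (\<lambda>a b. scale (full_trace (S b * S (S h))) a)"
    by (simp add: antipode_mult full_trace_comm)
  also have "\<dots> = sw \<Lambda> (\<lambda>a b. scale (full_trace (S b)) (S (S h) * a))"
    by (rule integral_balanced[OF b', symmetric])
  also have "\<dots> = sw \<Lambda> (\<lambda>a b. S (S h) * scale (full_trace (S b)) a)" by (simp add: scale_mult_right)
  also have "\<dots> = S (S h) * twist"
    unfolding twist_def by (intro sw_apply[where sV = scale and sW = scale, symmetric] sw_intros)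
  finally show ?thesis by simp
qed

text \<open>In \<open>\<Sum> E a b w E b a = 1\<close> the factor \<open>w\<close> can be pushed to either end.\<close>

lemma twist_invertible: "\<exists>v. v * twist = 1 \<and> twist * v = 1"
proof -
  have one: "(\<Sum>a\<in>A. \<Sum>b\<in>A. E a b * twist * E b a) = 1"
  proof -
    have "sw \<Lambda> (\<lambda>a b. a * S b) = (\<Sum>a\<in>A. \<Sum>b\<in>A. E a b * twist * E b a)"
      by (intro integral_tensor[where sW = scale] sw_intros)
    then show ?thesis by (simp add: averaging_one)
  qed
  define R where "R = (\<lambda>y. inv_into UNIV S (inv_into UNIV S y))"
  have R: "S (S (R y)) = y" for y by (simp add: R_def f_inv_into_f surj_antipode)
  let ?v = "\<Sum>a\<in>A. \<Sum>b\<in>A. E a b * S (S (E b a))" and ?u = "\<Sum>a\<in>A. \<Sum>b\<in>A. R (E a b) * E b a"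
  \<comment> \<open>The sums \<open>?v\<close> and \<open>?u\<close> are the left and the right inverse; \<open>R\<close> inverts the square of \<open>S\<close>.\<close>
  have "?v * twist = (\<Sum>a\<in>A. \<Sum>b\<in>A. E a b * twist * E b a)"
    by (simp only: sum_distrib_right mult.assoc antipode_square_twist)
  then have v: "?v * twist = 1" by (simp only: one)
  have "twist * ?u = (\<Sum>a\<in>A. \<Sum>b\<in>A. E a b * twist * E b a)"
    by (simp only: sum_distrib_left mult.assoc[symmetric] antipode_square_twist[symmetric] R)
  then have u: "twist * ?u = 1" by (simp only: one)
  have "?v = ?v * (twist * ?u)" by (simp only: u mult.right_neutral)
  also have "\<dots> = ?u" by (simp only: mult.assoc[symmetric] v mult.left_neutral)
  finally have "twist * ?v = 1" using u by (simp only:)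
  with v show ?thesis by blast
qed

definition twist_inv :: 'h where "twist_inv = (SOME v. v * twist = 1 \<and> twist * v = 1)"

lemma twist_inv: "twist_inv * twist = 1" "twist * twist_inv = 1"
  using someI_ex[OF twist_invertible] by (simp_all add: twist_inv_def)

lemma twist_inv_assoc: "twist_inv * (twist * x) = x" "twist * (twist_inv * x) = x"
  by (simp_all add: mult.assoc[symmetric] twist_inv)

lemma antipode_square: "S (S h) = twist * h * twist_inv"
proof -
  have "S (S h) = S (S h) * twist * twist_inv" by (simp add: mult.assoc twist_inv)
  then show ?thesis by (simp add: antipode_square_twist)
qed

text \<open>The integral \<open>\<lambda>\<close> of the dual algebra. It becomes the regular character only after \<open>w\<close> has been
  shown to be central, see \<open>cointegral_eq_regular_char\<close>.\<close>

definition cointegral :: "'h \<Rightarrow> 'k" where "cointegral x = full_trace (twist_inv * x)"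

lemma lin_cointegral_self: "lin (*) cointegral"
  unfolding cointegral_def[abs_def] by (intro sw_intros)

lemma lin_cointegral: "lin scale f \<Longrightarrow> lin (*) (\<lambda>x. cointegral (f x))"
  by (rule lin_compose[OF lin_cointegral_self])

lemmas cointegral_intros = sw_intros lin_cointegral

lemma cointegral_nondegenerate: assumes "\<And>y. cointegral (p * y) = cointegral (q * y)" shows "p = q"
proof -
  have "twist_inv * p = twist_inv * q"
    by (rule trace_nondegenerate) (use assms in \<open>simp add: cointegral_def mult.assoc\<close>)
  then show ?thesis using twist_inv_assoc(2) by metis
qed

text \<open>The form defined by \<open>\<lambda>\<close> is symmetric up to the square of the antipode, because \<open>\<lambda>\<close> is the
  matrix trace weighted by the inverse of \<open>w\<close>.\<close>

lemma cointegral_comm: "cointegral (x * y) = cointegral (S (S y) * x)"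
proof -
  have "cointegral (x * y) = full_trace (twist_inv * x * y)" by (simp add: cointegral_def mult.assoc)
  also have "\<dots> = full_trace (y * (twist_inv * x))" by (rule full_trace_comm)
  also have "\<dots> = cointegral (S (S y) * x)" by (simp add: cointegral_def antipode_square mult.assoc twist_inv_assoc)
  finally show ?thesis .
qed

text \<open>Together with the next lemma: \<open>\<Lambda>\<^sub>1\<close> and \<open>S \<Lambda>\<^sub>2\<close> are dual bases for the form defined by \<open>\<lambda>\<close>.\<close>

lemma cointegral_dual: "sw \<Lambda> (\<lambda>a b. scale (cointegral (z * a)) (S b)) = z"
proof -
  have "sw \<Lambda> (\<lambda>a b. scale (cointegral (z * a)) (S b)) = (\<Sum>a\<in>A. \<Sum>b\<in>A. scale (cointegral (z * (E a b * twist))) (E b a))"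
    by (intro integral_tensor[where sW = scale and B = "\<lambda>a b. scale (cointegral (z * a)) b"] cointegral_intros)
  also have "\<dots> = (\<Sum>a\<in>A. \<Sum>b\<in>A. scale (full_trace (z * E a b)) (E b a))"
  proof (intro sum.cong refl)
    fix a b
    have "full_trace (twist_inv * (z * (E a b * twist))) = full_trace (twist_inv * (z * E a b) * twist)" by (simp add: mult.assoc)
    also have "\<dots> = full_trace (twist * (twist_inv * (z * E a b)))" by (rule full_trace_comm)
    finally show "scale (cointegral (z * (E a b * twist))) (E b a) = scale (full_trace (z * E a b)) (E b a)"
      by (simp add: cointegral_def twist_inv_assoc)
  qed
  also have "\<dots> = z" by (subst sum.swap) (rule trace_expansion[symmetric])
  finally show ?thesis .
qed

lemma cointegral_dual': "sw \<Lambda> (\<lambda>a b. scale (cointegral (S b * z)) a) = z"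
proof -
  have "sw \<Lambda> (\<lambda>a b. scale (cointegral (S b * z)) a) = (\<Sum>a\<in>A. \<Sum>b\<in>A. scale (cointegral (E b a * z)) (E a b * twist))"
    by (intro integral_tensor[where sW = scale and B = "\<lambda>a b. scale (cointegral (b * z)) a"] cointegral_intros)
  also have "\<dots> = (\<Sum>a\<in>A. \<Sum>b\<in>A. scale (full_trace (z * twist_inv * E b a)) (E a b)) * twist"
  proof -
    have "cointegral (E b a * z) = full_trace (z * twist_inv * E b a)" for a b
    proof -
      have "cointegral (E b a * z) = full_trace (twist_inv * E b a * z)" by (simp add: cointegral_def mult.assoc)
      also have "\<dots> = full_trace (z * (twist_inv * E b a))" by (rule full_trace_comm)
      finally show ?thesis by (simp add: mult.assoc)
    qed
    then show ?thesis by (simp add: sum_distrib_right scale_mult_left)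
  qed
  also have "\<dots> = z * twist_inv * twist" by (subst trace_expansion[symmetric]) (rule refl)
  also have "\<dots> = z" by (simp add: mult.assoc twist_inv)
  finally show ?thesis .
qed

lemma antipode_cointegral_dual: "S (sw \<Lambda> (\<lambda>a b. scale (cointegral (z * a)) b)) = z"
proof -
  have "S (sw \<Lambda> (\<lambda>a b. scale (cointegral (z * a)) b)) = sw \<Lambda> (\<lambda>a b. S (scale (cointegral (z * a)) b))"
    by (rule sw_apply[OF antipode_linear])
  then show ?thesis by (simp add: lin_scale[OF antipode_linear] cointegral_dual)
qed

lemma cointegral_integral_left_one: "sw \<Lambda> (\<lambda>a b. scale (cointegral a) b) = 1"
  using antipode_cointegral_dual[of 1] antipode_one inj_antipode by (simp add: inj_def)

text \<open>Writing \<open>x = \<Sum> \<lambda>(S \<Lambda>\<^sub>2 x) \<Lambda>\<^sub>1\<close> reduces this to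
  \<open>\<Sum> \<lambda>(\<Lambda>\<^sub>1) \<Lambda>\<^sub>2 \<otimes> \<Lambda>\<^sub>3 = \<Delta> 1\<close>.\<close>

lemma cointegral_integral_right: "sw x (\<lambda>a b. scale (cointegral a) b) = scale (cointegral x) 1"
proof -
  let ?F = "\<lambda>x. sw x (\<lambda>a b. scale (cointegral a) b)"
  have F: "lin scale ?F" by (intro cointegral_intros)
  have "?F x = ?F (sw \<Lambda> (\<lambda>a b. scale (cointegral (S b * x)) a))" by (simp only: cointegral_dual')
  also have "\<dots> = sw \<Lambda> (\<lambda>a b. scale (cointegral (S b * x)) (?F a))"
    using sw_apply[OF F, of \<Lambda> "\<lambda>a b. scale (cointegral (S b * x)) a"] by (simp only: lin_scale[OF F])
  also have "\<dots> = sw \<Lambda> (\<lambda>a b. sw a (\<lambda>c e. scale (cointegral (S b * x)) (scale (cointegral c) e)))"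
    by (intro sw_cong sw_apply[where sV = scale and sW = scale] cointegral_intros)
  also have "\<dots> = sw \<Lambda> (\<lambda>c a. sw a (\<lambda>e b. scale (cointegral (S b * x)) (scale (cointegral c) e)))"
    by (intro sw_coassoc[where sW = scale, symmetric] cointegral_intros)
  also have "\<dots> = sw \<Lambda> (\<lambda>c a. sw (scale (cointegral c) a) (\<lambda>e b. scale (cointegral (S b * x)) e))"
  proof (intro sw_cong)
    fix c a
    have b: "bilin scale (\<lambda>e b. scale (cointegral (S b * x)) e)" by (intro cointegral_intros)
    have "sw (scale (cointegral c) a) (\<lambda>e b. scale (cointegral (S b * x)) e)
      = scale (cointegral c) (sw a (\<lambda>e b. scale (cointegral (S b * x)) e))" by (rule sw_scale[OF b])
    also have "\<dots> = sw a (\<lambda>e b. scale (cointegral c) (scale (cointegral (S b * x)) e))"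
      by (intro sw_apply[where sV = scale and sW = scale] cointegral_intros)
    finally show "sw a (\<lambda>e b. scale (cointegral (S b * x)) (scale (cointegral c) e))
        = sw (scale (cointegral c) a) (\<lambda>e b. scale (cointegral (S b * x)) e)"
      by (simp only: scale_scale mult.commute)
  qed
  also have "\<dots> = sw (sw \<Lambda> (\<lambda>c a. scale (cointegral c) a)) (\<lambda>e b. scale (cointegral (S b * x)) e)"
    by (intro sw_apply[where sV = scale and sW = scale and f = "\<lambda>z. sw z (\<lambda>e b. scale (cointegral (S b * x)) e)", symmetric] cointegral_intros)
  also have "\<dots> = sw 1 (\<lambda>e b. scale (cointegral (S b * x)) e)" by (simp only: cointegral_integral_left_one)
  also have "\<dots> = scale (cointegral (S 1 * x)) 1" by (intro sw_one[where sW = scale] cointegral_intros)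
  finally show ?thesis by (simp add: antipode_one)
qed

lemma cointegral_integral: "cointegral \<Lambda> = 1"
proof -
  have "cointegral \<Lambda> = sw \<Lambda> (\<lambda>a b. \<epsilon> b * cointegral a)"
    by (intro sw_counit_right[symmetric] cointegral_intros)
  also have "\<dots> = sw \<Lambda> (\<lambda>a b. \<epsilon> (scale (cointegral a) b))"
    by (simp add: lin_scale[OF counit_linear] mult.commute)
  also have "\<dots> = \<epsilon> (sw \<Lambda> (\<lambda>a b. scale (cointegral a) b))"
    by (rule sw_apply[OF counit_linear, symmetric])
  also have "\<dots> = 1" by (simp add: cointegral_integral_left_one counit_one)
  finally show ?thesis .
qed

text \<open>The group-like element \<open>g\<close> that measures how far \<open>\<lambda>\<close> is from being an integral on the other
  side as well.\<close>

definition modular :: 'h where "modular = sw \<Lambda> (\<lambda>a b. scale (cointegral b) a)"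

lemma cointegral_integral_left: "sw x (\<lambda>a b. scale (cointegral b) a) = scale (cointegral x) modular"
proof -
  let ?G = "\<lambda>x. sw x (\<lambda>a b. scale (cointegral b) a)"
  have G: "lin scale ?G" by (intro cointegral_intros)
  have "?G x = ?G (sw \<Lambda> (\<lambda>a b. scale (cointegral (S b * x)) a))" by (simp only: cointegral_dual')
  also have "\<dots> = sw \<Lambda> (\<lambda>a b. scale (cointegral (S b * x)) (?G a))"
    using sw_apply[OF G, of \<Lambda> "\<lambda>a b. scale (cointegral (S b * x)) a"] by (simp only: lin_scale[OF G])
  also have "\<dots> = sw \<Lambda> (\<lambda>a b. sw a (\<lambda>c e. scale (cointegral (S b * x)) (scale (cointegral e) c)))"
    by (intro sw_cong sw_apply[where sV = scale and sW = scale] cointegral_intros)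
  also have "\<dots> = sw \<Lambda> (\<lambda>c a. sw a (\<lambda>e b. scale (cointegral (S b * x)) (scale (cointegral e) c)))"
    by (intro sw_coassoc[where sW = scale, symmetric] cointegral_intros)
  also have "\<dots> = sw \<Lambda> (\<lambda>c a. sw a (\<lambda>e b. scale (cointegral (S (scale (cointegral e) b) * x)) c))"
    by (simp add: lin_scale[OF antipode_linear] scale_mult_left lin_scale[OF lin_cointegral_self] mult.commute)
  also have "\<dots> = sw \<Lambda> (\<lambda>c a. scale (cointegral (S (sw a (\<lambda>e b. scale (cointegral e) b)) * x)) c)"
    by (intro sw_cong sw_apply[where sV = scale and sW = scale and f = "\<lambda>z. scale (cointegral (S z * x)) c" for c, symmetric] cointegral_intros)
  also have "\<dots> = sw \<Lambda> (\<lambda>c a. scale (cointegral x) (scale (cointegral a) c))"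
    by (simp add: cointegral_integral_right lin_scale[OF antipode_linear] antipode_one scale_mult_left
        lin_scale[OF lin_cointegral_self] mult.commute)
  also have "\<dots> = scale (cointegral x) modular"
    unfolding modular_def by (intro sw_apply[where sV = scale and sW = scale, symmetric] cointegral_intros)
  finally show ?thesis .
qed

lemma counit_modular: "\<epsilon> modular = 1"
proof -
  have "\<epsilon> modular = sw \<Lambda> (\<lambda>a b. \<epsilon> a * cointegral b)"
    unfolding modular_def by (subst sw_apply[OF counit_linear]) (simp add: lin_scale[OF counit_linear] mult.commute)
  also have "\<dots> = cointegral \<Lambda>" by (intro sw_counit_left cointegral_intros)
  finally show ?thesis by (simp add: cointegral_integral)
qed

lemma grouplike_modular: assumes B: "bilin sW B" shows "sw modular B = B modular modular"
proof -
  interpret W: Vector_Spaces.vector_space sW by (rule bilin_vector_space[OF B])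
  note L = cointegral_intros bilin1[OF B] bilin2[OF B]
  have lW: "Vector_Spaces.linear sW sW (sW c)" for c
    by unfold_locales (auto simp: W.scale_right_distrib mult.commute)
  have lB: "lin sW (\<lambda>x. sw x B)" by (intro L B)
  have "sw modular B = sw \<Lambda> (\<lambda>a b. sw (scale (cointegral b) a) B)"
    unfolding modular_def by (rule sw_apply[OF lB])
  also have "\<dots> = sw \<Lambda> (\<lambda>a b. sW (cointegral b) (sw a B))" by (simp only: lin_scale[OF lB])
  also have "\<dots> = sw \<Lambda> (\<lambda>a b. sw a (\<lambda>c e. sW (cointegral b) (B c e)))"
    by (intro sw_cong sw_apply[OF lW])
  also have "\<dots> = sw \<Lambda> (\<lambda>a b. sw a (\<lambda>c e. B c (scale (cointegral b) e)))"
    by (simp only: bilin_scale2[OF B])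
  also have "\<dots> = sw \<Lambda> (\<lambda>c p. sw p (\<lambda>e b. B c (scale (cointegral b) e)))"
  proof (intro sw_coassoc[where sW = sW, symmetric])
    show "lin sW (\<lambda>b. B a (scale (cointegral b) c))" for a c by (intro L)
  qed (intro L)+
  also have "\<dots> = sw \<Lambda> (\<lambda>c p. B c (sw p (\<lambda>e b. scale (cointegral b) e)))"
    by (intro sw_cong sw_apply[where sV = scale and sW = sW, symmetric] L)
  also have "\<dots> = sw \<Lambda> (\<lambda>c p. B (scale (cointegral p) c) modular)"
    by (simp only: cointegral_integral_left bilin_scale1[OF B] bilin_scale2[OF B])
  also have "\<dots> = B modular modular"
    unfolding modular_def[symmetric]
    by (subst (2) modular_def, intro sw_apply[where sV = scale and sW = sW and f = "\<lambda>z. B z modular", symmetric] L)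
  finally show ?thesis .
qed

lemma antipode_modular: "S modular * modular = 1" "modular * S modular = 1"
proof -
  have "S modular * modular = sw modular (\<lambda>a b. S a * b)" by (intro grouplike_modular[where sW = scale, symmetric] cointegral_intros)
  then show "S modular * modular = 1" using sw_antipode_left[OF lin_self, of modular] by (simp add: counit_modular)
  have "modular * S modular = sw modular (\<lambda>a b. a * S b)" by (intro grouplike_modular[where sW = scale, symmetric] cointegral_intros)
  then show "modular * S modular = 1" using sw_antipode_right[OF lin_self, of modular] by (simp add: counit_modular)
qed

lemma antipode_square_modular: "S (S modular) = modular"
proof -
  have "S (S modular) * S modular = 1" using antipode_modular(2) antipode_mult[of modular "S modular"] by (simp add: antipode_one)
  then show ?thesis using antipode_modular by (metis mult.assoc mult.left_neutral mult.right_neutral)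
qed

lemma cointegral_antipode_square: "cointegral (S (S x)) = cointegral x"
proof -
  have "cointegral (S (S x)) = full_trace (x * twist_inv)" by (simp add: cointegral_def antipode_square mult.assoc twist_inv_assoc)
  also have "\<dots> = cointegral x" unfolding cointegral_def by (rule full_trace_comm)
  finally show ?thesis .
qed

text \<open>Insert the definition of the modular element and use \<open>\<Sum> \<lambda>(S x \<Lambda>\<^sub>1) \<Lambda>\<^sub>2 = x\<close>.\<close>

lemma cointegral_antipode_mult_modular: "cointegral (S x * modular) = cointegral x"
proof -
  let ?y = "sw \<Lambda> (\<lambda>a b. scale (cointegral (S x * a)) b)"
  have "cointegral (S x * modular) = sw \<Lambda> (\<lambda>a b. cointegral (S x * scale (cointegral b) a))"
    unfolding modular_def by (intro sw_apply[where sV = scale and sW = "(*)"] cointegral_intros)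
  also have "\<dots> = sw \<Lambda> (\<lambda>a b. cointegral (scale (cointegral (S x * a)) b))"
    by (simp add: scale_mult_right lin_scale[OF lin_cointegral_self] mult.commute)
  also have "\<dots> = cointegral ?y" by (rule sw_apply[OF lin_cointegral_self, symmetric])
  also have "?y = x" using antipode_cointegral_dual[of "S x"] inj_antipode by (simp add: inj_def)
  finally show ?thesis .
qed

lemma cointegral_antipode: "cointegral (S x) = cointegral (x * modular)"
proof -
  have "cointegral (S x) = cointegral (S (S x) * modular)" by (rule cointegral_antipode_mult_modular[symmetric])
  also have "\<dots> = cointegral (S (S (x * modular)))" by (simp add: antipode_mult antipode_square_modular)
  also have "\<dots> = cointegral (x * modular)" by (rule cointegral_antipode_square)
  finally show ?thesis .
qed

text \<open>Radford's formula for the fourth power of the antipode. Since \<open>\<lambda> \<circ> S\<close> is \<open>\<lambda>\<close> translated by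
  the modular element, \<open>\<lambda> (S (x y))\<close> can be computed in two ways with \<open>cointegral_comm\<close>.\<close>

lemma antipode_fourth_power: "S (S (S (S x))) * modular = modular * x"
proof (rule cointegral_nondegenerate)
  fix y
  have "cointegral (modular * x * y) = cointegral (S (S modular) * (x * y))" by (simp add: antipode_square_modular mult.assoc)
  also have "\<dots> = cointegral (x * y * modular)" by (rule cointegral_comm[symmetric])
  also have "\<dots> = cointegral (S (x * y))" by (rule cointegral_antipode[symmetric])
  also have "\<dots> = cointegral (S y * S x)" by (simp add: antipode_mult)
  also have "\<dots> = cointegral (S (S (S x)) * S y)" by (rule cointegral_comm)
  also have "\<dots> = cointegral (S (y * S (S x)))" by (simp add: antipode_mult)
  also have "\<dots> = cointegral (y * S (S x) * modular)" by (rule cointegral_antipode)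
  also have "\<dots> = cointegral (y * (S (S x) * modular))" by (simp add: mult.assoc)
  also have "\<dots> = cointegral (S (S (S (S x) * modular)) * y)" by (rule cointegral_comm)
  also have "\<dots> = cointegral (S (S (S (S x))) * modular * y)" by (simp add: antipode_mult antipode_square_modular)
  finally show "cointegral (S (S (S (S x))) * modular * y) = cointegral (modular * x * y)" by simp
qed

lemma modular_power_grouplike: "bilin sW B \<Longrightarrow> sw (modular ^ n) B = B (modular ^ n) (modular ^ n)"
proof (induction n arbitrary: B)
  case 0
  then show ?case by (simp add: sw_one)
next
  case (Suc n)
  note L = cointegral_intros bilin1[OF Suc.prems] bilin2[OF Suc.prems]
  have "sw (modular ^ Suc n) B = sw modular (\<lambda>a b. sw (modular ^ n) (\<lambda>c e. B (a * c) (b * e)))"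
    by (simp add: sw_mult[OF Suc.prems])
  also have "\<dots> = sw modular (\<lambda>a b. B (a * modular ^ n) (b * modular ^ n))"
    by (intro sw_cong Suc.IH L)
  also have "\<dots> = B (modular * modular ^ n) (modular * modular ^ n)"
    by (intro grouplike_modular[where sW = sW] L)
  finally show ?case by simp
qed

end

section \<open>Rational relations between roots of unity\<close>

definition rat_eval :: "rat poly \<Rightarrow> 'a::field_char_0 \<Rightarrow> 'a" where
  "rat_eval p x = poly (map_poly of_rat p) x"

lemma rat_eval_0: "rat_eval 0 x = 0"
  by (simp add: rat_eval_def)

lemma rat_eval_pCons: "rat_eval (pCons a p) x = of_rat a + x * rat_eval p x"
  by (simp add: rat_eval_def map_poly_pCons)

lemma rat_eval_add: "rat_eval (p + q) x = rat_eval p x + rat_eval q x"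
  by (induction p q rule: poly_induct2) (auto simp: rat_eval_0 rat_eval_pCons of_rat_add algebra_simps)

lemma rat_eval_smult: "rat_eval (Polynomial.smult c p) x = of_rat c * rat_eval p x"
  by (induction p) (auto simp: rat_eval_0 rat_eval_pCons of_rat_mult algebra_simps)

lemma rat_eval_mult: "rat_eval (p * q) x = rat_eval p x * rat_eval q x"
  by (induction p) (auto simp: rat_eval_0 rat_eval_pCons rat_eval_add rat_eval_smult algebra_simps)

lemma rat_eval_monom: "rat_eval (Polynomial.monom c n) x = of_rat c * x ^ n"
  by (induction n) (auto simp: monom_0 monom_Suc rat_eval_pCons rat_eval_0)

lemma rat_eval_sum: "rat_eval (sum f I) x = (\<Sum>i\<in>I. rat_eval (f i) x)"
  by (induction I rule: infinite_finite_induct) (auto simp: rat_eval_0 rat_eval_add)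

lemma minimal_polynomial_exists:
  fixes x :: "'a::field_char_0"
  assumes "p0 \<noteq> 0" "rat_eval p0 x = 0"
  obtains m where "m \<noteq> 0" "rat_eval m x = 0" "\<And>p. rat_eval p x = 0 \<Longrightarrow> m dvd p" "degree m > 0"
proof -
  from ex_has_least_nat[of "\<lambda>p. p \<noteq> 0 \<and> rat_eval p x = 0" p0 degree] assms
  obtain m where m: "m \<noteq> 0" "rat_eval m x = 0"
    and min: "\<And>p. p \<noteq> 0 \<Longrightarrow> rat_eval p x = 0 \<Longrightarrow> degree m \<le> degree p" by blast
  have "m dvd p" if p: "rat_eval p x = 0" for p
  proof -
    have "rat_eval (p div m * m + p mod m) x = 0" using p by simp
    then have "rat_eval (p mod m) x = 0" using m(2) by (simp only: rat_eval_add rat_eval_mult) simp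
    then have "p mod m = 0" using min[of "p mod m"] degree_mod_less[OF m(1), of p] by fastforce
    then show ?thesis by (simp add: dvd_eq_mod_eq_0)
  qed
  moreover have "degree m > 0"
  proof (rule ccontr)
    assume "\<not> degree m > 0"
    then obtain c where "m = [:c:]" by (auto elim: degree_eq_zeroE)
    then show False using m by (auto simp: rat_eval_pCons rat_eval_0)
  qed
  ultimately show ?thesis using that m by blast
qed

text \<open>Let \<open>y\<close> be a root of the minimal polynomial \<open>m\<close> of \<open>x\<close>, and let \<open>m'\<close> be the minimal
  polynomial of \<open>y\<close>, so that \<open>m = m' h\<close>. As \<open>h\<close> has smaller degree than \<open>m\<close>, it does not vanish at
  \<open>x\<close>, so \<open>m'\<close> does. Hence \<open>x\<close> and \<open>y\<close> satisfy the same rational equations.\<close>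

lemma conjugate_exists:
  fixes x :: "'a::field_char_0"
  assumes "p0 \<noteq> 0" "rat_eval p0 x = 0"
  shows "\<exists>y :: 'b::{alg_closed_field, field_char_0}. \<forall>p. rat_eval p y = 0 \<longleftrightarrow> rat_eval p x = 0"
proof -
  obtain m where m: "m \<noteq> 0" "rat_eval m x = 0" and m_dvd: "\<And>p. rat_eval p x = 0 \<Longrightarrow> m dvd p"
    and deg_m: "degree m > 0"
    using minimal_polynomial_exists[OF assms] by metis
  have "degree (map_poly (of_rat :: rat \<Rightarrow> 'b) m) = degree m" by (simp add: degree_map_poly)
  then obtain y :: 'b where "poly (map_poly of_rat m) y = 0"
    using alg_closed_imp_poly_has_root[of "map_poly (of_rat :: rat \<Rightarrow> 'b) m"] deg_m by auto
  then have y: "rat_eval m y = 0" by (simp add: rat_eval_def)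
  obtain m' where m': "m' \<noteq> 0" "rat_eval m' y = 0" and m'_dvd: "\<And>p. rat_eval p y = 0 \<Longrightarrow> m' dvd p"
    and deg_m': "degree m' > 0"
    using minimal_polynomial_exists[OF m(1) y] by metis
  obtain h where h: "m = m' * h" using m'_dvd[OF y] by (rule dvdE)
  have "h \<noteq> 0" using h m by auto
  then have "degree h < degree m" using deg_m' m' unfolding h by (subst degree_mult_eq) auto
  then have "rat_eval h x \<noteq> 0" using m_dvd[of h] \<open>h \<noteq> 0\<close> dvd_imp_degree_le[of m h] by fastforce
  then have m'x: "rat_eval m' x = 0" using m(2) by (simp add: h rat_eval_mult)
  have "rat_eval p y = 0 \<longleftrightarrow> rat_eval p x = 0" for p
  proof
    assume "rat_eval p y = 0"
    then obtain q where "p = m' * q" using m'_dvd by (metis dvdE)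
    then show "rat_eval p x = 0" by (simp add: rat_eval_mult m'x)
  next
    assume "rat_eval p x = 0"
    then obtain q where "p = m * q" using m_dvd by (metis dvdE)
    then show "rat_eval p y = 0" by (simp add: rat_eval_mult y)
  qed
  then show ?thesis by blast
qed

text \<open>For the complex number \<open>exp(2\<pi>i/Q)\<close> the second factor of each summand is the conjugate of the
  first one, so the sum is a sum of squared absolute values. Rational equations carry over to a
  conjugate of that number in the given field, where there are no absolute values.\<close>

lemma root_of_unity_definite:
  assumes Q: "Q > 0"
  shows "\<exists>\<zeta> :: 'b::{alg_closed_field, field_char_0}.
    \<zeta> ^ Q = 1 \<and> (\<forall>j. 0 < j \<longrightarrow> j < Q \<longrightarrow> \<zeta> ^ j \<noteq> 1) \<and>
    (\<forall>(I :: 'i set) (r :: 'i \<Rightarrow> nat \<Rightarrow> rat). finite I \<longrightarrow>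
      (\<Sum>i\<in>I. (\<Sum>l<Q. of_rat (r i l) * \<zeta> ^ l) * (\<Sum>l<Q. of_rat (r i l) * \<zeta> ^ (l * (Q - 1)))) = 0 \<longrightarrow>
      (\<forall>i\<in>I. (\<Sum>l<Q. of_rat (r i l) * \<zeta> ^ l) = 0))"
proof -
  define c where "c = cis (2 * pi / real Q)"
  have c_pow: "c ^ j = cis (2 * pi * real j / real Q)" for j
    by (simp add: c_def Complex.DeMoivre mult_ac)
  have cQ: "c ^ Q = 1" using Q by (simp add: c_pow)
  have c_prim: "c ^ j \<noteq> 1" if "0 < j" "j < Q" for j
  proof
    assume "c ^ j = 1"
    then have "cis (2 * pi * real j / real Q) = cis (2 * pi * real 0 / real Q)" by (simp add: c_pow)
    then have "j = 0" using inj_onD[OF bij_betw_imp_inj_on[OF bij_betw_roots_unity[OF Q]], of j 0] that Q by simp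
    then show False using that by simp
  qed
  let ?u = "\<lambda>j. Polynomial.monom 1 j - 1 :: rat poly"
  have u: "rat_eval (?u j) x = x ^ j - 1" for j and x :: "'x::field_char_0"
  proof -
    have "rat_eval (?u j + 1) x = rat_eval (?u j) x + rat_eval 1 x" by (rule rat_eval_add)
    then show ?thesis by (simp add: rat_eval_monom) (simp add: rat_eval_def algebra_simps)
  qed
  have "?u Q \<noteq> 0"
  proof
    assume "?u Q = 0"
    then have "coeff (?u Q) Q = 0" by simp
    then show False using Q by simp
  qed
  moreover have "rat_eval (?u Q) c = 0" by (simp add: u cQ)
  ultimately obtain \<zeta> :: 'b where \<zeta>: "\<And>p. rat_eval p \<zeta> = 0 \<longleftrightarrow> rat_eval p c = 0"
    using conjugate_exists[where 'b = 'b] by blast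
  show ?thesis
  proof (intro exI[of _ \<zeta>] conjI allI impI ballI)
    show "\<zeta> ^ Q = 1" using \<zeta>[of "?u Q"] by (simp add: u cQ)
    show "\<zeta> ^ j \<noteq> 1" if "0 < j" "j < Q" for j using \<zeta>[of "?u j"] c_prim[OF that] by (simp add: u)
  next
    fix I :: "'i set" and r :: "'i \<Rightarrow> nat \<Rightarrow> rat" and i
    assume I: "finite I" and
      sum0: "(\<Sum>i\<in>I. (\<Sum>l<Q. of_rat (r i l) * \<zeta> ^ l) * (\<Sum>l<Q. of_rat (r i l) * \<zeta> ^ (l * (Q - 1)))) = 0"
    assume "i \<in> I"
    with I have I: "finite I" "i \<in> I" by simp_all
    define R where "R = (\<lambda>i. \<Sum>l<Q. Polynomial.monom (r i l) l)"
    define R' where "R' = (\<lambda>i. \<Sum>l<Q. Polynomial.monom (r i l) (l * (Q - 1)))"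
    have R: "rat_eval (R i) x = (\<Sum>l<Q. of_rat (r i l) * x ^ l)"
      and R': "rat_eval (R' i) x = (\<Sum>l<Q. of_rat (r i l) * x ^ (l * (Q - 1)))" for i and x :: "'x::field_char_0"
      by (simp_all add: R_def R'_def rat_eval_sum rat_eval_monom)
    have "rat_eval (\<Sum>i\<in>I. R i * R' i) \<zeta> = 0"
      using sum0 by (simp add: rat_eval_sum rat_eval_mult R R')
    then have "rat_eval (\<Sum>i\<in>I. R i * R' i) c = 0" by (simp only: \<zeta>)
    then have sum_c: "(\<Sum>i\<in>I. rat_eval (R i) c * rat_eval (R' i) c) = 0"
      by (simp only: rat_eval_sum rat_eval_mult)
    have "c * c ^ (Q - 1) = 1" using cQ Q by (simp flip: power_Suc)
    moreover have "c * cnj c = 1" by (simp add: c_def complex_norm_square[symmetric])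
    ultimately have "c * c ^ (Q - 1) = c * cnj c" by simp
    then have "c ^ (Q - 1) = cnj c" by (simp add: c_def)
    then have cnj: "c ^ (l * (Q - 1)) = cnj (c ^ l)" for l
      by (simp add: mult.commute[of l] power_mult)
    have "rat_eval (R' i) c = cnj (rat_eval (R i) c)" for i
    proof -
      have "cnj (of_rat q) = of_rat q" for q by (cases q) (simp add: of_rat_rat)
      then show ?thesis by (simp add: R R' cnj del: One_nat_def)
    qed
    then have "(\<Sum>i\<in>I. complex_of_real ((cmod (rat_eval (R i) c))\<^sup>2)) = 0"
      using sum_c by (simp only: complex_norm_square)
    then have "(\<Sum>i\<in>I. (cmod (rat_eval (R i) c))\<^sup>2) = 0"
      by (metis of_real_eq_0_iff of_real_sum)
    then have "(cmod (rat_eval (R i) c))\<^sup>2 = 0"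
      using I by (simp only: sum_nonneg_eq_0_iff[OF I(1) zero_le_power2]) 
    then have "rat_eval (R i) \<zeta> = 0" by (simp add: \<zeta>)
    then show "(\<Sum>l<Q. of_rat (r i l) * \<zeta> ^ l) = 0" by (simp add: R)
  qed
qed

section \<open>The square of the antipode\<close>

context semisimple_hopf
begin

lemma eq_functionals: assumes "\<And>p. lin (*) p \<Longrightarrow> p x = p y" shows "x = y"
  by (rule coef_eq_imp_eq) (rule assms[OF lin_coef_self])

lemma modular_cancel: "S modular * (modular * x) = x"
  by (simp add: mult.assoc[symmetric] antipode_modular)

lemma modular_power_nonzero: "modular ^ n \<noteq> 0"
proof
  assume "modular ^ n = 0"
  moreover have "\<epsilon> (modular ^ n) = 1"
    by (induction n) (simp_all add: counit_one counit_mult counit_modular)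
  ultimately show False by (simp add: lin_zero[OF counit_linear])
qed

text \<open>Consider the first power of \<open>g\<close> that depends on its predecessors, \<open>g\<^sup>n = \<Sum> c\<^sub>i g\<^sup>i\<close>. Applying a
  functional \<open>p\<close> to the first leg of its comultiplication gives \<open>p(g\<^sup>n) c\<^sub>i = c\<^sub>i p(g\<^sup>i)\<close>, and
  therefore \<open>g\<^sup>n = g\<^sup>i\<close> as soon as \<open>c\<^sub>i \<noteq> 0\<close>.\<close>

lemma modular_finite_order: "\<exists>M>0. modular ^ M = 1"
proof -
  \<comment> \<open>\<open>D n\<close>: the power \<open>n\<close> depends linearly on the smaller powers.\<close>
  define D where "D = (\<lambda>n. \<exists>c. modular ^ n = (\<Sum>i<n. scale (c i) (modular ^ i)))"
  have below: "\<exists>n<m. D n" if "\<exists>i<m. c i \<noteq> 0" "(\<Sum>i<m. scale (c i) (modular ^ i)) = 0" for m c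
    using that
  proof (induction m)
    case (Suc m)
    show ?case
    proof (cases "c m = 0")
      case True
      then have "\<exists>n<m. D n" using Suc by (auto simp: less_Suc_eq)
      then show ?thesis using less_SucI by blast
    next
      case False
      have "scale (c m) (modular ^ m) = - (\<Sum>i<m. scale (c i) (modular ^ i))"
        using Suc.prems(2) by (simp add: eq_neg_iff_add_eq_0 add.commute)
      then have "scale (inverse (c m)) (scale (c m) (modular ^ m)) = scale (inverse (c m)) (- (\<Sum>i<m. scale (c i) (modular ^ i)))"
        by simp
      then have "modular ^ m = (\<Sum>i<m. scale (- inverse (c m) * c i) (modular ^ i))"
        using False by (simp add: scale_sum_right sum_negf)
      then have "D m" unfolding D_def by (intro exI[of _ "\<lambda>i. - inverse (c m) * c i"])
      then show ?thesis by blast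
    qed
  qed simp
  obtain c0 where "\<exists>i\<le>d. c0 i \<noteq> 0" "(\<Sum>i\<le>d. scale (c0 i) (modular ^ i)) = 0" by (rule family_dependent)
  then have "\<exists>n<Suc d. D n" by (intro below[of "Suc d" c0]) (auto simp: less_Suc_eq_le lessThan_Suc_atMost)
  then have "\<exists>n. D n" by blast
  then have Dn: "D (LEAST n. D n)" by (rule LeastI_ex)
  define n where "n = (LEAST n. D n)"
  have Dn: "D n" using Dn by (simp add: n_def)
  have least: "\<not> D m" if "m < n" for m using not_less_Least that by (simp add: n_def)
  obtain c where c: "modular ^ n = (\<Sum>i<n. scale (c i) (modular ^ i))" using Dn by (auto simp: D_def)
  have "\<exists>j<n. c j \<noteq> 0"
  proof (rule ccontr)
    assume "\<not> ?thesis"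
    then have "modular ^ n = 0" by (subst c) simp
    then show False using modular_power_nonzero by blast
  qed
  then obtain j where j: "j < n" "c j \<noteq> 0" by blast
  have "modular ^ n = modular ^ j"
  proof (rule eq_functionals)
    fix p :: "'h \<Rightarrow> 'k" assume p: "lin (*) p"
    have B: "bilin scale (\<lambda>x y. scale (p x) y)" by (intro bilinI lin_intros p)
    have lB: "lin scale (\<lambda>x. sw x (\<lambda>a b. scale (p a) b))" by (intro lin_sw B lin_self)
    have "scale (p (modular ^ n)) (modular ^ n) = sw (modular ^ n) (\<lambda>a b. scale (p a) b)"
      by (rule modular_power_grouplike[OF B, symmetric])
    also have "\<dots> = sw (\<Sum>i<n. scale (c i) (modular ^ i)) (\<lambda>a b. scale (p a) b)" by (simp only: c)
    also have "\<dots> = (\<Sum>i<n. scale (c i) (sw (modular ^ i) (\<lambda>a b. scale (p a) b)))"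
      by (simp only: lin_sum[OF lB] lin_scale[OF lB])
    also have "\<dots> = (\<Sum>i<n. scale (c i * p (modular ^ i)) (modular ^ i))" by (simp add: modular_power_grouplike[OF B])
    finally have 1: "scale (p (modular ^ n)) (modular ^ n) = (\<Sum>i<n. scale (c i * p (modular ^ i)) (modular ^ i))" .
    have "scale (p (modular ^ n)) (modular ^ n) = (\<Sum>i<n. scale (c i * p (modular ^ n)) (modular ^ i))"
      by (subst (2) c) (simp add: scale_sum_right mult.commute)
    with 1 have "(\<Sum>i<n. scale (c i * (p (modular ^ n) - p (modular ^ i))) (modular ^ i)) = 0"
      by (simp add: right_diff_distrib scale_left_diff_distrib sum_subtractf)
    then have "c j * (p (modular ^ n) - p (modular ^ j)) = 0"
      using below[of n "\<lambda>i. c i * (p (modular ^ n) - p (modular ^ i))"] least j(1) by blast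
    then show "p (modular ^ n) = p (modular ^ j)" using j(2) by simp
  qed
  then have eq: "modular ^ j * modular ^ (n - j) = modular ^ j * 1" using j by (simp flip: power_add)
  have cancel: "S modular ^ i * (modular ^ i * x) = x" for i x
  proof (induction i arbitrary: x)
    case (Suc i)
    show ?case by (simp only: power_Suc2[of "S modular"] power_Suc[of modular] mult.assoc modular_cancel Suc)
  qed simp
  have "modular ^ (n - j) = 1" using cancel[of j "modular ^ (n - j)"] cancel[of j 1] eq by simp
  then show ?thesis using j by (intro exI[of _ "n - j"]) simp
qed

text \<open>Both \<open>w\<^sup>2\<close> and the modular element implement the fourth power of the antipode by conjugation,
  so they differ by a central factor.\<close>

lemma twist_square: obtains f where "twist * twist = modular * central f"
proof -
  let ?c = "S modular * (twist * twist)"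
  have "?c * x = x * ?c" for x
  proof -
    have "modular * (x * S modular) = S (S (S (S x))) * modular * S modular" by (simp add: antipode_fourth_power mult.assoc)
    also have "\<dots> = S (S (S (S x)))" by (simp add: mult.assoc antipode_modular)
    finally have "S modular * S (S (S (S x))) = S modular * (modular * (x * S modular))" by (rule arg_cong[OF sym])
    then have gx: "S modular * S (S (S (S x))) = x * S modular" by (simp only: modular_cancel)
    have "?c * x = S modular * (S (S (S (S x))) * (twist * twist))"
    proof -
      have "S (S (S (S x))) * (twist * twist) = (S (S (S (S x))) * twist) * twist" by (simp only: mult.assoc)
      also have "\<dots> = twist * (S (S x) * twist)" by (simp only: antipode_square_twist mult.assoc)
      also have "\<dots> = twist * twist * x" by (simp only: antipode_square_twist mult.assoc)
      finally show ?thesis by (simp only: mult.assoc)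
    qed
    also have "\<dots> = x * ?c" by (simp only: mult.assoc[symmetric] gx)
    finally show ?thesis .
  qed
  then have "?c \<in> center" by (simp add: center_def)
  then obtain f where f: "?c = central f" by (auto simp: center_eq)
  have "twist * twist = modular * ?c" by (simp add: mult.assoc[symmetric] antipode_modular)
  then show ?thesis using that f by simp
qed

text \<open>Up to the factor \<open>deg i\<close>, this is the rank of the left multiplication by the component of
  \<open>p\<close> in block \<open>i\<close>.\<close>

lemma block_trace_idempotent:
  assumes p: "p * p = p" and i: "i \<in> rep ` A"
  shows "\<exists>q :: rat. block_trace i p = of_rat q"
proof -
  let ?e = "central (\<lambda>j. if j = i then 1 else 0)"
  have ee: "?e * ?e = ?e" unfolding central_mult by (rule central_cong) simp
  let ?P = "\<lambda>x. p * ?e * x"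
  have "p * ?e * (p * ?e) = p * (?e * p) * ?e" by (simp only: mult.assoc)
  also have "\<dots> = p * p * (?e * ?e)" by (simp only: central_commute[of _ p] mult.assoc)
  also have "\<dots> = p * ?e" by (simp only: ee p)
  finally have PP: "?P (?P x) = ?P x" for x by (simp only: mult.assoc[symmetric])
  obtain r where r: "lin_trace scale ?P = of_nat r"
    by (rule lin_trace_idempotent[OF lin_mult_left[OF lin_self] PP])
  have "of_nat r = regular_char scale (p * ?e)" by (simp add: regular_char_def r)
  also have "\<dots> = (\<Sum>j\<in>rep ` A. of_nat (deg j) * block_trace j (?e * p))"
    by (simp add: regular_char_eq central_commute[of _ p])
  also have "\<dots> = (\<Sum>j\<in>rep ` A. if j = i then of_nat (deg i) * block_trace i p else 0)"
    by (intro sum.cong refl) (simp add: block_trace_central_mult)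
  also have "\<dots> = of_nat (deg i) * block_trace i p" using i finite_A by simp
  finally have "block_trace i p = of_nat r / of_nat (deg i)" using deg_pos[OF i] by (simp add: field_simps)
  also have "\<dots> = of_rat (of_nat r / of_nat (deg i))" by (simp add: of_rat_divide)
  finally show ?thesis by blast
qed

lemma power_left_inverse: assumes "u * x = (1 :: 'h)" shows "u ^ n * x ^ n = 1"
proof (induction n)
  case (Suc n)
  have "u ^ Suc n * x ^ Suc n = u ^ n * (u * x) * x ^ n"
    by (simp only: power_Suc2[of u] power_Suc[of x] mult.assoc)
  then show ?case using Suc assms by simp
qed simp

lemma mult_central_power: "(x * central f) ^ n = x ^ n * central (\<lambda>i. f i ^ n)"
proof (induction n)
  case (Suc n)
  have "(x * central f) ^ Suc n = x * (central f * x ^ n) * central (\<lambda>i. f i ^ n)"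
    by (simp only: power_Suc Suc mult.assoc)
  also have "\<dots> = x * x ^ n * (central f * central (\<lambda>i. f i ^ n))"
    by (simp only: central_commute[of f "x ^ n"] mult.assoc)
  finally show ?case by (simp add: central_mult)
qed (simp add: central_one)

text \<open>Fourier inversion for the cyclic group generated by \<open>v\<close>.\<close>

lemma spectral_idempotents:
  fixes v :: 'h and \<zeta> :: 'k
  assumes Q: "Q > 0" and v: "v ^ Q = 1" and \<zeta>: "\<zeta> ^ Q = 1"
    and prim: "\<And>j. 0 < j \<Longrightarrow> j < Q \<Longrightarrow> \<zeta> ^ j \<noteq> 1"
  obtains p where "\<And>l. p l * p l = p l" "\<And>k. v ^ k = (\<Sum>l<Q. scale (\<zeta> ^ (l * k)) (p l))"
proof -
  have \<zeta>0: "\<zeta> \<noteq> 0" using \<zeta> Q by (auto simp: power_0_left)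
  define z where "z = inverse \<zeta>"
  have z: "z ^ Q = 1" "z * \<zeta> = 1" using \<zeta> \<zeta>0 by (simp_all add: z_def power_inverse)
  define p where "p = (\<lambda>l. scale (inverse (of_nat Q)) (\<Sum>j<Q. scale (z ^ (l * j)) (v ^ j)))"
  have vp: "v * p l = scale (\<zeta> ^ l) (p l)" for l
  proof -
    let ?F = "\<lambda>j. scale (z ^ (l * j)) (v ^ j)"
    \<comment> \<open>The summation index may be shifted because the summand has period \<open>Q\<close>.\<close>
    have "?F Q = ?F 0"
      using v z(1) by (simp add: mult.commute[of l] power_mult)
    then have shift: "(\<Sum>j<Q. ?F (Suc j)) = (\<Sum>j<Q. ?F j)"
      using sum.lessThan_Suc_shift[of ?F Q] sum.lessThan_Suc[of ?F Q] by (simp add: add.commute)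
    have "v * ?F j = scale (\<zeta> ^ l) (?F (Suc j))" for j
    proof -
      have "\<zeta> ^ l * z ^ (l * Suc j) = (z * \<zeta>) ^ l * z ^ (l * j)"
        by (simp add: power_add power_mult_distrib)
      then show ?thesis by (simp add: scale_mult_right z)
    qed
    then have "v * (\<Sum>j<Q. ?F j) = scale (\<zeta> ^ l) (\<Sum>j<Q. ?F (Suc j))"
      by (simp only: sum_distrib_left scale_sum_right)
    then show ?thesis by (simp only: p_def scale_mult_right shift scale_scale mult.commute)
  qed
  have vpk: "v ^ k * p l = scale (\<zeta> ^ (l * k)) (p l)" for k l
  proof (induction k)
    case (Suc k)
    have "v ^ Suc k * p l = v ^ k * (v * p l)" by (simp only: power_Suc2 mult.assoc)
    also have "\<dots> = scale (\<zeta> ^ l) (v ^ k * p l)" by (simp only: vp scale_mult_right)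
    finally show ?case by (simp add: Suc power_add)
  qed simp
  have "p l * p l = p l" for l
  proof -
    have "p l * p l = scale (inverse (of_nat Q)) (\<Sum>j<Q. scale (z ^ (l * j)) (v ^ j * p l))"
    proof -
      have "p l = scale (inverse (of_nat Q)) (\<Sum>j<Q. scale (z ^ (l * j)) (v ^ j))" by (simp add: p_def)
      then have "p l * x = scale (inverse (of_nat Q)) (\<Sum>j<Q. scale (z ^ (l * j)) (v ^ j * x))" for x
        by (simp only: scale_mult_left sum_distrib_right)
      then show ?thesis .
    qed
    also have "\<dots> = scale (inverse (of_nat Q)) (\<Sum>j<Q. p l)"
      by (simp add: vpk) (simp flip: power_mult_distrib add: z)
    also have "\<dots> = p l"
    proof -
      have "(\<Sum>j<Q. p l) = scale (of_nat Q) (p l)" by (simp only: sum_constant_scale card_lessThan)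
      then show ?thesis using Q by (simp del: sum_constant)
    qed
    finally show ?thesis .
  qed
  moreover have sum_p: "(\<Sum>l<Q. p l) = 1"
  proof -
    have geo: "(\<Sum>l<Q. z ^ (l * j)) = (if j = 0 then of_nat Q else 0)" if "j < Q" for j
    proof (cases "j = 0")
      case False
      have "(z * \<zeta>) ^ j = 1" by (simp add: z)
      then have ne: "z ^ j \<noteq> 1" using prim[of j] False that by (auto simp: power_mult_distrib)
      have "(\<Sum>l<Q. z ^ (l * j)) = (\<Sum>l<Q. (z ^ j) ^ l)" by (simp add: power_mult[symmetric] mult.commute)
      also have "\<dots> = 0"
        using geometric_sum[OF ne, of Q] z(1) by (simp add: power_mult[symmetric] mult.commute[of j]) (simp add: power_mult)
      finally show ?thesis using False by simp
    qed simp
    have "(\<Sum>l<Q. p l) = scale (inverse (of_nat Q)) (\<Sum>j<Q. scale (\<Sum>l<Q. z ^ (l * j)) (v ^ j))"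
      unfolding p_def scale_sum_right[symmetric] scale_sum_left by (subst sum.swap) (rule refl)
    also have "(\<Sum>j<Q. scale (\<Sum>l<Q. z ^ (l * j)) (v ^ j)) = (\<Sum>j<Q. if j = 0 then scale (of_nat Q) 1 else 0)"
      by (intro sum.cong refl) (simp add: geo)
    also have "\<dots> = scale (of_nat Q) 1" using Q by simp
    finally show ?thesis using Q by simp
  qed
  moreover have "v ^ k = (\<Sum>l<Q. scale (\<zeta> ^ (l * k)) (p l))" for k
  proof -
    have "v ^ k = v ^ k * (\<Sum>l<Q. p l)" by (simp add: sum_p)
    also have "\<dots> = (\<Sum>l<Q. scale (\<zeta> ^ (l * k)) (p l))" by (simp only: sum_distrib_left vpk)
    finally show ?thesis .
  qed
  ultimately show ?thesis using that by blast
qed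

text \<open>The number in question is the sum of the block traces of the inverse of \<open>w\<close>. By the preceding
  lemmas some power of \<open>w\<close> is central, so in every block \<open>w\<close> is a scalar multiple of an element
  \<open>v\<close> of finite order. Since \<open>w\<close> has trace 1, the scalars cancel: the block trace of the inverse of
  \<open>w\<close> is the product of the block traces of \<open>v\<close> and of its inverse. The eigenvalues of \<open>v\<close> are roots of
  unity with rational weights, so these products behave like squared absolute values and cannot
  cancel each other.\<close>

lemma cointegral_one_nonzero: "cointegral 1 \<noteq> 0"
proof
  assume lam0: "cointegral 1 = 0"
  obtain f where f: "twist * twist = modular * central f" by (rule twist_square)
  obtain M where M: "M > 0" "modular ^ M = 1" using modular_finite_order by blast
  define Q where "Q = 2 * M"
  have Q: "Q > 0" using M by (simp add: Q_def)
  define F where "F = (\<lambda>i. f i ^ M)"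
  have "twist ^ Q = (twist * twist) ^ M" by (simp add: Q_def power_mult power2_eq_square)
  then have wQ: "twist ^ Q = central F" by (simp add: f mult_central_power M F_def)
  have F0: "F i \<noteq> 0" if "i \<in> rep ` A" for i
  proof -
    from that obtain a where a: "a \<in> A" "i = rep a" by blast
    have "1 = coef a a (twist_inv ^ Q * central F)"
      using power_left_inverse[OF twist_inv(1), of Q] a by (simp add: wQ coef_one)
    also have "\<dots> = F i * coef a a (twist_inv ^ Q)" using a by (simp add: coef_central_mult)
    finally show ?thesis by auto
  qed
  have "\<forall>i. \<exists>\<mu>. \<mu> ^ Q = F i" using nth_root_exists[OF Q] by blast
  from choice[OF this] obtain \<mu> where \<mu>: "\<And>i. \<mu> i ^ Q = F i" by blast
  have \<mu>0: "\<mu> i \<noteq> 0" if "i \<in> rep ` A" for i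
    using F0[OF that] \<mu>[of i] Q by (auto simp: power_0_left)
  let ?\<mu>i = "\<lambda>i. inverse (\<mu> i)"
  \<comment> \<open>Dividing by a \<open>Q\<close>-th root of the scalar \<open>F i\<close> in every block produces an element whose \<open>Q\<close>-th power is 1.\<close>
  define v where "v = twist * central ?\<mu>i"
  have "v ^ Q = central (\<lambda>i. F i * ?\<mu>i i ^ Q)" by (simp add: v_def mult_central_power wQ central_mult)
  also have "\<dots> = central (\<lambda>i. 1)" by (rule central_cong) (simp add: \<mu> F0 power_inverse)
  finally have vQ: "v ^ Q = 1" by (simp add: central_one)
  then have vv: "v * v ^ (Q - 1) = 1" using Q by (simp flip: power_Suc)
  have "central ?\<mu>i * central \<mu> = central (\<lambda>i. 1)"
    unfolding central_mult by (rule central_cong) (simp add: \<mu>0)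
  then have "twist = v * central \<mu>" by (simp add: v_def mult.assoc central_one)
  then have tr_twist: "block_trace i twist = \<mu> i * block_trace i v" for i
    by (simp add: central_commute[symmetric] block_trace_central_mult)
  have "twist_inv = twist_inv * (v * v ^ (Q - 1))" by (simp only: vv mult.right_neutral)
  also have "\<dots> = central ?\<mu>i * v ^ (Q - 1)" by (simp add: v_def mult.assoc twist_inv_assoc)
  finally have tr_twist_inv: "block_trace i twist_inv = ?\<mu>i i * block_trace i (v ^ (Q - 1))" for i
    by (simp only: block_trace_central_mult)
  have tr: "block_trace i twist_inv = block_trace i v * block_trace i (v ^ (Q - 1))"
    and tr_v: "block_trace i v \<noteq> 0" if i: "i \<in> rep ` A" for i
  proof -
    have 1: "\<mu> i * block_trace i v = 1" using tr_twist block_trace_twist[OF i] by simp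
    then show "block_trace i v \<noteq> 0" by auto
    from 1 have "?\<mu>i i = block_trace i v" using \<mu>0[OF i] by (simp add: field_simps)
    then show "block_trace i twist_inv = block_trace i v * block_trace i (v ^ (Q - 1))" by (simp add: tr_twist_inv)
  qed
  obtain \<zeta> :: 'k where \<zeta>: "\<zeta> ^ Q = 1" "\<forall>j. 0 < j \<longrightarrow> j < Q \<longrightarrow> \<zeta> ^ j \<noteq> 1"
    and pos: "\<forall>(I :: 'h set) (r :: 'h \<Rightarrow> nat \<Rightarrow> rat). finite I \<longrightarrow>
      (\<Sum>i\<in>I. (\<Sum>l<Q. of_rat (r i l) * \<zeta> ^ l) * (\<Sum>l<Q. of_rat (r i l) * \<zeta> ^ (l * (Q - 1)))) = 0 \<longrightarrow>
      (\<forall>i\<in>I. (\<Sum>l<Q. of_rat (r i l) * \<zeta> ^ l) = 0)"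
    using root_of_unity_definite[OF Q, where 'b = 'k and 'i = 'h] by (elim exE conjE)
  obtain p where p: "\<And>l. p l * p l = p l" and v_p: "\<And>k. v ^ k = (\<Sum>l<Q. scale (\<zeta> ^ (l * k)) (p l))"
    by (rule spectral_idempotents[OF Q vQ \<zeta>(1)]) (use \<zeta>(2) in blast)+
  define r where "r = (\<lambda>i l. SOME q :: rat. block_trace i (p l) = of_rat q)"
  have r: "block_trace i (p l) = of_rat (r i l)" if "i \<in> rep ` A" for i l
    unfolding r_def by (rule someI_ex[OF block_trace_idempotent[OF p that]])
  have tr_k: "block_trace i (v ^ k) = (\<Sum>l<Q. of_rat (r i l) * \<zeta> ^ (l * k))" if "i \<in> rep ` A" for i k
    by (simp add: v_p lin_sum[OF lin_block_trace_self] lin_scale[OF lin_block_trace_self] r[OF that] mult.commute)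
  have tr_1: "block_trace i v = (\<Sum>l<Q. of_rat (r i l) * \<zeta> ^ l)" if "i \<in> rep ` A" for i
    using tr_k[OF that, of 1] by simp
  have "0 = (\<Sum>i\<in>rep ` A. block_trace i twist_inv)"
    using lam0 by (simp add: cointegral_def full_trace_blocks)
  also have "\<dots> = (\<Sum>i\<in>rep ` A. (\<Sum>l<Q. of_rat (r i l) * \<zeta> ^ l) * (\<Sum>l<Q. of_rat (r i l) * \<zeta> ^ (l * (Q - 1))))"
    by (intro sum.cong refl) (simp only: tr tr_1 tr_k)
  finally have zero: "(\<Sum>i\<in>rep ` A. (\<Sum>l<Q. of_rat (r i l) * \<zeta> ^ l) * (\<Sum>l<Q. of_rat (r i l) * \<zeta> ^ (l * (Q - 1)))) = 0"
    by (rule sym)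
  have "A \<noteq> {}" using sum_A by auto
  then obtain i where i: "i \<in> rep ` A" by blast
  have "block_trace i v = 0"
    unfolding tr_1[OF i] using pos[THEN spec, THEN spec, THEN mp, THEN mp, OF _ zero] i finite_A by blast
  then show False using tr_v[OF i] by simp
qed

text \<open>Both one-sided integral properties of \<open>\<lambda>\<close> are evaluated at 1.\<close>

lemma modular_eq_one: "modular = 1"
proof -
  have "scale (cointegral 1) modular = sw 1 (\<lambda>a b. scale (cointegral b) a)" by (rule cointegral_integral_left[symmetric])
  also have "\<dots> = scale (cointegral 1) 1" by (intro sw_one[where sW = scale] cointegral_intros)
  finally show ?thesis using cointegral_one_nonzero by (simp add: scale_cancel_left)
qed

lemma antipode_order_four: "S (S (S (S x))) = x"
  using antipode_fourth_power[of x] by (simp add: modular_eq_one)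

lemma lin_trace_integral:
  assumes f: "lin scale f"
  shows "lin_trace scale f = sw \<Lambda> (\<lambda>a b. cointegral (S b * f a))"
proof -
  let ?v = "\<lambda>j. fst (\<Delta> \<Lambda> ! j)" and ?\<phi> = "\<lambda>j x. cointegral (S (snd (\<Delta> \<Lambda> ! j)) * x)"
  have nth: "sw \<Lambda> F = (\<Sum>j<length (\<Delta> \<Lambda>). F (fst (\<Delta> \<Lambda> ! j)) (snd (\<Delta> \<Lambda> ! j)))" for F :: "'h \<Rightarrow> 'h \<Rightarrow> 'w::ab_group_add"
    by (simp add: sw_def sum_list_sum_nth atLeast0LessThan case_prod_unfold)
  have "x = (\<Sum>j<length (\<Delta> \<Lambda>). scale (?\<phi> j x) (?v j))" for x
    using cointegral_dual'[of x] unfolding nth by (rule sym)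
  then have "coordinates {..<length (\<Delta> \<Lambda>)} ?v ?\<phi>"
    unfolding coordinates_def by (intro conjI ballI allI finite_lessThan cointegral_intros) blast
  then show ?thesis by (simp only: lin_trace_coordinates[OF f] nth)
qed

text \<open>With the dual bases given by \<open>\<Lambda>\<close> the trace is
  \<open>\<Sum> p(\<Lambda>\<^sub>1) \<lambda>(S (S \<Lambda>\<^sub>2 \<Lambda>\<^sub>3))\<close>, where the last two legs contract.\<close>

lemma trace_twisted_convolution:
  assumes p: "lin (*) p"
  shows "lin_trace scale (\<lambda>y. sw y (\<lambda>c e. scale (p c) (S (S e)))) = p \<Lambda> * cointegral 1"
proof -
  note L = cointegral_intros p lin_compose[OF p]
  have "lin_trace scale (\<lambda>y. sw y (\<lambda>c e. scale (p c) (S (S e))))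
      = sw \<Lambda> (\<lambda>a b. cointegral (S b * sw a (\<lambda>c e. scale (p c) (S (S e)))))"
    by (intro lin_trace_integral L)
  also have "\<dots> = sw \<Lambda> (\<lambda>a b. sw a (\<lambda>c e. cointegral (S b * scale (p c) (S (S e)))))"
    by (intro sw_cong sw_apply[where sV = scale and sW = "(*)"] L)
  also have "\<dots> = sw \<Lambda> (\<lambda>c a. sw a (\<lambda>e b. cointegral (S b * scale (p c) (S (S e)))))"
    by (intro sw_coassoc[where sW = "(*)", symmetric] L)
  also have "\<dots> = sw \<Lambda> (\<lambda>c a. sw a (\<lambda>e b. p c * cointegral (S (S e * b))))"
    by (simp add: scale_mult_right lin_scale[OF lin_cointegral_self] antipode_mult)
  also have "\<dots> = sw \<Lambda> (\<lambda>c a. \<epsilon> a * (p c * cointegral (S 1)))"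
    by (intro sw_cong sw_antipode_left[where f = "\<lambda>z. p c * cointegral (S z)" for c] L)
  also have "\<dots> = p \<Lambda> * cointegral (S 1)"
    by (intro sw_counit_right[where f = "\<lambda>c. p c * cointegral (S 1)"] L)
  finally show ?thesis by (simp add: antipode_one)
qed

lemma trace_antipode_square: "lin_trace scale (\<lambda>y. S (S y)) = cointegral 1"
proof -
  have "sw y (\<lambda>c e. scale (\<epsilon> c) (S (S e))) = S (S y)" for y
    by (intro sw_counit_left cointegral_intros)
  then show ?thesis using trace_twisted_convolution[OF counit_linear] by (simp add: counit_integral)
qed

lemma lin_regular_char_self: "lin (*) (regular_char scale)"
  unfolding regular_char_trace[abs_def] by (intro cointegral_intros)

lemma regular_char_comm: "regular_char scale (x * y) = regular_char scale (y * x)"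
  unfolding regular_char_eq by (simp only: block_trace_comm)

lemma regular_char_antipode_square: "regular_char scale (S (S x)) = regular_char scale x"
proof -
  have "regular_char scale (S (S x)) = regular_char scale (x * (twist_inv * twist))"
    by (simp add: antipode_square regular_char_comm[of twist] mult.assoc)
  then show ?thesis by (simp add: twist_inv)
qed

lemma regular_char_one: "regular_char scale 1 = of_nat d"
proof -
  have "(*) 1 = (\<lambda>x :: 'h. x)" by (simp add: fun_eq_iff)
  then show ?thesis by (simp add: regular_char_def lin_trace_id)
qed

lemma regular_char_sw: "regular_char scale x = sw \<Lambda> (\<lambda>a b. cointegral (S b * (x * a)))"
  unfolding regular_char_def by (intro lin_trace_integral cointegral_intros)

lemma regular_char_integral: "regular_char scale \<Lambda> = 1"
proof -
  have "regular_char scale \<Lambda> = sw \<Lambda> (\<lambda>a b. \<epsilon> a * \<epsilon> (S b))"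
    by (simp add: regular_char_sw integral_right scale_mult_right integral_left
        lin_scale[OF lin_cointegral_self] cointegral_integral)
  also have "\<dots> = \<epsilon> (S \<Lambda>)" by (intro sw_counit_left cointegral_intros)
  finally show ?thesis by (simp add: counit_antipode counit_integral)
qed

text \<open>This is the isomorphism between \<open>H \<otimes> V\<close> and a sum of copies of \<open>H\<close>, on the level of traces.
  Write the regular character as \<open>\<Sum> \<lambda>(S \<Lambda>\<^sub>2 x \<Lambda>\<^sub>1)\<close> and use the integral property of \<open>\<lambda>\<close> for the
  elements \<open>S \<Lambda>\<^sub>2 x \<Lambda>\<^sub>1\<close>; the superfluous legs of \<open>\<Lambda>\<close> contract because \<open>\<tau>\<close> is invariant under
  cyclic permutation.\<close>

lemma regular_char_absorbs:
  assumes \<tau>: "lin (*) \<tau>" and comm: "\<And>x y. \<tau> (x * y) = \<tau> (y * x)"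
  shows "sw x (\<lambda>a b. regular_char scale a * \<tau> b) = regular_char scale x * \<tau> 1"
proof -
  note L = cointegral_intros \<tau> lin_compose[OF \<tau>]
  let ?B = "\<lambda>a b. cointegral a * \<tau> b"
  have B: "bilin (*) ?B" by (intro L)
  have lamt: "sw y ?B = cointegral y * \<tau> 1" for y
  proof -
    have "sw y ?B = sw y (\<lambda>a b. \<tau> (scale (cointegral a) b))" by (simp add: lin_scale[OF \<tau>])
    also have "\<dots> = \<tau> (sw y (\<lambda>a b. scale (cointegral a) b))" by (rule sw_apply[OF \<tau>, symmetric])
    finally show ?thesis by (simp add: cointegral_integral_right lin_scale[OF \<tau>])
  qed
  have cell: "sw x (\<lambda>a b. sw \<Lambda> (\<lambda>p q. sw p (\<lambda>t u. sw q (\<lambda>r s. cointegral (S s * (a * t)) * \<tau> (S r * (b * u))))))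
      = sw x (\<lambda>a b. sw \<Lambda> (\<lambda>p q. cointegral (S q * (a * p)) * \<tau> b))"
  proof (rule sw_cong)
    fix a b
    have "sw \<Lambda> (\<lambda>p q. sw p (\<lambda>t u. sw q (\<lambda>r s. cointegral (S s * (a * t)) * \<tau> (S r * (b * u)))))
        = sw \<Lambda> (\<lambda>p q. sw p (\<lambda>t u. sw q (\<lambda>r s. cointegral (S s * (a * t)) * \<tau> (b * (u * S r)))))"
      by (simp add: comm[of "S _"] mult.assoc)
    also have "\<dots> = sw \<Lambda> (\<lambda>t q. sw q (\<lambda>u q. sw q (\<lambda>r s. cointegral (S s * (a * t)) * \<tau> (b * (u * S r)))))"
      by (intro sw_coassoc[where sW = "(*)", symmetric] L)
    also have "\<dots> = sw \<Lambda> (\<lambda>t q. sw q (\<lambda>p s. sw p (\<lambda>u r. cointegral (S s * (a * t)) * \<tau> (b * (u * S r)))))"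
      by (intro sw_cong sw_coassoc[where sW = "(*)"] L)
    also have "\<dots> = sw \<Lambda> (\<lambda>t q. sw q (\<lambda>p s. \<epsilon> p * (cointegral (S s * (a * t)) * \<tau> (b * 1))))"
      by (intro sw_cong sw_antipode_right[where f = "\<lambda>z. cointegral (S s * (a * t)) * \<tau> (b * z)" for s t] L)
    also have "\<dots> = sw \<Lambda> (\<lambda>t q. cointegral (S q * (a * t)) * \<tau> (b * 1))"
      by (intro sw_cong sw_counit_left[where f = "\<lambda>s. cointegral (S s * (a * t)) * \<tau> (b * 1)" for t] L)
    finally show "sw \<Lambda> (\<lambda>p q. sw p (\<lambda>t u. sw q (\<lambda>r s. cointegral (S s * (a * t)) * \<tau> (S r * (b * u)))))
        = sw \<Lambda> (\<lambda>p q. cointegral (S q * (a * p)) * \<tau> b)" by simp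
  qed
  have mulconst: "Vector_Spaces.linear (*) (*) (\<lambda>t. t * c)" for c :: 'k
    by unfold_locales (auto simp: algebra_simps)
  have "regular_char scale x * \<tau> 1 = sw \<Lambda> (\<lambda>p q. cointegral (S q * (x * p)) * \<tau> 1)"
    unfolding regular_char_sw by (rule sw_apply[OF mulconst])
  also have "\<dots> = sw \<Lambda> (\<lambda>p q. sw (S q * (x * p)) ?B)" by (simp only: lamt)
  also have "\<dots> = sw \<Lambda> (\<lambda>p q. sw (S q) (\<lambda>r s. sw (x * p) (\<lambda>a b. cointegral (r * a) * \<tau> (s * b))))"
    by (simp only: sw_mult[OF B])
  also have "\<dots> = sw \<Lambda> (\<lambda>p q. sw q (\<lambda>r s. sw (x * p) (\<lambda>a b. cointegral (S s * a) * \<tau> (S r * b))))"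
    by (intro sw_cong sw_antipode[where sW = "(*)"] L)
  also have "\<dots> = sw \<Lambda> (\<lambda>p q. sw q (\<lambda>r s. sw x (\<lambda>a b. sw p (\<lambda>t u. cointegral (S s * (a * t)) * \<tau> (S r * (b * u))))))"
    by (intro sw_cong sw_mult[where sW = "(*)"] L)
  also have "\<dots> = sw \<Lambda> (\<lambda>p q. sw x (\<lambda>a b. sw q (\<lambda>r s. sw p (\<lambda>t u. cointegral (S s * (a * t)) * \<tau> (S r * (b * u))))))"
    by (intro sw_cong sw_swap)
  also have "\<dots> = sw \<Lambda> (\<lambda>p q. sw x (\<lambda>a b. sw p (\<lambda>t u. sw q (\<lambda>r s. cointegral (S s * (a * t)) * \<tau> (S r * (b * u))))))"
    by (intro sw_cong sw_swap)
  also have "\<dots> = sw x (\<lambda>a b. sw \<Lambda> (\<lambda>p q. sw p (\<lambda>t u. sw q (\<lambda>r s. cointegral (S s * (a * t)) * \<tau> (S r * (b * u))))))"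
    by (rule sw_swap)
  also have "\<dots> = sw x (\<lambda>a b. sw \<Lambda> (\<lambda>p q. cointegral (S q * (a * p)) * \<tau> b))" by (rule cell)
  also have "\<dots> = sw x (\<lambda>a b. regular_char scale a * \<tau> b)"
    unfolding regular_char_sw by (intro sw_cong sw_apply[OF mulconst, symmetric])
  finally show ?thesis by simp
qed

lemma d_pos: "d > 0"
proof (rule ccontr)
  assume "\<not> d > 0"
  have "independent {1 :: 'h}" by simp
  then have "card {1 :: 'h} \<le> d" by (rule independent_bound)
  then show False using \<open>\<not> d > 0\<close> by simp
qed

text \<open>The operator on \<open>H\<close> given by the idempotent \<open>\<chi>\<^sub>H / d\<close> of the dual algebra, \<open>\<chi>\<^sub>H\<close> being
  the regular character.\<close>

definition regular_proj :: "'h \<Rightarrow> 'h" where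
  "regular_proj y = sw y (\<lambda>c b. scale (regular_char scale c / of_nat d) b)"

lemma lin_chi: "lin scale f \<Longrightarrow> lin (*) (\<lambda>x. regular_char scale (f x) / of_nat d)"
  using lin_field_mult_right[OF lin_compose[OF lin_regular_char_self], of f "inverse (of_nat d)"]
  by (simp add: divide_inverse)

lemma lin_regular_proj_self: "lin scale regular_proj"
  unfolding regular_proj_def[abs_def] by (intro cointegral_intros lin_chi)

lemma regular_proj_idempotent: "regular_proj (regular_proj y) = regular_proj y"
proof -
  note L = cointegral_intros lin_chi
  let ?c = "\<lambda>c. regular_char scale c / of_nat d"
  have conv: "sw x (\<lambda>a b. ?c a * ?c b) = ?c x" for x
  proof -
    have "sw x (\<lambda>a b. ?c a * ?c b) = sw x (\<lambda>a b. regular_char scale a * (regular_char scale b / (of_nat d * of_nat d)))"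
      by (intro sw_cong) simp
    also have "\<dots> = regular_char scale x * (regular_char scale 1 / (of_nat d * of_nat d))"
    proof (rule regular_char_absorbs)
      show "lin (*) (\<lambda>b. regular_char scale b / (of_nat d * of_nat d))"
        using lin_field_mult_right[OF lin_regular_char_self, of "inverse (of_nat d * of_nat d)"]
        by (simp add: divide_inverse)
    qed (simp only: regular_char_comm)
    finally show ?thesis using d_pos by (simp add: regular_char_one)
  qed
  have "regular_proj (regular_proj y) = sw y (\<lambda>a b. regular_proj (scale (?c a) b))"
    unfolding regular_proj_def[of y] by (rule sw_apply[OF lin_regular_proj_self])
  also have "\<dots> = sw y (\<lambda>a b. scale (?c a) (sw b (\<lambda>e b. scale (?c e) b)))"
    by (simp only: lin_scale[OF lin_regular_proj_self]) (simp only: regular_proj_def)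
  also have "\<dots> = sw y (\<lambda>a b. sw b (\<lambda>e b. scale (?c a) (scale (?c e) b)))"
    by (intro sw_cong sw_apply[where sV = scale and sW = scale] L)
  also have "\<dots> = sw y (\<lambda>x b. sw x (\<lambda>a e. scale (?c a) (scale (?c e) b)))"
    by (intro sw_coassoc[where sW = scale] L)
  also have "\<dots> = sw y (\<lambda>x b. sw x (\<lambda>a e. scale (?c a * ?c e) b))" by simp
  also have "\<dots> = sw y (\<lambda>x b. scale (sw x (\<lambda>a e. ?c a * ?c e)) b)"
  proof (intro sw_cong)
    fix x b
    have "Vector_Spaces.linear (*) scale (\<lambda>t. scale t b)"
      by unfold_locales (auto simp: scale_left_distrib algebra_simps)
    then show "sw x (\<lambda>a e. scale (?c a * ?c e) b) = scale (sw x (\<lambda>a e. ?c a * ?c e)) b"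
      by (rule sw_apply[symmetric])
  qed
  also have "\<dots> = regular_proj y" by (simp only: conv regular_proj_def)
  finally show ?thesis .
qed

lemma regular_proj_antipode_square: "regular_proj (S (S y)) = S (S (regular_proj y))"
proof -
  note L = cointegral_intros lin_chi
  let ?B = "\<lambda>c b. scale (regular_char scale c / of_nat d) b"
  have "regular_proj (S (S y)) = sw (S y) (\<lambda>a b. ?B (S b) (S a))"
    unfolding regular_proj_def by (intro sw_antipode[where sW = scale] L)
  also have "\<dots> = sw y (\<lambda>a b. ?B (S (S a)) (S (S b)))"
    by (intro sw_antipode[where sW = scale] L)
  also have "\<dots> = sw y (\<lambda>a b. S (S (?B a b)))"
    by (simp add: regular_char_antipode_square lin_scale[OF antipode_linear])
  also have "\<dots> = S (S (regular_proj y))"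
    unfolding regular_proj_def by (intro sw_apply[where sV = scale and sW = scale and f = "\<lambda>z. S (S z)", symmetric] L)
  finally show ?thesis .
qed

lemma trace_twisted_regular_proj: "lin_trace scale (\<lambda>y. S (S (regular_proj y))) = cointegral 1 / of_nat d"
proof -
  note L = cointegral_intros lin_chi
  have "S (S (regular_proj y)) = sw y (\<lambda>c e. scale (regular_char scale c / of_nat d) (S (S e)))" for y
    unfolding regular_proj_def
    by (subst sw_apply[where sV = scale and sW = scale and f = "\<lambda>z. S (S z)"])
      (auto intro!: L simp: lin_scale[OF antipode_linear])
  then have "lin_trace scale (\<lambda>y. S (S (regular_proj y))) = regular_char scale \<Lambda> / of_nat d * cointegral 1"
    using trace_twisted_convolution[OF lin_chi[OF lin_self]] by simp
  then show ?thesis by (simp add: regular_char_integral)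
qed

text \<open>The numbers \<open>r\<close> and \<open>s\<close> are the dimensions of the eigenspaces of \<open>f\<close> for 1 and -1 in the
  range of \<open>P\<close>.\<close>

lemma involution_trace:
  assumes P: "lin scale P" and f: "lin scale f"
    and PP: "\<And>x. P (P x) = P x" and ff: "\<And>x. f (f x) = P x" and Pf: "\<And>x. P (f x) = f x" "\<And>x. f (P x) = f x"
  obtains r s where "lin_trace scale f = of_nat r - of_nat s" "lin_trace scale P = of_nat r + of_nat s"
    "r \<le> d" "s \<le> d" "r = 0 \<Longrightarrow> \<forall>x. f x = - P x" "s = 0 \<Longrightarrow> \<forall>x. f x = P x"
proof -
  define h where "h = inverse (2 :: 'k)"
  have h0: "h \<noteq> 0" by (simp add: h_def)
  have h: "h + h = 1" "h * h + h * h = h" by (simp_all add: h_def field_simps)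
  have half: "scale h x + scale h x = x" for x by (simp only: scale_left_distrib[symmetric] h scale_one)
  define P1 where "P1 = (\<lambda>x. scale h (P x) + scale h (f x))"
  define P2 where "P2 = (\<lambda>x. scale h (P x) + scale (- h) (f x))"
  have lin: "lin scale P1" "lin scale P2"
    unfolding P1_def P2_def by (intro lin_add_fun lin_scale_vec P f)+
  have quarter: "scale h (scale h x) + scale h (scale h x) = scale h x" for x
  proof -
    have "scale h (scale h x) + scale h (scale h x) = scale h (scale h x + scale h x)"
      by (rule scale_right_distrib[symmetric])
    then show ?thesis by (simp only: half)
  qed
  have "P1 (P1 x) = P1 x" for x
  proof -
    have "P1 (P1 x) = (scale h (scale h (P x)) + scale h (scale h (P x))) + (scale h (scale h (f x)) + scale h (scale h (f x)))"
      by (simp only: P1_def lin_add[OF P] lin_add[OF f] lin_scale[OF P] lin_scale[OF f] PP ff Pf scale_right_distrib ac_simps)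
    then show ?thesis by (simp only: quarter P1_def)
  qed
  then obtain r where r: "lin_trace scale P1 = of_nat r" "r \<le> d" "r = 0 \<Longrightarrow> \<forall>x. P1 x = 0"
    by (rule lin_trace_idempotent[OF lin(1)]) blast
  have "P2 (P2 x) = P2 x" for x
  proof -
    have "P2 (P2 x) = (scale h (scale h (P x)) + scale h (scale h (P x))) - (scale h (scale h (f x)) + scale h (scale h (f x)))"
      by (simp add: P2_def lin_add[OF P] lin_add[OF f] lin_scale[OF P] lin_scale[OF f] lin_minus[OF P] lin_minus[OF f] lin_diff[OF P] lin_diff[OF f] PP ff Pf scale_right_diff_distrib)
    then show ?thesis by (simp only: quarter) (simp add: P2_def)
  qed
  then obtain s where s: "lin_trace scale P2 = of_nat s" "s \<le> d" "s = 0 \<Longrightarrow> \<forall>x. P2 x = 0"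
    by (rule lin_trace_idempotent[OF lin(2)]) blast
  have tr: "lin_trace scale P1 = h * lin_trace scale P + h * lin_trace scale f"
    "lin_trace scale P2 = h * lin_trace scale P - h * lin_trace scale f"
    unfolding P1_def P2_def using P f
    by (simp_all add: lin_trace_add lin_scale_vec lin_trace_scale del: scale_minus_left)
  have eqs: "lin_trace scale f = of_nat r - of_nat s" "lin_trace scale P = of_nat r + of_nat s"
  proof -
    have "of_nat r - of_nat s = (h + h) * lin_trace scale f" "of_nat r + of_nat s = (h + h) * lin_trace scale P"
      unfolding r(1)[symmetric] s(1)[symmetric] tr by (simp_all add: algebra_simps)
    then show "lin_trace scale f = of_nat r - of_nat s" "lin_trace scale P = of_nat r + of_nat s"
      by (simp_all add: h)
  qed
  show ?thesis
  proof (rule that[OF eqs r(2) s(2)])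
    assume "r = 0"
    then have "P1 x = 0" for x using r(3) by blast
    then have "scale h (P x + f x) = 0" for x by (simp only: P1_def scale_right_distrib)
    then have "P x + f x = 0" for x using h0 by (metis scale_eq_0_iff)
    then show "\<forall>x. f x = - P x" by (simp add: eq_neg_iff_add_eq_0 add.commute)
  next
    assume "s = 0"
    then have "P2 x = 0" for x using s(3) by blast
    then have "scale h (P x - f x) = 0" for x by (simp add: P2_def scale_right_diff_distrib)
    then have "P x - f x = 0" for x using h0 by (metis scale_eq_0_iff)
    then show "\<forall>x. f x = P x" by simp
  qed
qed

text \<open>The theorem of Larson and Radford. The square of the antipode is an involution with trace
  \<open>\<lambda> 1 = r - s\<close>, where \<open>r + s = d\<close>. On the range of the projection \<open>regular_proj\<close> its trace is
  \<open>\<lambda> 1 / d\<close>, which is an integer too. So \<open>r - s\<close> is a nonzero multiple of \<open>d\<close>; this leaves only the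
  identity and its negative, and the latter moves 1.\<close>

theorem antipode_involutive: "S (S x) = x"
proof -
  obtain r s where rs: "lin_trace scale (\<lambda>y. S (S y)) = of_nat r - of_nat s"
    "lin_trace scale (\<lambda>y. y :: 'h) = of_nat r + of_nat s"
    and r0: "r = 0 \<Longrightarrow> \<forall>x. S (S x) = - x" and s0: "s = 0 \<Longrightarrow> \<forall>x. S (S x) = x"
    by (rule involution_trace[of "\<lambda>y. y" "\<lambda>y. S (S y)"])
      (simp_all add: antipode_order_four lin_S lin_self)
  obtain r' s' where rs': "lin_trace scale (\<lambda>y. S (S (regular_proj y))) = of_nat r' - of_nat s'"
    by (rule involution_trace[of regular_proj "\<lambda>y. S (S (regular_proj y))"])
      (simp_all add: regular_proj_idempotent regular_proj_antipode_square antipode_order_four lin_regular_proj_self lin_S)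
  have "(of_nat (r + s) :: 'k) = of_nat d" using rs(2) by (simp add: lin_trace_id)
  then have d: "r + s = d" by (simp only: of_nat_eq_iff)
  have lam1: "cointegral 1 = of_nat r - of_nat s" using rs(1) by (simp add: trace_antipode_square)
  have "cointegral 1 = of_nat d * (of_nat r' - of_nat s')"
    using rs' d_pos by (simp add: trace_twisted_regular_proj field_simps)
  then have "(of_int (int r - int s) :: 'k) = of_int (int d * (int r' - int s'))" by (simp add: lam1)
  then have eq: "int r - int s = int d * (int r' - int s')" by (simp only: of_int_eq_iff)
  have ne: "int r - int s \<noteq> 0" using cointegral_one_nonzero by (auto simp: lam1)
  have "int d dvd int r - int s" unfolding eq by (rule dvd_triv_left)
  from dvd_imp_le_int[OF ne this] have "int d \<le> \<bar>int r - int s\<bar>" by linarith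
  then have "r = 0 \<or> s = 0" using d by linarith
  then show ?thesis
  proof
    assume "r = 0"
    then have "S (S 1) = - 1" using r0 by blast
    then have "(1 :: 'h) + 1 = 0" by (simp add: antipode_one eq_neg_iff_add_eq_0)
    then have "scale (1 + 1) 1 = (0 :: 'h)" by (simp only: scale_left_distrib scale_one)
    then have "(1 :: 'k) + 1 = 0" unfolding scale_eq_0_iff by simp
    then show ?thesis by simp
  qed (use s0 in blast)
qed

end

section \<open>Casimir elements of the center\<close>

context unital_algebra
begin

lemma basis_in: "is_basis scale C B \<Longrightarrow> b \<in> B \<Longrightarrow> b \<in> C"
  using span_superset[of B] by (auto simp: is_basis_def)

lemma basis_subspace: "is_basis scale C B \<Longrightarrow> subspace C"
  using subspace_span[of B] by (auto simp: is_basis_def)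

lemma form_sum_left:
  assumes C: "subspace C" and \<beta>: "nondeg_assoc_sym_form scale C \<beta>"
    and x: "\<And>i. i \<in> I \<Longrightarrow> x i \<in> C" and y: "y \<in> C"
  shows "\<beta> (\<Sum>i\<in>I. scale (c i) (x i)) y = (\<Sum>i\<in>I. c i * \<beta> (x i) y)"
proof -
  have add: "\<beta> (u + v) y = \<beta> u y + \<beta> v y" if "u \<in> C" "v \<in> C" for u v
    using \<beta> that y unfolding nondeg_assoc_sym_form_def by blast
  have sc: "\<beta> (scale k u) y = k * \<beta> u y" if "u \<in> C" for u k
    using \<beta> that y unfolding nondeg_assoc_sym_form_def by blast
  have 0: "\<beta> 0 y = 0" using sc[of 0 0] subspace_0[OF C] by simp
  show ?thesis using x
    by (induction I rule: infinite_finite_induct)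
      (simp_all add: 0 add sc subspace_sum[OF C] subspace_scale[OF C])
qed

lemma dual_bases_sym:
  assumes \<beta>: "nondeg_assoc_sym_form scale C \<beta>" and D: "dual_bases scale C \<beta> m r l"
  shows "dual_bases scale C \<beta> m l r"
proof -
  have in_C: "r i \<in> C" "l i \<in> C" if "i < m" for i
    using D that basis_in[of C "r ` {..<m}" "r i"] basis_in[of C "l ` {..<m}" "l i"]
    by (auto simp: dual_bases_def)
  have "\<beta> (l i) (r j) = \<beta> (r j) (l i)" if "i < m" "j < m" for i j
    using \<beta> in_C that unfolding nondeg_assoc_sym_form_def by blast
  then show ?thesis using D by (auto simp: dual_bases_def)
qed

lemma dual_bases_expand:
  assumes \<beta>: "nondeg_assoc_sym_form scale C \<beta>" and D: "dual_bases scale C \<beta> m r l" and x: "x \<in> C"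
  shows "x = (\<Sum>i<m. scale (\<beta> x (l i)) (r i))"
proof -
  have inj: "inj_on r {..<m}" and br: "is_basis scale C (r ` {..<m})" and bl: "is_basis scale C (l ` {..<m})"
    and dual: "\<And>i j. i < m \<Longrightarrow> j < m \<Longrightarrow> \<beta> (r i) (l j) = (if i = j then 1 else 0)"
    using D by (auto simp: dual_bases_def)
  have rC: "r i \<in> C" and lC: "l i \<in> C" if "i < m" for i
    using that by (auto intro: basis_in[OF br] basis_in[OF bl])
  have "x \<in> span (r ` {..<m})" using br x by (simp add: is_basis_def)
  then obtain u where "x = (\<Sum>v\<in>r ` {..<m}. scale (u v) v)"
    by (auto simp: span_finite)
  then have x_eq: "x = (\<Sum>i<m. scale (u (r i)) (r i))" by (simp add: sum.reindex[OF inj])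
  have "\<beta> x (l j) = u (r j)" if j: "j < m" for j
  proof -
    have "\<beta> x (l j) = (\<Sum>i<m. u (r i) * \<beta> (r i) (l j))"
      unfolding x_eq by (rule form_sum_left[OF basis_subspace[OF br] \<beta>]) (use rC lC j in auto)
    also have "\<dots> = (\<Sum>i<m. if i = j then u (r j) else 0)"
      by (intro sum.cong refl) (use dual j in auto)
    finally show ?thesis using j by simp
  qed
  then show ?thesis using x_eq by simp
qed

text \<open>Any two pairs of dual bases give the same sum: expand the vectors of one pair in the other.\<close>

lemma casimir_eqI:
  assumes \<beta>: "nondeg_assoc_sym_form scale C \<beta>" and D: "dual_bases scale C \<beta> m r l"
  shows "casimir scale C \<beta> = (\<Sum>i<m. r i * l i)"
  unfolding casimir_def
proof (rule the_equality)
  show "\<exists>m' r' l'. dual_bases scale C \<beta> m' r' l' \<and> (\<Sum>i<m. r i * l i) = (\<Sum>i<m'. r' i * l' i)"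
    using D by blast
next
  fix c assume "\<exists>m r l. dual_bases scale C \<beta> m r l \<and> c = (\<Sum>i<m. r i * l i)"
  then obtain m' r' l' where D': "dual_bases scale C \<beta> m' r' l'" and c: "c = (\<Sum>i<m'. r' i * l' i)" by blast
  have in_C: "r i \<in> C" "l i \<in> C" if "i < m" for i
    using D that basis_in[of C "r ` {..<m}" "r i"] basis_in[of C "l ` {..<m}" "l i"]
    by (auto simp: dual_bases_def)
  have in_C': "r' i \<in> C" "l' i \<in> C" if "i < m'" for i
    using D' that basis_in[of C "r' ` {..<m'}" "r' i"] basis_in[of C "l' ` {..<m'}" "l' i"]
    by (auto simp: dual_bases_def)
  have "c = (\<Sum>j<m'. (\<Sum>i<m. scale (\<beta> (r' j) (l i)) (r i)) * l' j)"
    unfolding c by (intro sum.cong refl arg_cong2[where f = "(*)"] dual_bases_expand[OF \<beta> D] in_C') simp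
  also have "\<dots> = (\<Sum>i<m. \<Sum>j<m'. r i * scale (\<beta> (l i) (r' j)) (l' j))"
  proof -
    have "\<beta> (r' j) (l i) = \<beta> (l i) (r' j)" if "i < m" "j < m'" for i j
      using \<beta> in_C(2)[OF that(1)] in_C'(1)[OF that(2)] unfolding nondeg_assoc_sym_form_def by blast
    then show ?thesis
      by (subst sum.swap) (simp add: sum_distrib_right scale_mult_left scale_mult_right)
  qed
  also have "\<dots> = (\<Sum>i<m. r i * (\<Sum>j<m'. scale (\<beta> (l i) (r' j)) (l' j)))"
    by (simp only: sum_distrib_left)
  also have "\<dots> = (\<Sum>i<m. r i * l i)"
    by (intro sum.cong refl arg_cong2[where f = "(*)"]
        dual_bases_expand[OF \<beta> dual_bases_sym[OF \<beta> D'], symmetric] in_C) simp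
  finally show "c = (\<Sum>i<m. r i * l i)" .
qed

end

context matrix_units_char0
begin

lemma central_eq_iff: "central f = central f' \<longleftrightarrow> (\<forall>i\<in>rep ` A. f i = f' i)"
proof
  assume eq: "central f = central f'"
  show "\<forall>i\<in>rep ` A. f i = f' i"
  proof
    fix i assume i: "i \<in> rep ` A"
    have "f i * of_nat (deg i) = f' i * of_nat (deg i)"
      using arg_cong[OF eq, of "block_trace i"] by (simp only: block_trace_central)
    then show "f i = f' i" using deg_pos[OF i] by simp
  qed
qed (rule central_cong, blast)

lemma central_zero: "central (\<lambda>i. 0) = 0" by (simp add: central_def)

text \<open>Both members of the dual bases used below are multiples of the block idempotents.\<close>

lemma central_basis:
  fixes m :: nat
  assumes en: "bij_betw en {..<m} (rep ` A)" and s: "\<And>i. i \<in> rep ` A \<Longrightarrow> s i \<noteq> 0"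
  defines "b \<equiv> \<lambda>j. central (\<lambda>i. if i = en j then s i else 0)"
  shows "inj_on b {..<m}" "is_basis scale center (b ` {..<m})"
proof -
  have enA: "en j \<in> rep ` A" if "j < m" for j using en that by (auto simp: bij_betw_def)
  have en_eq: "en j = en l \<longleftrightarrow> j = l" if "j < m" "l < m" for j l
    using en that by (auto simp: bij_betw_def inj_on_def)
  show inj: "inj_on b {..<m}"
  proof
    fix j l assume jl: "j \<in> {..<m}" "l \<in> {..<m}" "b j = b l"
    then have "s (en j) = (if en j = en l then s (en j) else 0)"
      using enA[of j] unfolding b_def central_eq_iff by auto
    then show "j = l" using s[OF enA, of j] en_eq jl by (auto split: if_splits)
  qed
  have comb: "(\<Sum>j<m. scale (c j) (b j)) = central f"
    if "\<And>j. j < m \<Longrightarrow> c j * s (en j) = f (en j)" for c f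
  proof -
    have "(\<Sum>j<m. scale (c j) (b j)) = central (\<lambda>i. \<Sum>j<m. c j * (if i = en j then s i else 0))"
      by (simp add: b_def central_scale central_sum)
    also have "\<dots> = central f"
    proof (rule central_cong)
      fix i assume "i \<in> rep ` A"
      then obtain l where l: "l < m" "i = en l" using en by (auto simp: bij_betw_def)
      have "(\<Sum>j<m. c j * (if i = en j then s i else 0)) = (\<Sum>j<m. if j = l then c l * s (en l) else 0)"
        by (intro sum.cong refl) (use l en_eq in auto)
      also have "\<dots> = c l * s (en l)" using l(1) by simp
      finally show "(\<Sum>j<m. c j * (if i = en j then s i else 0)) = f i" by (simp only: that[OF l(1)] l(2))
    qed
    finally show ?thesis .
  qed
  show "is_basis scale center (b ` {..<m})" unfolding is_basis_def
  proof
    show "independent (b ` {..<m})"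
    proof
      assume "dependent (b ` {..<m})"
      then obtain u where u: "\<exists>v\<in>b ` {..<m}. u v \<noteq> 0" "(\<Sum>v\<in>b ` {..<m}. scale (u v) v) = 0"
        by (auto simp: dependent_finite)
      then obtain j where j: "j < m" "u (b j) \<noteq> 0" by blast
      define ei where "ei = inv_into {..<m} en"
      have ei: "ei (en l) = l" if "l < m" for l
        using en that by (simp add: ei_def bij_betw_def)
      have "0 = (\<Sum>l<m. scale (u (b l)) (b l))" using u(2) inj by (simp add: sum.reindex)
      also have "\<dots> = central (\<lambda>i. u (b (ei i)) * s i)" by (rule comb) (simp add: ei)
      finally have "u (b (ei (en j))) * s (en j) = 0"
        unfolding central_zero[symmetric] central_eq_iff using enA[OF j(1)] by auto
      then show False using j s[OF enA[OF j(1)]] by (simp add: ei)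
    qed
    show "span (b ` {..<m}) = center"
    proof
      have "b ` {..<m} \<subseteq> center" by (auto simp: b_def central_in_center)
      moreover have "subspace (center :: 'h set)"
        by (auto simp: subspace_def center_def algebra_simps scale_mult_left scale_mult_right)
      ultimately show "span (b ` {..<m}) \<subseteq> center" by (rule span_minimal)
      show "center \<subseteq> span (b ` {..<m})"
      proof
        fix z :: 'h assume "z \<in> center"
        then obtain f where f: "z = central f" by (auto simp: center_eq)
        have "(\<Sum>j<m. scale (f (en j) / s (en j)) (b j)) = z"
          unfolding f by (rule comb) (simp add: s enA)
        moreover have "(\<Sum>j<m. scale (f (en j) / s (en j)) (b j)) \<in> span (b ` {..<m})"
          by (intro span_sum span_scale span_base imageI)
        ultimately show "z \<in> span (b ` {..<m})" by simp
      qed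
    qed
  qed
qed

lemma weighted_trace_form:
  "full_trace (central q * (central f * central f')) = (\<Sum>i\<in>rep ` A. q i * (f i * f' i) * of_nat (deg i))"
  by (simp add: central_mult full_trace_blocks block_trace_central)

lemma weighted_trace_form_nondegenerate:
  assumes q: "\<And>i. i \<in> rep ` A \<Longrightarrow> q i \<noteq> 0"
  shows "nondeg_assoc_sym_form scale center (\<lambda>x y. full_trace (central q * (x * y)))"
  unfolding nondeg_assoc_sym_form_def
proof (intro conjI ballI allI impI)
  fix x y z :: 'h and c
  show "full_trace (central q * ((x + y) * z)) = full_trace (central q * (x * z)) + full_trace (central q * (y * z))"
    by (simp add: algebra_simps lin_add[OF lin_full_trace_self])
  show "full_trace (central q * (scale c x * y)) = c * full_trace (central q * (x * y))"
    by (simp add: scale_mult_left scale_mult_right lin_scale[OF lin_full_trace_self])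
  show "full_trace (central q * (x * y)) = full_trace (central q * (y * x))" if "x \<in> center"
    using that by (simp add: center_def)
  show "full_trace (central q * (x * y * z)) = full_trace (central q * (x * (y * z)))"
    by (simp add: mult.assoc)
next
  fix x :: 'h assume x: "x \<in> center" and zero: "\<forall>y\<in>center. full_trace (central q * (x * y)) = 0"
  obtain f where f: "x = central f" using x by (auto simp: center_eq)
  have "f i = 0" if i: "i \<in> rep ` A" for i
  proof -
    let ?e = "\<lambda>l. if l = i then 1 else 0"
    have "0 = full_trace (central q * (central f * central ?e))"
      using zero central_in_center[of ?e] f by simp
    also have "\<dots> = (\<Sum>l\<in>rep ` A. if l = i then q i * f i * of_nat (deg i) else 0)"
      unfolding weighted_trace_form by (intro sum.cong refl) simp
    also have "\<dots> = q i * f i * of_nat (deg i)" using i finite_A by simp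
    finally show ?thesis using q[OF i] deg_pos[OF i] by simp
  qed
  then show "x = 0" unfolding f central_zero[symmetric] central_eq_iff by blast
qed

lemma casimir_weighted_trace_form:
  assumes q: "\<And>i. i \<in> rep ` A \<Longrightarrow> q i \<noteq> 0"
  shows "casimir scale center (\<lambda>x y. full_trace (central q * (x * y))) = central (\<lambda>i. inverse (q i * of_nat (deg i)))"
proof -
  define m where "m = card (rep ` A)"
  obtain en where en: "bij_betw en {..<m} (rep ` A)"
    using ex_bij_betw_nat_finite[OF finite_imageI[OF finite_A, of rep]]
    unfolding atLeast0LessThan m_def by blast
  let ?s = "\<lambda>i. inverse (q i * of_nat (deg i))"
  let ?r = "\<lambda>j. central (\<lambda>i. if i = en j then 1 else 0)"
  let ?l = "\<lambda>j. central (\<lambda>i. if i = en j then ?s i else 0)"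
  have s0: "?s i \<noteq> 0" if "i \<in> rep ` A" for i using q[OF that] deg_pos[OF that] by simp
  have enA: "en j \<in> rep ` A" if "j < m" for j using en that by (auto simp: bij_betw_def)
  have en_eq: "en j = en l \<longleftrightarrow> j = l" if "j < m" "l < m" for j l
    using en that by (auto simp: bij_betw_def inj_on_def)
  have "dual_bases scale center (\<lambda>x y. full_trace (central q * (x * y))) m ?r ?l"
    unfolding dual_bases_def
  proof (intro conjI allI impI)
    show "inj_on ?r {..<m}" "is_basis scale center (?r ` {..<m})"
      using central_basis[OF en, of "\<lambda>i. 1"] by simp_all
    show "inj_on ?l {..<m}" "is_basis scale center (?l ` {..<m})"
      using central_basis[OF en s0] by simp_all
    fix j l assume jl: "j < m" "l < m"
    have "full_trace (central q * (?r j * ?l l))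
        = (\<Sum>i\<in>rep ` A. if i = en j then (if j = l then 1 else 0) else 0)"
      unfolding weighted_trace_form
    proof (intro sum.cong refl)
      fix i assume i: "i \<in> rep ` A"
      show "q i * ((if i = en j then 1 else 0) * (if i = en l then ?s i else 0)) * of_nat (deg i)
          = (if i = en j then (if j = l then 1 else 0) else 0)"
        using q[OF i] deg_pos[OF i] en_eq[OF jl] by (auto simp: field_simps)
    qed
    also have "\<dots> = (if j = l then 1 else 0)" using enA[OF jl(1)] finite_A by simp
    finally show "full_trace (central q * (?r j * ?l l)) = (if j = l then 1 else 0)" .
  qed
  then have "casimir scale center (\<lambda>x y. full_trace (central q * (x * y))) = (\<Sum>j<m. ?r j * ?l j)"
    by (rule casimir_eqI[rotated]) (rule weighted_trace_form_nondegenerate, rule q)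
  also have "\<dots> = central (\<lambda>i. \<Sum>j<m. (if i = en j then 1 else 0) * (if i = en j then ?s i else 0))"
    by (simp only: central_mult central_sum)
  also have "\<dots> = central ?s"
  proof (rule central_cong)
    fix i assume "i \<in> rep ` A"
    then obtain l where l: "l < m" "i = en l" using en by (auto simp: bij_betw_def)
    have "(\<Sum>j<m. (if i = en j then 1 else 0) * (if i = en j then ?s i else 0)) = (\<Sum>j<m. if j = l then ?s i else 0)"
      by (intro sum.cong refl) (use l en_eq in auto)
    then show "(\<Sum>j<m. (if i = en j then 1 else 0) * (if i = en j then ?s i else 0)) = ?s i" using l by simp
  qed
  finally show ?thesis .
qed

end

context semisimple_hopf
begin

lemma twist_eq: "twist = central (\<lambda>i. inverse (of_nat (deg i)))"
proof -
  have "twist * h = h * twist" for h using antipode_square_twist[of h] by (simp add: antipode_involutive)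
  then have "twist \<in> center" by (simp add: center_def)
  then obtain f where f: "twist = central f" by (auto simp: center_eq)
  have "f i = inverse (of_nat (deg i))" if "i \<in> rep ` A" for i
    using block_trace_twist[OF that] deg_pos[OF that] by (simp add: f block_trace_central field_simps)
  then show ?thesis unfolding f by (rule central_cong)
qed

lemma twist_power: "twist ^ n = central (\<lambda>i. inverse (of_nat (deg i)) ^ n)"
  by (simp add: twist_eq central_power)

lemma twist_commute: "twist * x = x * twist" by (simp only: twist_eq central_commute)

lemma twist_inv_eq: "twist_inv = central (\<lambda>i. of_nat (deg i))"
proof -
  have "twist * central (\<lambda>i. of_nat (deg i)) = central (\<lambda>i. 1)"
    unfolding twist_eq central_mult by (rule central_cong) (use deg_pos in auto)
  then have "twist_inv * (twist * central (\<lambda>i. of_nat (deg i))) = twist_inv" by (simp add: central_one)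
  then show ?thesis by (simp add: twist_inv_assoc)
qed

lemma cointegral_eq_regular_char: "cointegral = regular_char scale"
  by (rule ext) (simp add: cointegral_def twist_inv_eq regular_char_trace)

text \<open>In \<open>\<Sum> E a b w E c e w y E b a E e c\<close> only the terms with \<open>c = b\<close> and \<open>e = a\<close> survive, and they
  add up to \<open>w\<^sup>2 \<Sum> a y b\<close>.\<close>

lemma double_averaging: "sw \<Lambda> (\<lambda>a b. sw \<Lambda> (\<lambda>c e. a * c * y * (S b * S e))) = twist ^ 2 * y"
proof -
  have "sw \<Lambda> (\<lambda>a b. sw \<Lambda> (\<lambda>c e. a * c * y * (S b * S e)))
      = (\<Sum>a\<in>A. \<Sum>b\<in>A. sw \<Lambda> (\<lambda>c e. E a b * twist * c * y * (E b a * S e)))"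
    by (intro integral_tensor[where sW = scale and B = "\<lambda>p q. sw \<Lambda> (\<lambda>c e. p * c * y * (q * S e))"] cointegral_intros)
  also have "\<dots> = (\<Sum>a\<in>A. \<Sum>b\<in>A. \<Sum>c\<in>A. \<Sum>e\<in>A. E a b * twist * (E c e * twist) * y * (E b a * E e c))"
    by (intro sum.cong refl integral_tensor[where sW = scale] cointegral_intros)
  also have "\<dots> = (\<Sum>a\<in>A. \<Sum>b\<in>A. twist ^ 2 * (a * y * b))"
  proof (intro sum.cong refl)
    fix a b assume ab: "a \<in> A" "b \<in> A"
    have summand: "E a b * twist * (E c e * twist) * y * (E b a * E e c)
        = (if c = b then if e = a then twist ^ 2 * (a * y * b) else 0 else 0)" if ce: "c \<in> A" "e \<in> A" for c e
    proof -
      have ab_twist: "E a b * twist = twist * E a b" and ce_twist: "E c e * twist = twist * E c e" by (rule twist_commute[symmetric])+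
      have "E a b * twist * (E c e * twist) * y * (E b a * E e c) = twist * E a b * (twist * E c e) * y * (E b a * E e c)"
        by (simp only: ab_twist ce_twist)
      also have "\<dots> = twist * (E a b * twist) * (E c e * y * (E b a * E e c))" by (simp only: mult.assoc)
      also have "\<dots> = twist * twist * ((E a b * E c e) * y * (E b a * E e c))" by (simp only: ab_twist mult.assoc)
      finally have "E a b * twist * (E c e * twist) * y * (E b a * E e c) = twist * twist * ((E a b * E c e) * y * (E b a * E e c))" .
      moreover have "(E a b * E c e) * y * (E b a * E e c) = (if c = b then if e = a then a * y * b else 0 else 0)"
      proof (cases "rep a = rep b")
        case True
        note rab = True
        show ?thesis
        proof (cases "rep c = rep e")
          case True
          then show ?thesis
            unfolding E_mult[OF ab ce rab True] E_mult[OF ab(2,1) ce(2,1) rab[symmetric] True[symmetric]]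
            using ab by (auto simp: E_diag)
        next
          case False
          then have "\<not> (c = b \<and> e = a)" using rab by auto
          then show ?thesis using E_off[OF ce False] by auto
        qed
      next
        case False
        then have "a * y * b = 0" using corner_coef[OF ab] coef_off by simp
        then show ?thesis using E_off[OF ab False] by simp
      qed
      ultimately show ?thesis by (simp add: power2_eq_square)
    qed
    have "(\<Sum>c\<in>A. \<Sum>e\<in>A. E a b * twist * (E c e * twist) * y * (E b a * E e c))
        = (\<Sum>c\<in>A. \<Sum>e\<in>A. if c = b then if e = a then twist ^ 2 * (a * y * b) else 0 else 0)"
      by (intro sum.cong refl summand)
    also have "\<dots> = (\<Sum>c\<in>A. if c = b then twist ^ 2 * (a * y * b) else 0)"
      by (intro sum.cong refl) (use finite_A ab in simp)
    also have "\<dots> = twist ^ 2 * (a * y * b)" using finite_A ab by simp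
    finally show "(\<Sum>c\<in>A. \<Sum>e\<in>A. E a b * twist * (E c e * twist) * y * (E b a * E e c)) = twist ^ 2 * (a * y * b)" .
  qed
  also have "\<dots> = twist ^ 2 * (\<Sum>A * y * \<Sum>A)"
    by (simp only: sum_distrib_left sum_distrib_right) (subst sum.swap, rule refl)
  finally show ?thesis by (simp add: sum_A)
qed

text \<open>The two outermost copies of \<open>\<Lambda>\<close> enclose the product of the first legs of the others, as
  in \<open>double_averaging\<close>.\<close>

lemma z_elem_step: "z_elem \<Delta> S \<Lambda> (Suc (Suc n)) = twist ^ 2 * z_elem \<Delta> S \<Lambda> n"
proof -
  let ?P = "\<lambda>xs. prod_list (map fst xs)" and ?R = "\<lambda>xs. prod_list (map (S \<circ> snd) xs)"
  have concat_sum: "(\<Sum>xs\<leftarrow>concat (map (\<lambda>ys. map (\<lambda>y. y # ys) L) M). F xs) = (\<Sum>ys\<leftarrow>M. \<Sum>y\<leftarrow>L. F (y # ys))"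
    for L and M :: "('h \<times> 'h) list list" and F :: "('h \<times> 'h) list \<Rightarrow> 'h"
    by (induction M) (simp_all add: o_def)
  have "z_elem \<Delta> S \<Lambda> (Suc (Suc n))
      = (\<Sum>xs\<leftarrow>List.n_lists n (\<Delta> \<Lambda>). \<Sum>q\<leftarrow>\<Delta> \<Lambda>. \<Sum>p\<leftarrow>\<Delta> \<Lambda>. ?P (p # q # xs) * ?R (p # q # xs))"
    unfolding z_elem_def by (simp only: n_lists.simps concat_sum)
  also have "\<dots> = (\<Sum>xs\<leftarrow>List.n_lists n (\<Delta> \<Lambda>). twist ^ 2 * (?P xs * ?R xs))"
  proof (rule arg_cong[where f = sum_list], rule map_cong[OF refl])
    fix xs
    have "(\<Sum>q\<leftarrow>\<Delta> \<Lambda>. \<Sum>p\<leftarrow>\<Delta> \<Lambda>. ?P (p # q # xs) * ?R (p # q # xs))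
        = sw \<Lambda> (\<lambda>c e. sw \<Lambda> (\<lambda>a b. a * c * ?P xs * (S b * S e) * ?R xs))"
      by (simp add: sw_def case_prod_unfold mult.assoc)
    also have "\<dots> = sw \<Lambda> (\<lambda>a b. sw \<Lambda> (\<lambda>c e. a * c * ?P xs * (S b * S e) * ?R xs))"
      by (rule sw_swap)
    also have "\<dots> = sw \<Lambda> (\<lambda>a b. sw \<Lambda> (\<lambda>c e. a * c * ?P xs * (S b * S e)) * ?R xs)"
      by (intro sw_cong sw_apply[where sV = scale and sW = scale and f = "\<lambda>t. t * ?R xs", symmetric] cointegral_intros)
    also have "\<dots> = sw \<Lambda> (\<lambda>a b. sw \<Lambda> (\<lambda>c e. a * c * ?P xs * (S b * S e))) * ?R xs"
      by (intro sw_apply[where sV = scale and sW = scale and f = "\<lambda>t. t * ?R xs", symmetric] cointegral_intros)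
    also have "\<dots> = twist ^ 2 * ?P xs * ?R xs" by (simp only: double_averaging)
    finally show "(\<Sum>q\<leftarrow>\<Delta> \<Lambda>. \<Sum>p\<leftarrow>\<Delta> \<Lambda>. ?P (p # q # xs) * ?R (p # q # xs)) = twist ^ 2 * (?P xs * ?R xs)"
      by (simp only: mult.assoc)
  qed
  also have "\<dots> = twist ^ 2 * z_elem \<Delta> S \<Lambda> n"
    unfolding z_elem_def by (rule sum_list_const_mult)
  finally show ?thesis .
qed

lemma z_elem_eq: "z_elem \<Delta> S \<Lambda> n = twist ^ (n - n mod 2)"
proof (induction n rule: induct_nat_012)
  case 0
  show ?case by (simp add: z_elem_def)
next
  case 1
  have "z_elem \<Delta> S \<Lambda> 1 = sw \<Lambda> (\<lambda>a b. a * S b)"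
    by (simp add: z_elem_def sw_def case_prod_unfold o_def)
  then show ?case by (simp add: averaging_one)
next
  case (ge2 n)
  have "Suc (Suc n) - Suc (Suc n) mod 2 = 2 + (n - n mod 2)"
    using mod_less_eq_dividend[of n 2] by simp
  then show ?case by (simp only: z_elem_step ge2 power_add)
qed

lemma cointegral_dual_flip: "sw \<Lambda> (\<lambda>a b. scale (cointegral (z * b)) (S a)) = z"
proof -
  have "sw \<Lambda> (\<lambda>a b. scale (cointegral (z * b)) a) = sw \<Lambda> (\<lambda>a b. scale (cointegral b) (S z * a))"
    by (intro integral_move_left[where sW = scale and B = "\<lambda>a b. scale (cointegral b) a"] cointegral_intros)
  also have "\<dots> = sw \<Lambda> (\<lambda>a b. S z * scale (cointegral b) a)" by (simp only: scale_mult_right)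
  also have "\<dots> = S z * modular" unfolding modular_def
    by (intro sw_apply[where sV = scale and sW = scale, symmetric] cointegral_intros)
  finally have "S (sw \<Lambda> (\<lambda>a b. scale (cointegral (z * b)) a)) = z" by (simp add: modular_eq_one antipode_involutive)
  moreover have "S (sw \<Lambda> (\<lambda>a b. scale (cointegral (z * b)) a)) = sw \<Lambda> (\<lambda>a b. S (scale (cointegral (z * b)) a))"
    by (rule sw_apply[OF antipode_linear])
  ultimately show ?thesis by (simp add: lin_scale[OF antipode_linear])
qed

text \<open>Both \<open>\<Lambda>\<^sub>1 \<otimes> S \<Lambda>\<^sub>2\<close> and \<open>\<Lambda>\<^sub>2 \<otimes> S \<Lambda>\<^sub>1\<close> consist of dual bases for \<open>\<lambda>\<close>.\<close>

lemma integral_cocommutative: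
  assumes B: "bilin sW B" shows "sw \<Lambda> (\<lambda>a b. B b (S a)) = sw \<Lambda> (\<lambda>a b. B a (S b))"
proof -
  note L = cointegral_intros bilin1[OF B] bilin2[OF B]
  have "sw \<Lambda> (\<lambda>a b. B b (S a)) = sw \<Lambda> (\<lambda>a b. B (sw \<Lambda> (\<lambda>c e. scale (cointegral (S e * b)) c)) (S a))"
    by (simp only: cointegral_dual')
  also have "\<dots> = sw \<Lambda> (\<lambda>a b. sw \<Lambda> (\<lambda>c e. B (scale (cointegral (S e * b)) c) (S a)))"
    by (intro sw_cong sw_apply[where sV = scale and sW = sW] L)
  also have "\<dots> = sw \<Lambda> (\<lambda>c e. sw \<Lambda> (\<lambda>a b. B (scale (cointegral (S e * b)) c) (S a)))"
    by (rule sw_swap)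
  also have "\<dots> = sw \<Lambda> (\<lambda>c e. sw \<Lambda> (\<lambda>a b. B c (scale (cointegral (S e * b)) (S a))))"
    by (simp only: bilin_scale1[OF B] bilin_scale2[OF B])
  also have "\<dots> = sw \<Lambda> (\<lambda>c e. B c (sw \<Lambda> (\<lambda>a b. scale (cointegral (S e * b)) (S a))))"
    by (intro sw_cong sw_apply[where sV = scale and sW = sW, symmetric] L)
  also have "\<dots> = sw \<Lambda> (\<lambda>c e. B c (S e))" by (simp only: cointegral_dual_flip)
  finally show ?thesis .
qed

text \<open>The antipode reverses the product \<open>\<Lambda>\<^sub>1 \<Lambda>'\<^sub>1 S \<Lambda>\<^sub>2 S \<Lambda>'\<^sub>2 = w\<^sup>2\<close>, and cocommutativity of
  \<open>\<Lambda>\<close> restores it. The Frobenius map contains an antipode, which disappears by this invariance.\<close>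

lemma antipode_twist_square: "S (twist ^ 2) = twist ^ 2"
proof -
  have w2: "twist ^ 2 = sw \<Lambda> (\<lambda>a b. sw \<Lambda> (\<lambda>c e. a * c * (S b * S e)))"
    using double_averaging[of 1] by simp
  have "S (twist ^ 2) = sw \<Lambda> (\<lambda>a b. S (sw \<Lambda> (\<lambda>c e. a * c * (S b * S e))))"
    unfolding w2 by (rule sw_apply[OF antipode_linear])
  also have "\<dots> = sw \<Lambda> (\<lambda>a b. sw \<Lambda> (\<lambda>c e. S (a * c * (S b * S e))))"
    by (intro sw_cong sw_apply[OF antipode_linear])
  also have "\<dots> = sw \<Lambda> (\<lambda>a b. sw \<Lambda> (\<lambda>c e. e * b * (S c * S a)))"
    by (simp only: antipode_mult antipode_involutive)
  also have "\<dots> = sw \<Lambda> (\<lambda>a b. sw \<Lambda> (\<lambda>c e. c * b * (S e * S a)))"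
    by (intro sw_cong integral_cocommutative[where sW = scale and B = "\<lambda>p q. p * b * (q * S a)" for b a] cointegral_intros)
  also have "\<dots> = sw \<Lambda> (\<lambda>a b. sw \<Lambda> (\<lambda>c e. c * a * (S e * S b)))"
    by (intro integral_cocommutative[where sW = scale and B = "\<lambda>p q. sw \<Lambda> (\<lambda>c e. c * p * (S e * q))"] cointegral_intros)
  also have "\<dots> = twist ^ 2" unfolding w2 by (rule sw_swap)
  finally show ?thesis .
qed

lemma antipode_twist_even_power: "S (twist ^ (2 * m)) = twist ^ (2 * m)"
proof (induction m)
  case (Suc m)
  have "twist ^ (2 * Suc m) = twist ^ (2 * m) * twist ^ 2" by (simp flip: power_add)
  then show ?case using Suc
    by (simp only: antipode_mult antipode_twist_square) (simp flip: power_add)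
qed (simp add: antipode_one)

lemma frob_map_eq: "frob_map scale S h = (\<lambda>x. cointegral (S h * x))"
  by (simp add: frob_map_def dual_act_def cointegral_eq_regular_char)

lemma frob_map_inv_eq: "frob_map_inv scale \<Delta> \<Lambda> (\<lambda>x. cointegral (z * x)) = S z"
proof -
  have "S (sw \<Lambda> (\<lambda>a b. scale (cointegral (z * a)) b)) = z" by (rule antipode_cointegral_dual)
  then have "sw \<Lambda> (\<lambda>a b. scale (cointegral (z * a)) b) = S z" using antipode_involutive by metis
  then show ?thesis by (simp add: frob_map_inv_def sw_def)
qed

text \<open>The Frobenius map and its inverse reverse products, so the factors change places.\<close>

lemma convolution_eq:
  "convolution scale \<Delta> S \<Lambda> d (\<lambda>x. cointegral (y * x)) (\<lambda>x. cointegral (z * x)) = (\<lambda>x. cointegral (scale (of_nat d) (z * y) * x))"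
  unfolding convolution_def frob_map_inv_eq frob_map_eq
  by (simp add: antipode_mult antipode_involutive scale_mult_left lin_scale[OF lin_cointegral_self])

lemma f_rob_eq: "f_rob scale d = (\<lambda>x. cointegral (scale (of_nat d) (twist ^ 2) * x))"
proof
  fix x
  have "f_rob scale d x = full_trace (central (\<lambda>i. of_nat d / of_nat (deg i)) * x)"
    unfolding f_rob_def by (rule sum_irr_chars_trace)
  also have "central (\<lambda>i. of_nat d / of_nat (deg i)) = twist_inv * scale (of_nat d) (twist ^ 2)"
    unfolding twist_power twist_inv_eq central_scale central_mult
    by (rule central_cong) (use deg_pos in \<open>auto simp: field_simps power2_eq_square\<close>)
  finally show "f_rob scale d x = cointegral (scale (of_nat d) (twist ^ 2) * x)" by (simp add: cointegral_def mult.assoc)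
qed

text \<open>Each of the \<open>m + 1\<close> factors contributes \<open>d w\<^sup>2\<close>, and each of the \<open>m\<close> products another \<open>d\<close>.\<close>

lemma convolution_power_eq:
  "convolution_power scale \<Delta> S \<Lambda> d (f_rob scale d) (Suc m)
    = (\<lambda>x. of_nat d ^ (2 * m + 1) * cointegral (twist ^ (2 * m + 2) * x))"
proof -
  let ?u = "scale (of_nat d) (twist ^ 2)"
  have "(convolution scale \<Delta> S \<Lambda> d (f_rob scale d) ^^ m) (f_rob scale d)
      = (\<lambda>x. cointegral (scale (of_nat d ^ (2 * m + 1)) (twist ^ (2 * m + 2)) * x))"
  proof (induction m)
    case 0
    show ?case by (simp add: f_rob_eq power2_eq_square)
  next
    case (Suc m)
    have "(convolution scale \<Delta> S \<Lambda> d (f_rob scale d) ^^ Suc m) (f_rob scale d)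
        = convolution scale \<Delta> S \<Lambda> d (\<lambda>x. cointegral (?u * x)) (\<lambda>x. cointegral (scale (of_nat d ^ (2 * m + 1)) (twist ^ (2 * m + 2)) * x))"
      by (simp only: funpow.simps o_apply Suc) (simp only: f_rob_eq)
    also have "\<dots> = (\<lambda>x. cointegral (scale (of_nat d) (scale (of_nat d ^ (2 * m + 1)) (twist ^ (2 * m + 2)) * ?u) * x))"
      by (rule convolution_eq)
    also have "scale (of_nat d) (scale (of_nat d ^ (2 * m + 1)) (twist ^ (2 * m + 2)) * ?u)
        = scale (of_nat d ^ (2 * Suc m + 1)) (twist ^ (2 * Suc m + 2))"
      by (simp add: scale_mult_left scale_mult_right power_add[symmetric] mult_ac)
    finally show ?case .
  qed
  then show ?thesis
    by (simp add: convolution_power_def scale_mult_left lin_scale[OF lin_cointegral_self])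
qed

lemma t_char_eq: "t_char scale n = (\<lambda>x. full_trace (central (\<lambda>i. of_nat (deg i) ^ (n - 1 - n mod 2)) * x))"
  unfolding t_char_def by (rule ext) (rule sum_irr_chars_trace)

lemma beta_Z_nondegenerate: "nondeg_assoc_sym_form scale center (beta_Z scale n)"
  unfolding beta_Z_def t_char_eq
  by (rule weighted_trace_form_nondegenerate) (use deg_pos in auto)

lemma casimir_Z_eq:
  assumes "n \<ge> 2" shows "casimir_Z scale n = twist ^ (n - n mod 2)"
proof -
  let ?k = "n - 1 - n mod 2"
  have k: "n - n mod 2 = Suc ?k" using assms by (cases "even n") (auto simp: odd_iff_mod_2_eq_one)
  have "casimir_Z scale n = central (\<lambda>i. inverse (of_nat (deg i) ^ ?k * of_nat (deg i)))"
    unfolding casimir_Z_def beta_Z_def t_char_eq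
    by (rule casimir_weighted_trace_form) (use deg_pos in auto)
  then show ?thesis unfolding k twist_power by (simp add: power_inverse mult.commute)
qed

lemma t_char_two: "t_char scale 2 = regular_char scale"
  by (rule ext) (simp add: t_char_eq regular_char_trace)

end

theorem corollary3p5:
  fixes scale :: "'k::{alg_closed_field, field_char_0} \<Rightarrow> 'h::ring_1 \<Rightarrow> 'h"
    and \<Delta> :: "'h \<Rightarrow> ('h \<times> 'h) list"
    and \<epsilon> :: "'h \<Rightarrow> 'k"
    and S :: "'h \<Rightarrow> 'h"
    and \<Lambda> :: 'h
    and d n :: nat
  assumes hopf: "hopf_algebra scale \<Delta> \<epsilon> S"
    and dim: "has_dimension scale d"
    and semisimple: "semisimple_ring TYPE('h)"
    and integral: "idempotent_integral scale \<epsilon> \<Lambda>"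
    and n: "n \<ge> 2"
  shows "nondeg_assoc_sym_form scale center (beta_Z scale n)
    \<and> casimir_Z scale n = z_elem \<Delta> S \<Lambda> n
    \<and> (\<lambda>h. of_nat d ^ (n - 1) * frob_map scale S (casimir_Z scale n) h)
        = (\<lambda>h. of_nat d ^ (n mod 2) *
             convolution_power scale \<Delta> S \<Lambda> d (f_rob scale d) ((n - n mod 2) div 2) h)
    \<and> (\<lambda>h. of_nat d ^ (n mod 2) *
             convolution_power scale \<Delta> S \<Lambda> d (f_rob scale d) ((n - n mod 2) div 2) h)
        = (\<lambda>h. \<Sum>\<chi>\<in>irr_chars scale.
             of_nat d ^ (n - 1) / of_nat (char_degree scale \<chi>) ^ (n - 1 - n mod 2) * \<chi> h)
    \<and> t_char scale 2 = regular_char scale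
    \<and> casimir_Z scale 2 = z_elem \<Delta> S \<Lambda> 2"
proof -
  interpret hopf_algebra scale \<Delta> \<epsilon> S by (fact hopf)
  interpret semisimple_algebra scale d by unfold_locales (fact dim, fact semisimple)
  obtain A rep E where units: "matrix_units scale d A rep E" using matrix_units_exist by blast
  interpret matrix_units scale d A rep E by (fact units)
  interpret semisimple_hopf scale \<Delta> \<epsilon> S d A rep E \<Lambda> by unfold_locales (fact integral)
  \<comment> \<open>There is at least one convolution factor, because \<open>n \<ge> 2\<close>.\<close>
  obtain m where m: "n - n mod 2 = 2 * m + 2"
  proof -
    have "n - n mod 2 = 2 * (n div 2)" by (simp add: minus_mod_eq_mult_div)
    also have "\<dots> = 2 * (n div 2 - 1) + 2" using n by simp
    finally show ?thesis by (rule that)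
  qed
  have k: "n - 1 - n mod 2 = 2 * m + 1" and n1: "n - 1 = n mod 2 + (2 * m + 1)" using m by auto
  have div: "(n - n mod 2) div 2 = Suc m" using m by simp
  have conv: "of_nat d ^ (n mod 2) * convolution_power scale \<Delta> S \<Lambda> d (f_rob scale d) ((n - n mod 2) div 2) h
      = of_nat d ^ (n - 1) * cointegral (twist ^ (2 * m + 2) * h)" for h
    unfolding div convolution_power_eq n1 by (simp add: power_add mult.assoc)
  have frob: "frob_map scale S (casimir_Z scale n) h = cointegral (twist ^ (2 * m + 2) * h)" for h
    using antipode_twist_even_power[of "m + 1"] by (simp add: frob_map_eq casimir_Z_eq[OF n] m)
  have chars: "of_nat d ^ (n - 1) * cointegral (twist ^ (2 * m + 2) * h)
      = (\<Sum>\<chi>\<in>irr_chars scale. of_nat d ^ (n - 1) / of_nat (char_degree scale \<chi>) ^ (n - 1 - n mod 2) * \<chi> h)" for h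
  proof -
    have "(\<Sum>\<chi>\<in>irr_chars scale. of_nat d ^ (n - 1) / of_nat (char_degree scale \<chi>) ^ (n - 1 - n mod 2) * \<chi> h)
        = full_trace (central (\<lambda>i. of_nat d ^ (n - 1) / of_nat (deg i) ^ (n - 1 - n mod 2)) * h)"
      by (rule sum_irr_chars_trace)
    also have "central (\<lambda>i. of_nat d ^ (n - 1) / of_nat (deg i) ^ (n - 1 - n mod 2))
        = scale (of_nat d ^ (n - 1)) (twist_inv * twist ^ (2 * m + 2))"
      unfolding twist_power twist_inv_eq central_scale central_mult k
      by (rule central_cong) (use deg_pos in \<open>auto simp: field_simps power_inverse\<close>)
    finally show ?thesis
      by (simp add: cointegral_def scale_mult_left mult.assoc lin_scale[OF lin_full_trace_self])
  qed
  show ?thesis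
  proof (intro conjI)
    show "casimir_Z scale n = z_elem \<Delta> S \<Lambda> n" by (simp only: casimir_Z_eq[OF n] z_elem_eq)
    show "casimir_Z scale 2 = z_elem \<Delta> S \<Lambda> 2" by (simp only: casimir_Z_eq[OF order_refl] z_elem_eq)
    show "(\<lambda>h. of_nat d ^ (n - 1) * frob_map scale S (casimir_Z scale n) h)
        = (\<lambda>h. of_nat d ^ (n mod 2) *
             convolution_power scale \<Delta> S \<Lambda> d (f_rob scale d) ((n - n mod 2) div 2) h)"
      by (simp only: conv frob)
    show "(\<lambda>h. of_nat d ^ (n mod 2) *
             convolution_power scale \<Delta> S \<Lambda> d (f_rob scale d) ((n - n mod 2) div 2) h)
        = (\<lambda>h. \<Sum>\<chi>\<in>irr_chars scale.
             of_nat d ^ (n - 1) / of_nat (char_degree scale \<chi>) ^ (n - 1 - n mod 2) * \<chi> h)"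
      by (simp only: conv chars)
  qed (fact beta_Z_nondegenerate t_char_two)+
qed

end
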